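(* Let $F$ be either a number field or a field of characteristic different from $2$ that is finitely generated of transcendence degree at least one over a subfield. Let $E/F$ be an infinite Galois extension. Then $E_{\mathrm{pyth}}$ and $E_{\mathrm{quad}}$ are both hereditarily non-pythagorean.
   Context: A number field is a finite extension of $\mathbb{Q}$. A field $K$ is pythagorean if every sum of squares of elements of $K$ is a square in $K$. For a field $E$, inside a fixed algebraic closure of $E$, the pythagorean closure $E_{\mathrm{pyth}}$ is the direct limit (union) of all finite extensions of $E$ obtained by finite chains of quadratic extensions, each given by adjoining a square root of a sum of two squares of the preceding field; the quadratic closure $E_{\mathrm{quad}}$ is the direct limit (union) of all finite extensions of $E$ obtained by finite chains of quadratic extensions, each given by adjoining a square root of an arbitrary element of the preceding field. A field $k$ is hereditarily non-pythagorean if every proper finite extension $K/k$ that is not purely inseparable is non-pythagorean. *)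

theory Defs
  imports
    "HOL-Library.FuncSet"
    "HOL-Library.Extended_Nat"
    "HOL-Computational_Algebra.Computational_Algebra"
begin

text \<open>
  Fields are represented as subfields, that is, as subsets of the universe of a type of class
  \<open>field\<close>. Several fields and the extensions between them can thus live in one ambient field.
\<close>

definition is_subfield :: "'a::field set \<Rightarrow> bool" where
  "is_subfield K \<longleftrightarrow>
     0 \<in> K \<and> 1 \<in> K \<and>
     (\<forall>x\<in>K. \<forall>y\<in>K. x + y \<in> K \<and> x * y \<in> K) \<and>
     (\<forall>x\<in>K. - x \<in> K \<and> inverse x \<in> K)"

definition generated_subfield :: "'a::field set \<Rightarrow> 'a set" where
  "generated_subfield S = \<Inter>{K. is_subfield K \<and> S \<subseteq> K}"

definition field_extension :: "'a::field set \<Rightarrow> 'a set \<Rightarrow> bool" where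
  "field_extension k K \<longleftrightarrow> is_subfield k \<and> is_subfield K \<and> k \<subseteq> K"

definition finite_extension :: "'a::field set \<Rightarrow> 'a set \<Rightarrow> bool" where
  "finite_extension k K \<longleftrightarrow>
     field_extension k K \<and>
     (\<exists>B\<subseteq>K. finite B \<and> (\<forall>x\<in>K. \<exists>c. c ` B \<subseteq> k \<and> x = (\<Sum>b\<in>B. c b * b)))"

definition poly_over :: "'a::field set \<Rightarrow> 'a poly \<Rightarrow> bool" where
  "poly_over k p \<longleftrightarrow> (\<forall>i. coeff p i \<in> k)"

definition algebraic_extension :: "'a::field set \<Rightarrow> 'a set \<Rightarrow> bool" where
  "algebraic_extension k K \<longleftrightarrow>
     field_extension k K \<and> (\<forall>x\<in>K. \<exists>p. p \<noteq> 0 \<and> poly_over k p \<and> poly p x = 0)"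

definition is_min_poly :: "'a::field set \<Rightarrow> 'a \<Rightarrow> 'a poly \<Rightarrow> bool" where
  "is_min_poly k x p \<longleftrightarrow>
     poly_over k p \<and> lead_coeff p = 1 \<and> poly p x = 0 \<and>
     (\<forall>q. q \<noteq> 0 \<longrightarrow> poly_over k q \<longrightarrow> poly q x = 0 \<longrightarrow> degree p \<le> degree q)"

text \<open>
  The ambient field is required to be algebraically closed here, so that \<open>rsquarefree p\<close> (no
  multiple root in the ambient field) says that \<open>p\<close> has no multiple root in an algebraic closure.
\<close>

definition separable_extension :: "'a::alg_closed_field set \<Rightarrow> 'a set \<Rightarrow> bool" where
  "separable_extension k K \<longleftrightarrow>
     algebraic_extension k K \<and> (\<forall>x\<in>K. \<forall>p. is_min_poly k x p \<longrightarrow> rsquarefree p)"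

definition normal_extension :: "'a::field set \<Rightarrow> 'a set \<Rightarrow> bool" where
  "normal_extension k K \<longleftrightarrow>
     algebraic_extension k K \<and>
     (\<forall>x\<in>K. \<forall>p. is_min_poly k x p \<longrightarrow> (\<exists>A. set_mset A \<subseteq> K \<and> p = (\<Prod>a\<in>#A. [:- a, 1:])))"

definition galois_extension :: "'a::alg_closed_field set \<Rightarrow> 'a set \<Rightarrow> bool" where
  "galois_extension k K \<longleftrightarrow> normal_extension k K \<and> separable_extension k K"

text \<open>
  The exponent is a power of the characteristic exponent; hence in characteristic \<open>0\<close> only the
  trivial extension is purely inseparable.
\<close>

definition purely_inseparable_extension :: "'a::field set \<Rightarrow> 'a set \<Rightarrow> bool" where
  "purely_inseparable_extension k K \<longleftrightarrow>
     field_extension k K \<and>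
     (\<forall>x\<in>K. \<exists>n. x ^ ((if CHAR('a) = 0 then 1 else CHAR('a)) ^ n) \<in> k)"

text \<open>The copy of the rational numbers inside an ambient field of characteristic \<open>0\<close>:\<close>

definition rational_subfield :: "'a::field set" where
  "rational_subfield = {of_int a / of_int b | a b. b \<noteq> 0}"

definition number_field :: "'a::field set \<Rightarrow> bool" where
  "number_field K \<longleftrightarrow> CHAR('a) = 0 \<and> finite_extension rational_subfield K"

definition finitely_generated_extension :: "'a::field set \<Rightarrow> 'a set \<Rightarrow> bool" where
  "finitely_generated_extension k K \<longleftrightarrow>
     field_extension k K \<and> (\<exists>S. finite S \<and> K = generated_subfield (k \<union> S))"

text \<open>
  Algebraic independence of a finite set \<open>S\<close>: no polynomial over \<open>k\<close> in variables indexed by \<open>S\<close>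
  vanishes at \<open>S\<close>, except the zero polynomial. The polynomial has coefficient \<open>c e\<close> at the monomial
  with exponents \<open>e\<close>, for \<open>e\<close> in a finite set \<open>M\<close> of functions from \<open>S\<close> to the natural numbers.
\<close>

definition algebraically_independent :: "'a::field set \<Rightarrow> 'a set \<Rightarrow> bool" where
  "algebraically_independent k S \<longleftrightarrow>
     (\<forall>M c. finite M \<longrightarrow> M \<subseteq> (S \<rightarrow>\<^sub>E (UNIV :: nat set)) \<longrightarrow> c ` M \<subseteq> k \<longrightarrow>
        (\<Sum>e\<in>M. c e * (\<Prod>s\<in>S. s ^ e s)) = 0 \<longrightarrow> (\<forall>e\<in>M. c e = 0))"

definition transcendence_degree :: "'a::field set \<Rightarrow> 'a set \<Rightarrow> enat" where
  "transcendence_degree k K =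
     Sup {enat (card S) | S. finite S \<and> S \<subseteq> K \<and> algebraically_independent k S}"

definition pythagorean :: "'a::field set \<Rightarrow> bool" where
  "pythagorean K \<longleftrightarrow> (\<forall>xs. set xs \<subseteq> K \<longrightarrow> (\<exists>y\<in>K. (\<Sum>x\<leftarrow>xs. x\<^sup>2) = y\<^sup>2))"

text \<open>
  Finite chains of quadratic extensions. Outside characteristic \<open>2\<close>, adjoining a square root \<open>s\<close> is
  a quadratic extension precisely if \<open>s\<close> does not already lie in the field.
\<close>

inductive pyth_chain :: "'a::field set \<Rightarrow> 'a set \<Rightarrow> bool" for E where
  base: "pyth_chain E E"
| step: "\<lbrakk>pyth_chain E L; a \<in> L; b \<in> L; s\<^sup>2 = a\<^sup>2 + b\<^sup>2; s \<notin> L\<rbrakk>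
          \<Longrightarrow> pyth_chain E (generated_subfield (insert s L))"

inductive quad_chain :: "'a::field set \<Rightarrow> 'a set \<Rightarrow> bool" for E where
  base: "quad_chain E E"
| step: "\<lbrakk>quad_chain E L; a \<in> L; s\<^sup>2 = a; s \<notin> L\<rbrakk>
          \<Longrightarrow> quad_chain E (generated_subfield (insert s L))"

text \<open>
  The closures are formed inside the ambient field; they are the usual ones if that field contains
  an algebraic closure of \<open>E\<close>.
\<close>

definition pyth_closure :: "'a::alg_closed_field set \<Rightarrow> 'a set" where
  "pyth_closure E = \<Union>{L. pyth_chain E L}"

definition quad_closure :: "'a::alg_closed_field set \<Rightarrow> 'a set" where
  "quad_closure E = \<Union>{L. quad_chain E L}"

definition field_hom_on :: "'a::field set \<Rightarrow> ('a \<Rightarrow> 'b::field) \<Rightarrow> bool" where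
  "field_hom_on k h \<longleftrightarrow>
     h 1 = 1 \<and> (\<forall>x\<in>k. \<forall>y\<in>k. h (x + y) = h x + h y \<and> h (x * y) = h x * h y)"

text \<open>
  The extensions \<open>K\<close> of \<open>k\<close> are abstract: they need not lie in the ambient field of \<open>k\<close>, but are
  fields inside another type \<open>'b\<close>, and \<open>k\<close> is identified with its image under an embedding \<open>h\<close>.
  A definition cannot quantify over types, so \<open>'b\<close> is a parameter; a theorem stated for a type
  variable \<open>'b\<close> covers all extensions.
\<close>

definition hereditarily_non_pythagorean :: "'b::field itself \<Rightarrow> 'a::field set \<Rightarrow> bool" where
  "hereditarily_non_pythagorean _ k \<longleftrightarrow>
     (\<forall>(h :: 'a \<Rightarrow> 'b) K.
        field_hom_on k h \<longrightarrow> finite_extension (h ` k) K \<longrightarrow> h ` k \<noteq> K \<longrightarrow>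
        \<not> purely_inseparable_extension (h ` k) K \<longrightarrow> \<not> pythagorean K)"

end

theory Submission
  imports Defs
begin

text \<open>
  Let \<open>N\<close> be one of the two closures. It contains \<open>F\<close> and is mapped into itself by every
  endomorphism of the ambient field over \<open>F\<close>. Suppose a finite extension \<open>M\<close> of \<open>N\<close> is pythagorean and
  not purely inseparable, and let \<open>\<sigma>\<close> be an endomorphism over \<open>N\<close> moving some \<open>\<alpha> \<in> M\<close>. Let \<open>D\<close> be
  generated over \<open>F\<close> by a finite set of roots containing \<open>\<alpha>\<close> and generators of \<open>M / N\<close>, and closed
  under endomorphisms over \<open>F\<close>. Any endomorphism \<open>a\<close> over \<open>D\<close> commutes with \<open>\<sigma>\<close> on \<open>N(D)\<close>, since each
  of \<open>N\<close> and \<open>D\<close> is preserved by both maps and fixed pointwise by one of them. If \<open>z\<^sup>2 = 1 + (s - \<alpha>)\<^sup>2\<close> with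
  \<open>z \<in> M\<close>, then \<open>a z = \<plusminus> z\<close> and therefore \<open>a (\<sigma> z) = \<plusminus> \<sigma> z\<close> with the same sign, so \<open>z \<cdot> \<sigma> z\<close> lies in \<open>D\<close>.
  Hence \<open>(1 + (s - \<alpha>)\<^sup>2) (1 + (s - \<sigma> \<alpha>)\<^sup>2)\<close> is a square in \<open>D\<close> for every \<open>s \<in> F\<close>.

  This is impossible. The field \<open>F\<close>, hence \<open>D\<close>, is finite over the field of fractions of a Euclidean
  ring \<open>A\<close>, namely the integers or a polynomial ring \<open>k[t]\<close>, and for a place of \<open>D\<close> that is unramified
  of degree one over \<open>A\<close> one can choose \<open>s \<in> A\<close> such that the product has valuation one. In
  positive characteristic, odd powers of the characteristic are used as exponents throughout to
  pass to separable elements.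
\<close>

subsection \<open>Subfields and algebraic elements\<close>

text \<open>A pythagorean \<open>M\<close> makes many elements of \<open>D\<close> squares in
  \<open>M\<close>, but the square roots need not lie in \<open>D\<close>, so no valuation of
  \<open>D\<close> is contradicted directly. The conjugate factor repairs this: the sign with which
  \<open>a\<close> acts on \<open>z\<close> occurs twice in the product of \<open>z\<close> and
  \<open>\<sigma> z\<close> and cancels. The price is that two sums of squares must be controlled at
  once. With \<open>\<iota>\<close> a square root of \<open>- 1\<close>, they split into four
  factors \<open>s - x\<close>, where \<open>x\<close> is \<open>\<alpha> + \<iota>\<close>,
  \<open>\<alpha> - \<iota>\<close>, \<open>\<sigma> \<alpha> + \<iota>\<close> or
  \<open>\<sigma> \<alpha> - \<iota>\<close>. Valuation one is reached by letting a single factor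
  have valuation one while the others are units, so one of these elements must differ from the other
  three. Since \<open>\<sigma>\<close> moves \<open>\<alpha>\<close> and \<open>2\<close> is not
  zero, a suitable sign of \<open>\<iota>\<close> achieves this. Integral closures and completions
  are avoided: denominators are cleared by hand, and roots are approximated modulo powers of a prime
  of \<open>A\<close>. Endomorphisms can replace automorphisms because commutation and signs only
  require maps that preserve \<open>N\<close> and a finite set of roots.\<close>

definition is_subring :: "'a::comm_ring_1 set \<Rightarrow> bool" where
  "is_subring A \<longleftrightarrow> 0 \<in> A \<and> 1 \<in> A \<and> (\<forall>x\<in>A. \<forall>y\<in>A. x + y \<in> A \<and> x * y \<in> A) \<and> (\<forall>x\<in>A. - x \<in> A)"

lemma is_subringD:
  assumes "is_subring A"
  shows "0 \<in> A" "1 \<in> A" "x \<in> A \<Longrightarrow> y \<in> A \<Longrightarrow> x + y \<in> A" "x \<in> A \<Longrightarrow> y \<in> A \<Longrightarrow> x * y \<in> A"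
    "x \<in> A \<Longrightarrow> - x \<in> A" "x \<in> A \<Longrightarrow> y \<in> A \<Longrightarrow> x - y \<in> A"
proof -
  show "0 \<in> A" "1 \<in> A" "x \<in> A \<Longrightarrow> y \<in> A \<Longrightarrow> x + y \<in> A" "x \<in> A \<Longrightarrow> y \<in> A \<Longrightarrow> x * y \<in> A"
    "x \<in> A \<Longrightarrow> - x \<in> A"
    using assms unfolding is_subring_def by auto
  show "x \<in> A \<Longrightarrow> y \<in> A \<Longrightarrow> x - y \<in> A"
    using assms unfolding is_subring_def by (metis diff_conv_add_uminus)
qed

lemma is_subring_sum: "is_subring A \<Longrightarrow> (\<And>i. i \<in> I \<Longrightarrow> f i \<in> A) \<Longrightarrow> sum f I \<in> A"
  by (induction I rule: infinite_finite_induct) (auto simp: is_subringD)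

lemma is_subring_prod_list: "is_subring A \<Longrightarrow> (\<And>x. x \<in> set xs \<Longrightarrow> x \<in> A) \<Longrightarrow> prod_list xs \<in> A"
  by (induction xs) (auto simp: is_subringD)

lemma is_subring_power: "is_subring A \<Longrightarrow> x \<in> A \<Longrightarrow> x ^ n \<in> A"
  by (induction n) (auto simp: is_subringD)

lemma is_subring_of_nat: "is_subring A \<Longrightarrow> of_nat n \<in> A"
  by (induction n) (auto simp: is_subringD)

lemma is_subfield_is_subring: "is_subfield K \<Longrightarrow> is_subring K"
  unfolding is_subfield_def is_subring_def by auto

lemmas is_subfieldD = is_subringD[OF is_subfield_is_subring]

lemma is_subfield_inverse: "is_subfield K \<Longrightarrow> x \<in> K \<Longrightarrow> inverse x \<in> K"
  unfolding is_subfield_def by auto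

lemma is_subfield_divide: "is_subfield K \<Longrightarrow> x \<in> K \<Longrightarrow> y \<in> K \<Longrightarrow> x / y \<in> K"
  by (simp add: divide_inverse is_subfieldD is_subfield_inverse)

lemma is_subfieldI:
  assumes "is_subring K" "\<And>x. x \<in> K \<Longrightarrow> x \<noteq> 0 \<Longrightarrow> inverse x \<in> K"
  shows "is_subfield K"
  using assms is_subringD[OF assms(1)] unfolding is_subfield_def
  by (metis inverse_zero)

lemma is_subfield_UNIV: "is_subfield UNIV"
  by (simp add: is_subfield_def)

lemma generated_subfield_superset: "S \<subseteq> generated_subfield S"
  unfolding generated_subfield_def by auto

lemma generated_subfield_minimal: "is_subfield K \<Longrightarrow> S \<subseteq> K \<Longrightarrow> generated_subfield S \<subseteq> K"
  unfolding generated_subfield_def by auto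

lemma is_subfield_generated_subfield: "is_subfield (generated_subfield S)"
  unfolding generated_subfield_def is_subfield_def by auto

lemma generated_subfield_mono: "S \<subseteq> T \<Longrightarrow> generated_subfield S \<subseteq> generated_subfield T"
  unfolding generated_subfield_def by auto

section \<open>Polynomials with coefficients in a subring\<close>

lemma poly_over_pCons [simp]: "poly_over k (pCons a p) \<longleftrightarrow> a \<in> k \<and> poly_over k p"
proof
  assume "poly_over k (pCons a p)"
  then show "a \<in> k \<and> poly_over k p" unfolding poly_over_def by (metis coeff_pCons_0 coeff_pCons_Suc)
next
  assume "a \<in> k \<and> poly_over k p"
  then show "poly_over k (pCons a p)" unfolding poly_over_def by (auto simp: coeff_pCons split: nat.splits)
qed

lemma poly_over_mono: "poly_over k p \<Longrightarrow> k \<subseteq> K \<Longrightarrow> poly_over K p"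
  unfolding poly_over_def by auto

lemma poly_over_UNIV [simp]: "poly_over UNIV p"
  unfolding poly_over_def by auto

lemma poly_over_closed:
  assumes "is_subring k"
  shows "poly_over k 0" "poly_over k 1" "c \<in> k \<Longrightarrow> poly_over k [:c:]" "c \<in> k \<Longrightarrow> poly_over k (monom c n)"
    "poly_over k p \<Longrightarrow> poly_over k q \<Longrightarrow> poly_over k (p + q)"
    "poly_over k p \<Longrightarrow> poly_over k q \<Longrightarrow> poly_over k (p - q)"
    "poly_over k p \<Longrightarrow> poly_over k q \<Longrightarrow> poly_over k (p * q)"
    "poly_over k p \<Longrightarrow> poly_over k (- p)"
    "c \<in> k \<Longrightarrow> poly_over k p \<Longrightarrow> poly_over k (smult c p)"
    "poly_over k p \<Longrightarrow> poly_over k (pderiv p)"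
proof -
  show "poly_over k 0" "c \<in> k \<Longrightarrow> poly_over k [:c:]" "c \<in> k \<Longrightarrow> poly_over k (monom c n)"
    "poly_over k p \<Longrightarrow> poly_over k q \<Longrightarrow> poly_over k (p + q)"
    "poly_over k p \<Longrightarrow> poly_over k q \<Longrightarrow> poly_over k (p - q)"
    "poly_over k p \<Longrightarrow> poly_over k (- p)"
    "c \<in> k \<Longrightarrow> poly_over k p \<Longrightarrow> poly_over k (smult c p)"
    "poly_over k 1"
    using is_subringD[OF assms]
    by (auto simp: poly_over_def coeff_pCons one_pCons split: nat.splits)
  show "poly_over k p \<Longrightarrow> poly_over k q \<Longrightarrow> poly_over k (p * q)"
    unfolding poly_over_def coeff_mult by (intro allI is_subring_sum[OF assms] is_subringD[OF assms]) auto
  show "poly_over k p \<Longrightarrow> poly_over k (pderiv p)"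
    unfolding poly_over_def coeff_pderiv
    by (intro allI is_subringD[OF assms] is_subring_of_nat[OF assms]) auto
qed

lemma poly_over_power: "is_subring k \<Longrightarrow> poly_over k p \<Longrightarrow> poly_over k (p ^ n)"
  by (induction n) (auto simp: poly_over_closed)

lemma poly_over_prod: "is_subring k \<Longrightarrow> (\<And>i. i \<in> I \<Longrightarrow> poly_over k (f i)) \<Longrightarrow> poly_over k (prod f I)"
  by (induction I rule: infinite_finite_induct) (auto simp: poly_over_closed)

lemma poly_over_sum: "is_subring k \<Longrightarrow> (\<And>i. i \<in> I \<Longrightarrow> poly_over k (f i)) \<Longrightarrow> poly_over k (sum f I)"
  by (induction I rule: infinite_finite_induct) (auto simp: poly_over_closed)

lemma poly_over_prod_list:
  "is_subring k \<Longrightarrow> (\<And>p. p \<in> set ps \<Longrightarrow> poly_over k p) \<Longrightarrow> poly_over k (prod_list ps)"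
  by (induction ps) (auto simp: poly_over_closed)

lemma poly_over_pcompose:
  "is_subring k \<Longrightarrow> poly_over k p \<Longrightarrow> poly_over k q \<Longrightarrow> poly_over k (pcompose p q)"
  by (induction p) (auto simp: pcompose_pCons poly_over_closed)

lemma poly_in_subring: "is_subring k \<Longrightarrow> poly_over k p \<Longrightarrow> x \<in> k \<Longrightarrow> poly p x \<in> k"
  by (induction p) (auto simp: is_subringD)

lemma poly_over_divmod:
  assumes k: "is_subfield k" and m: "poly_over k m" "m \<noteq> 0" and p: "poly_over k p"
  shows "\<exists>q r. poly_over k q \<and> poly_over k r \<and> p = m * q + r \<and> (r = 0 \<or> degree r < degree m)"
  using p
\<comment> \<open>The measure separates the zero polynomial from the nonzero constants, which
  \<open>degree\<close> alone does not; this matters when \<open>m\<close> is constant.\<close>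
proof (induction "if p = 0 then 0 else Suc (degree p)" arbitrary: p rule: less_induct)
  case less
  note kr = is_subfield_is_subring[OF k]
  show ?case
  proof (cases "p = 0 \<or> degree p < degree m")
    case True
    with less.prems show ?thesis by (intro exI[of _ 0] exI[of _ p]) (auto simp: poly_over_closed[OF kr])
  next
    case False
    define c where "c = lead_coeff p / lead_coeff m"
    define q where "q = monom c (degree p - degree m)"
    have cc: "c \<in> k" unfolding c_def using less.prems m by (auto simp: poly_over_def intro!: is_subfield_divide k)
    have q: "poly_over k q" unfolding q_def using cc by (simp add: poly_over_closed[OF kr])
    have c0: "c \<noteq> 0" using False m by (auto simp: c_def)
    have q0: "q \<noteq> 0" using c0 by (simp add: q_def monom_eq_0_iff)
    have dq: "degree (m * q) = degree p"
      using False m q0 c0 by (subst degree_mult_eq) (auto simp: q_def degree_monom_eq)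
    have lq: "coeff (m * q) (degree p) = lead_coeff p"
    proof -
      have "coeff (m * q) (degree (m * q)) = lead_coeff m * lead_coeff q" by (rule lead_coeff_mult)
      also have "\<dots> = lead_coeff p" using c0 m by (simp add: q_def c_def degree_monom_eq)
      finally show ?thesis unfolding dq .
    qed
    let ?p = "p - m * q"
    have "?p = 0 \<or> degree ?p < degree p"
    proof (cases "degree p = 0")
      case True
      then have "degree ?p = 0" using dq by (metis degree_diff_le le_zero_eq)
      moreover have "coeff ?p 0 = 0" using lq True by simp
      ultimately show ?thesis by (metis leading_coeff_0_iff)
    next
      case f: False
      have "degree ?p \<le> degree p" using dq by (simp add: degree_diff_le)
      moreover have "coeff ?p (degree p) = 0" using lq by simp
      ultimately show ?thesis by (metis leading_coeff_0_iff le_neq_implies_less)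
    qed
    then have lt: "(if ?p = 0 then 0 else Suc (degree ?p)) < (if p = 0 then 0 else Suc (degree p))"
      using False by auto
    obtain q' r where "poly_over k q'" "poly_over k r" "?p = m * q' + r" "r = 0 \<or> degree r < degree m"
      using less.hyps[OF lt] less.prems m q poly_over_closed[OF kr] by metis
    then show ?thesis
      by (intro exI[of _ "q + q'"] exI[of _ r]) (auto simp: poly_over_closed[OF kr] q algebra_simps)
  qed
qed

section \<open>Algebraic elements and minimal polynomials\<close>

definition algebraic_over :: "'a::field set \<Rightarrow> 'a \<Rightarrow> bool" where
  "algebraic_over k x \<longleftrightarrow> (\<exists>p. p \<noteq> 0 \<and> poly_over k p \<and> poly p x = 0)"

lemma algebraic_over_mono: "algebraic_over k x \<Longrightarrow> k \<subseteq> K \<Longrightarrow> algebraic_over K x"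
  unfolding algebraic_over_def using poly_over_mono by blast

lemma algebraic_over_self: "is_subfield k \<Longrightarrow> x \<in> k \<Longrightarrow> algebraic_over k x"
  unfolding algebraic_over_def by (intro exI[of _ "[:- x, 1:]"]) (auto simp: is_subfieldD poly_over_closed is_subfield_is_subring)

lemma is_min_poly_exists:
  assumes k: "is_subfield k" and x: "algebraic_over k x"
  shows "\<exists>m. is_min_poly k x m"
proof -
  note kr = is_subfield_is_subring[OF k]
  let ?P = "\<lambda>p. p \<noteq> 0 \<and> poly_over k p \<and> poly p x = 0"
  obtain p where p: "?P p" and min: "\<And>q. ?P q \<Longrightarrow> degree p \<le> degree q"
    using x ex_has_least_nat[of ?P _ degree] unfolding algebraic_over_def by blast
  let ?m = "smult (inverse (lead_coeff p)) p"
  have "inverse (lead_coeff p) \<in> k" using p k by (auto simp: poly_over_def intro: is_subfield_inverse)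
  then have "is_min_poly k x ?m"
    using p min unfolding is_min_poly_def by (auto simp: poly_over_closed[OF kr])
  then show ?thesis by blast
qed

lemma is_min_poly_nonzero: "is_min_poly k x m \<Longrightarrow> m \<noteq> 0"
  unfolding is_min_poly_def by auto

lemma is_min_poly_less:
  "is_min_poly k x m \<Longrightarrow> poly_over k r \<Longrightarrow> poly r x = 0 \<Longrightarrow> degree r < degree m \<Longrightarrow> r = 0"
  unfolding is_min_poly_def by (metis not_le)

lemma is_min_poly_degree_pos: "is_min_poly k x m \<Longrightarrow> degree m > 0"
  unfolding is_min_poly_def by (metis degree_0_id gr0I leading_coeff_0_iff one_neq_zero poly_const_conv)

lemma is_min_poly_dvd:
  assumes k: "is_subfield k" and m: "is_min_poly k x m" and p: "poly_over k p" "poly p x = 0"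
  shows "\<exists>q. poly_over k q \<and> p = m * q"
proof -
  have m': "poly_over k m" "m \<noteq> 0" "poly m x = 0" using m is_min_poly_nonzero by (auto simp: is_min_poly_def)
  obtain q r where qr: "poly_over k q" "poly_over k r" "p = m * q + r" "r = 0 \<or> degree r < degree m"
    using poly_over_divmod[OF k m'(1,2) p(1)] by blast
  have "poly r x = 0" using p qr m' by simp
  then have "r = 0" using qr is_min_poly_less[OF m] by auto
  then show ?thesis using qr by auto
qed

text \<open>The extended Euclidean algorithm, run on \<open>m\<close> and \<open>g\<close>.\<close>

lemma poly_value_inverse:
  assumes k: "is_subfield k" and x: "algebraic_over k x" and g: "poly_over k g" "poly g x \<noteq> 0"
  shows "\<exists>u. poly_over k u \<and> poly u x * poly g x = 1"
proof -
  note kr = is_subfield_is_subring[OF k]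
  obtain m where m: "is_min_poly k x m" using is_min_poly_exists[OF k x] by blast
  have m': "poly_over k m" "m \<noteq> 0" "poly m x = 0" using m is_min_poly_nonzero by (auto simp: is_min_poly_def)
  have *: "\<exists>u. poly_over k u \<and> poly u x * poly g x = 1"
    if "poly_over k g" "poly g x \<noteq> 0" "degree g < degree m" for g
    using that
  proof (induction "degree g" arbitrary: g rule: less_induct)
    case less
    show ?case
    proof (cases "degree g = 0")
      case True
      then obtain c where c: "g = [:c:]" by (metis degree_0_id)
      with less.prems show ?thesis
        by (intro exI[of _ "[:inverse c:]"]) (auto simp: poly_over_closed[OF kr] is_subfield_inverse[OF k])
    next
      case False
      have g0: "g \<noteq> 0" using less.prems by auto
      obtain q r where qr: "poly_over k q" "poly_over k r" "m = g * q + r" "r = 0 \<or> degree r < degree g"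
        using poly_over_divmod[OF k less.prems(1) g0 m'(1)] by blast
      \<comment> \<open>Otherwise \<open>m\<close> would be the product of \<open>g\<close> and
        \<open>q\<close> with \<open>g\<close> nonzero at \<open>x\<close>, and \<open>q\<close>
        would be a relation for \<open>x\<close> of degree below that of \<open>m\<close>.\<close>
      have "poly r x \<noteq> 0"
      proof
        assume r: "poly r x = 0"
        then have "r = 0" using qr is_min_poly_less[OF m] less.prems by fastforce
        then have mq: "m = g * q" using qr by simp
        then have "poly q x = 0" using m' less.prems by auto
        moreover have "degree q < degree m" using mq m' False by (auto simp: degree_mult_eq)
        ultimately have "q = 0" using qr is_min_poly_less[OF m] by auto
        then show False using mq m' by simp
      qed
      moreover from this have "degree r < degree g" using qr by auto
      ultimately obtain u where u: "poly_over k u" "poly u x * poly r x = 1"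
        using less.hyps[of r] qr less.prems by (auto intro: less_trans)
      have "poly r x = - poly g x * poly q x" using m'(3) qr(3) by (simp add: eq_neg_iff_add_eq_0 add.commute)
      then have "poly (- (u * q)) x * poly g x = 1" using u by (simp add: mult_ac)
      then show ?thesis using u qr by (intro exI[of _ "- (u * q)"]) (auto simp: poly_over_closed[OF kr])
    qed
  qed
  obtain q r where qr: "poly_over k q" "poly_over k r" "g = m * q + r" "r = 0 \<or> degree r < degree m"
    using poly_over_divmod[OF k m'(1,2) g(1)] by blast
  have "poly g x = poly r x" using qr m' by simp
  then show ?thesis using *[of r] qr g by auto
qed

text \<open>This is \<open>k[x]\<close> and not \<open>k(x)\<close>. It is the simple extension when
  \<open>x\<close> is algebraic, and for a transcendental \<open>x\<close> it is the polynomial ring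
  that later serves as Euclidean subring.\<close>

definition adjoin :: "'a::field set \<Rightarrow> 'a \<Rightarrow> 'a set" where
  "adjoin k x = {poly g x | g. poly_over k g}"

lemma adjoin_superset: "is_subring k \<Longrightarrow> k \<subseteq> adjoin k x"
proof
  fix y assume "is_subring k" "y \<in> k"
  then have "y = poly [:y:] x" "poly_over k [:y:]" by (simp_all add: poly_over_closed)
  then show "y \<in> adjoin k x" unfolding adjoin_def by blast
qed

lemma adjoin_generator: "is_subring k \<Longrightarrow> x \<in> adjoin k x"
  unfolding adjoin_def by (auto intro!: exI[of _ "[:0, 1:]"] simp: poly_over_closed is_subringD)

lemma is_subring_adjoin:
  assumes "is_subring k"
  shows "is_subring (adjoin k x)"
proof -
  note c = poly_over_closed[OF assms]
  have "poly p x + poly q x \<in> adjoin k x" "poly p x * poly q x \<in> adjoin k x" "- poly p x \<in> adjoin k x"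
    if "poly_over k p" "poly_over k q" for p q
    using that c unfolding adjoin_def by (auto simp flip: poly_add poly_mult poly_minus)
  moreover have "0 \<in> adjoin k x" "1 \<in> adjoin k x"
    using adjoin_superset[OF assms, of x] is_subringD[OF assms] by auto
  ultimately show ?thesis unfolding is_subring_def adjoin_def by blast
qed

lemma adjoin_minimal: "is_subring K \<Longrightarrow> k \<subseteq> K \<Longrightarrow> x \<in> K \<Longrightarrow> adjoin k x \<subseteq> K"
  unfolding adjoin_def using poly_in_subring poly_over_mono by blast

lemma is_subfield_adjoin:
  assumes k: "is_subfield k" and x: "algebraic_over k x"
  shows "is_subfield (adjoin k x)"
proof (rule is_subfieldI)
  show "is_subring (adjoin k x)" by (simp add: is_subring_adjoin is_subfield_is_subring k)
  show "inverse y \<in> adjoin k x" if y: "y \<in> adjoin k x" "y \<noteq> 0" for y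
  proof -
    obtain g where g: "poly_over k g" "y = poly g x" using y by (auto simp: adjoin_def)
    obtain u where "poly_over k u" "poly u x * y = 1" using poly_value_inverse[OF k x] g y by blast
    then show ?thesis unfolding adjoin_def by (auto dest: inverse_unique simp: mult.commute)
  qed
qed

section \<open>Linear dependence and finite extensions\<close>

lemma linear_dependence:
  assumes k: "is_subfield k" and "finite B" "finite I" "card B < card I"
    "\<And>i. i \<in> I \<Longrightarrow> \<exists>c. c ` B \<subseteq> k \<and> v i = (\<Sum>b\<in>B. c b * b)"
  shows "\<exists>c. c ` I \<subseteq> k \<and> (\<exists>i\<in>I. c i \<noteq> 0) \<and> (\<Sum>i\<in>I. c i * v i) = 0"
  using assms(2-)
proof (induction B arbitrary: I v rule: finite_induct)
  case empty
  then have "I \<noteq> {}" by auto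
  moreover have "v i = 0" if "i \<in> I" for i using empty(3)[OF that] by simp
  ultimately show ?case using is_subfieldD(2)[OF k] by (intro exI[of _ "\<lambda>_. 1"]) auto
next
  case (insert b B)
  from insert.prems(3) obtain c where c: "\<And>i. i \<in> I \<Longrightarrow> c i ` insert b B \<subseteq> k \<and> v i = (\<Sum>b\<in>insert b B. c i b * b)"
    by metis
  have v: "v i = c i b * b + (\<Sum>b\<in>B. c i b * b)" if "i \<in> I" for i
    using c[OF that] insert.hyps by simp
  have ck: "c i b' \<in> k" if "i \<in> I" "b' \<in> insert b B" for i b' using c that by blast
  show ?case
  proof (cases "\<forall>i\<in>I. c i b = 0")
    case True
    show ?thesis
    proof (rule insert.IH)
      show "card B < card I" using insert.prems insert.hyps by simp
      show "\<exists>c. c ` B \<subseteq> k \<and> v i = (\<Sum>b\<in>B. c b * b)" if "i \<in> I" for i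
        using v[OF that] True that ck[OF that] by (intro exI[of _ "c i"]) auto
    qed (use insert.prems in auto)
  next
    case False
    then obtain j where j: "j \<in> I" "c j b \<noteq> 0" by auto
    \<comment> \<open>Gaussian elimination with pivot \<open>v j\<close>: the vectors
      \<open>w i\<close> no longer involve \<open>b\<close>, so the induction hypothesis applies to
      \<open>I - {j}\<close> and \<open>B\<close>. Vectors are an indexed family, so that equal
      values at different indices count as dependent; this is needed for powers of an
      element.\<close>
    define t where "t i = c i b / c j b" for i
    have t: "t i \<in> k" if "i \<in> I" for i using ck j that k by (auto simp: t_def intro!: is_subfield_divide)
    define w where "w i = v i - t i * v j" for i
    have w: "w i = (\<Sum>b\<in>B. (c i b - t i * c j b) * b)" if "i \<in> I" for i
    proof -
      have "t i * c j b = c i b" using j by (simp add: t_def)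
      moreover have "(\<Sum>b\<in>B. (c i b - t i * c j b) * b) = (\<Sum>b\<in>B. c i b * b) - t i * (\<Sum>b\<in>B. c j b * b)"
        by (simp add: sum_subtractf left_diff_distrib sum_distrib_left mult.assoc)
      ultimately show ?thesis unfolding w_def v[OF that] v[OF j(1)] distrib_left by (simp flip: mult.assoc)
    qed
    have "\<exists>d. d ` (I - {j}) \<subseteq> k \<and> (\<exists>i\<in>I - {j}. d i \<noteq> 0) \<and> (\<Sum>i\<in>I - {j}. d i * w i) = 0"
    proof (rule insert.IH)
      show "card B < card (I - {j})" using insert j by simp
      show "\<exists>c. c ` B \<subseteq> k \<and> w i = (\<Sum>b\<in>B. c b * b)" if "i \<in> I - {j}" for i
        using that w[of i] ck[of i] ck[OF j(1)] t[of i] is_subfieldD[OF k]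
        by (intro exI[of _ "\<lambda>b. c i b - t i * c j b"]) (auto)
    qed (use insert in auto)
    then obtain d where d: "d ` (I - {j}) \<subseteq> k" "\<exists>i\<in>I - {j}. d i \<noteq> 0" "(\<Sum>i\<in>I - {j}. d i * w i) = 0" by blast
    \<comment> \<open>The coefficient at \<open>j\<close> collects the multiples of
      \<open>v j\<close> that were subtracted in forming the \<open>w i\<close>.\<close>
    define e where "e i = (if i = j then - (\<Sum>i\<in>I - {j}. d i * t i) else d i)" for i
    have "(\<Sum>i\<in>I. e i * v i) = e j * v j + (\<Sum>i\<in>I - {j}. d i * v i)"
      using j insert.prems by (subst sum.remove[of _ j]) (auto simp: e_def)
    also have "\<dots> = (\<Sum>i\<in>I - {j}. d i * w i)"
      by (simp add: e_def w_def algebra_simps sum_subtractf sum_distrib_left sum_distrib_right)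
    finally have "(\<Sum>i\<in>I. e i * v i) = 0" using d by simp
    moreover have "e j \<in> k" unfolding e_def
      using d t by (auto intro!: is_subfieldD[OF k] is_subring_sum[OF is_subfield_is_subring[OF k]])
    then have "e ` I \<subseteq> k" using d by (auto simp: e_def)
    moreover have "\<exists>i\<in>I. e i \<noteq> 0" using d by (auto simp: e_def)
    ultimately show ?thesis by blast
  qed
qed

lemma finite_extension_algebraic:
  assumes "finite_extension k K" "x \<in> K"
  shows "algebraic_over k x"
proof -
  from assms obtain B where B: "finite B" "\<And>x. x \<in> K \<Longrightarrow> \<exists>c. c ` B \<subseteq> k \<and> x = (\<Sum>b\<in>B. c b * b)"
    and k: "is_subfield k" "is_subfield K" unfolding finite_extension_def field_extension_def by blast
  obtain c where c: "c ` {..card B} \<subseteq> k" "\<exists>i\<in>{..card B}. c i \<noteq> 0" "(\<Sum>i\<le>card B. c i * x ^ i) = 0"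
    using linear_dependence[OF k(1) B(1), of "{..card B}" "\<lambda>i. x ^ i"] B(2)
      is_subring_power[OF is_subfield_is_subring[OF k(2)] assms(2)] by auto
  let ?p = "\<Sum>i\<le>card B. monom (c i) i"
  have "coeff ?p i = (if i \<le> card B then c i else 0)" for i by (simp add: coeff_sum coeff_monom)
  then have "?p \<noteq> 0" using c by (metis atMost_iff coeff_0)
  moreover have "poly_over k ?p"
    using c by (intro poly_over_sum poly_over_closed is_subfield_is_subring k) auto
  moreover have "poly ?p x = 0" using c by (simp add: poly_sum poly_monom)
  ultimately show ?thesis unfolding algebraic_over_def by blast
qed

lemma finite_extension_refl: "is_subfield k \<Longrightarrow> finite_extension k k"
  unfolding finite_extension_def field_extension_def
  by (auto intro!: exI[of _ "{1}"] simp: is_subfieldD)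

definition lin_span :: "'a::field set \<Rightarrow> 'a set \<Rightarrow> 'a set" where
  "lin_span k B = {\<Sum>b\<in>B. c b * b | c. c ` B \<subseteq> k}"

lemma lin_span_closed:
  assumes k: "is_subfield k"
  shows "0 \<in> lin_span k B" "x \<in> lin_span k B \<Longrightarrow> y \<in> lin_span k B \<Longrightarrow> x + y \<in> lin_span k B"
    "a \<in> k \<Longrightarrow> x \<in> lin_span k B \<Longrightarrow> a * x \<in> lin_span k B"
    "finite B \<Longrightarrow> b \<in> B \<Longrightarrow> b \<in> lin_span k B"
proof -
  show "0 \<in> lin_span k B" unfolding lin_span_def using is_subfieldD(1)[OF k]
    by (auto intro!: exI[of _ "\<lambda>_. 0"])
  show "x + y \<in> lin_span k B" if "x \<in> lin_span k B" "y \<in> lin_span k B"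
  proof -
    from that obtain c d where "c ` B \<subseteq> k" "d ` B \<subseteq> k" "x = (\<Sum>b\<in>B. c b * b)" "y = (\<Sum>b\<in>B. d b * b)"
      by (auto simp: lin_span_def)
    then show ?thesis unfolding lin_span_def using is_subfieldD[OF k]
      by (auto intro!: exI[of _ "\<lambda>b. c b + d b"] simp: sum.distrib distrib_right)
  qed
  show "a * x \<in> lin_span k B" if "a \<in> k" "x \<in> lin_span k B"
  proof -
    from that obtain c where "c ` B \<subseteq> k" "x = (\<Sum>b\<in>B. c b * b)" by (auto simp: lin_span_def)
    then show ?thesis unfolding lin_span_def using is_subfieldD[OF k] that
      by (auto intro!: exI[of _ "\<lambda>b. a * c b"] simp: sum_distrib_left mult.assoc)
  qed
  show "b \<in> lin_span k B" if "finite B" "b \<in> B"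
  proof -
    have "(\<Sum>b'\<in>B. (if b' = b then 1 else 0) * b') = (\<Sum>b'\<in>B. if b' = b then b' else 0)"
      by (intro sum.cong) auto
    then have "b = (\<Sum>b'\<in>B. (if b' = b then 1 else 0) * b')" using that by simp
    then show ?thesis unfolding lin_span_def using is_subfieldD[OF k]
      by (intro CollectI exI[of _ "\<lambda>b'. if b' = b then 1 else 0"]) auto
  qed
qed

lemma lin_span_sum: "is_subfield k \<Longrightarrow> (\<And>i. i \<in> I \<Longrightarrow> f i \<in> lin_span k B) \<Longrightarrow> sum f I \<in> lin_span k B"
  by (induction I rule: infinite_finite_induct) (auto simp: lin_span_closed)

lemma finite_extension_adjoin:
  assumes V: "finite_extension k V" and x: "algebraic_over V x"
  shows "finite_extension k (adjoin V x)"
proof -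
  from V have k: "is_subfield k" "is_subfield V" "k \<subseteq> V"
    unfolding finite_extension_def field_extension_def by blast+
  from V obtain B where B': "finite B" "B \<subseteq> V" "\<forall>x\<in>V. \<exists>c. c ` B \<subseteq> k \<and> x = (\<Sum>b\<in>B. c b * b)"
    unfolding finite_extension_def by blast
  then have B: "finite B" "B \<subseteq> V" "\<And>x. x \<in> V \<Longrightarrow> x \<in> lin_span k B"
    unfolding lin_span_def by blast+
  note Vr = is_subfield_is_subring[OF k(2)]
  obtain m where m: "is_min_poly V x m" using is_min_poly_exists[OF k(2) x] by blast
  have m': "poly_over V m" "m \<noteq> 0" "poly m x = 0" using m is_min_poly_nonzero by (auto simp: is_min_poly_def)
  \<comment> \<open>Reduction modulo \<open>m\<close> bounds the exponents of \<open>x\<close>, so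
    these products span. Coincidences among them do no harm, since only spanning is
    required.\<close>
  define C where "C = (\<lambda>(b, j). b * x ^ j) ` (B \<times> {..degree m})"
  have "b * x ^ j \<in> adjoin V x" if "b \<in> B" for b j
  proof -
    note a = is_subring_adjoin[OF Vr, of x]
    have "b \<in> adjoin V x" using that B(2) adjoin_superset[OF Vr] by blast
    then show ?thesis by (intro is_subringD(4)[OF a] is_subring_power[OF a] adjoin_generator[OF Vr])
  qed
  then have C: "finite C" "C \<subseteq> adjoin V x" using B(1) by (auto simp: C_def)
  have "y \<in> lin_span k C" if y: "y \<in> adjoin V x" for y
  proof -
    obtain g where g: "poly_over V g" "y = poly g x" using y by (auto simp: adjoin_def)
    obtain q r where qr: "poly_over V q" "poly_over V r" "g = m * q + r" "r = 0 \<or> degree r < degree m"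
      using poly_over_divmod[OF k(2) m'(1,2) g(1)] by blast
    have "y = poly r x" using qr m' g by simp
    also have "\<dots> = (\<Sum>j\<le>degree r. coeff r j * x ^ j)" by (rule poly_altdef)
    also have "\<dots> \<in> lin_span k C"
    proof (rule lin_span_sum[OF k(1)])
      fix j assume j: "j \<in> {..degree r}"
      obtain c where c: "c ` B \<subseteq> k" "coeff r j = (\<Sum>b\<in>B. c b * b)"
        using B(3)[of "coeff r j"] qr by (auto simp: poly_over_def lin_span_def)
      have "coeff r j * x ^ j = (\<Sum>b\<in>B. c b * (b * x ^ j))" unfolding c by (simp add: sum_distrib_right mult.assoc)
      also have "\<dots> \<in> lin_span k C"
      proof (rule lin_span_sum[OF k(1)], rule lin_span_closed(3)[OF k(1)])
        fix b assume b: "b \<in> B"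
        show "c b \<in> k" using b c by auto
        have "j \<le> degree m" using j qr by auto
        then have "b * x ^ j \<in> C" using b unfolding C_def by force
        then show "b * x ^ j \<in> lin_span k C" using C(1) by (rule lin_span_closed(4)[OF k(1), rotated])
      qed
      finally show "coeff r j * x ^ j \<in> lin_span k C" .
    qed
    finally show ?thesis .
  qed
  then have "\<forall>y\<in>adjoin V x. \<exists>c. c ` C \<subseteq> k \<and> y = (\<Sum>b\<in>C. c b * b)" unfolding lin_span_def by blast
  then show ?thesis
    unfolding finite_extension_def field_extension_def
    using C k is_subfield_adjoin[OF k(2) x] adjoin_superset[OF Vr, of x] by blast
qed

lemma finite_extension_containing:
  assumes "is_subfield k" "finite X" "\<And>x. x \<in> X \<Longrightarrow> algebraic_over k x"
  shows "\<exists>V. finite_extension k V \<and> X \<subseteq> V"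
  using assms(2,3)
proof (induction X rule: finite_induct)
  case empty
  then show ?case using finite_extension_refl[OF assms(1)] by auto
next
  case (insert x X)
  then obtain V where V: "finite_extension k V" "X \<subseteq> V" by auto
  then have f: "is_subfield V" "k \<subseteq> V" by (auto simp: finite_extension_def field_extension_def)
  have "algebraic_over V x" using insert.prems[of x] f algebraic_over_mono by auto
  then have "finite_extension k (adjoin V x)" using finite_extension_adjoin V by blast
  moreover have "insert x X \<subseteq> adjoin V x"
    using V f adjoin_superset adjoin_generator is_subfield_is_subring by blast
  ultimately show ?case by blast
qed

text \<open>A relation for \<open>x\<close> over \<open>K\<close> has finitely many coefficients.
  They lie in a finite extension \<open>V\<close> of \<open>k\<close>, and adjoining
  \<open>x\<close> to \<open>V\<close> keeps it finite over \<open>k\<close>.\<close>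

lemma algebraic_over_trans:
  assumes k: "is_subfield k" and K: "is_subfield K" "\<And>y. y \<in> K \<Longrightarrow> algebraic_over k y" and x: "algebraic_over K x"
  shows "algebraic_over k x"
proof -
  obtain p where p: "p \<noteq> 0" "poly_over K p" "poly p x = 0"
    using x unfolding algebraic_over_def by blast
  have "\<exists>V. finite_extension k V \<and> set (coeffs p) \<subseteq> V"
  proof (intro finite_extension_containing k)
    fix y assume "y \<in> set (coeffs p)"
    then have "y \<in> range (coeff p)" using range_coeff by blast
    then show "algebraic_over k y" using p(2) K(2) by (auto simp: poly_over_def)
  qed auto
  then obtain V where V: "finite_extension k V" "set (coeffs p) \<subseteq> V" by blast
  then have f: "is_subfield V" by (auto simp: finite_extension_def field_extension_def)
  have "coeff p i \<in> V" for i
    using V is_subfieldD(1)[OF f] coeff_in_coeffs[OF p(1), of i] by (cases "i \<le> degree p") (auto simp: coeff_eq_0)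
  then have "algebraic_over V x" using p by (auto simp: algebraic_over_def poly_over_def)
  then show ?thesis
    using finite_extension_algebraic[OF finite_extension_adjoin[OF V(1)]] adjoin_generator f is_subfield_is_subring by blast
qed

lemma is_subfield_algebraic_closure:
  assumes k: "is_subfield k"
  shows "is_subfield {x. algebraic_over k x}"
proof -
  have V: "\<exists>V. is_subfield V \<and> x \<in> V \<and> y \<in> V \<and> (\<forall>z\<in>V. algebraic_over k z)"
    if xy: "algebraic_over k x" "algebraic_over k y" for x y
  proof -
    have "\<exists>V. finite_extension k V \<and> {x, y} \<subseteq> V"
      by (rule finite_extension_containing[OF k]) (use xy in auto)
    then obtain V where V: "finite_extension k V" "{x, y} \<subseteq> V" by blast
    then show ?thesis using finite_extension_algebraic[OF V(1)]
      by (intro exI[of _ V]) (auto simp: finite_extension_def field_extension_def)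
  qed
  show ?thesis
  proof (rule is_subfieldI)
    have "x + y \<in> {x. algebraic_over k x} \<and> x * y \<in> {x. algebraic_over k x} \<and> - x \<in> {x. algebraic_over k x}"
      if xy: "algebraic_over k x" "algebraic_over k y" for x y
    proof -
      obtain W where W: "is_subfield W" "x \<in> W" "y \<in> W" "\<forall>z\<in>W. algebraic_over k z"
        using V[OF xy] by blast
      then show ?thesis using is_subfieldD[OF W(1)] by simp
    qed
    moreover have "algebraic_over k 0" "algebraic_over k 1"
      using algebraic_over_self[OF k] is_subfieldD[OF k] by blast+
    ultimately show "is_subring {x. algebraic_over k x}" unfolding is_subring_def by blast
    show "inverse x \<in> {x. algebraic_over k x}" if "x \<in> {x. algebraic_over k x}" for x
      using V[of x x] that is_subfield_inverse by blast
  qed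
qed

lemma algebraic_over_generated:
  assumes "is_subfield k" "\<And>x. x \<in> S \<Longrightarrow> algebraic_over k x" "x \<in> generated_subfield S"
  shows "algebraic_over k x"
  using generated_subfield_minimal[OF is_subfield_algebraic_closure[OF assms(1)], of S] assms by auto

subsection \<open>Extension of homomorphisms\<close>

lemma field_hom_onD:
  assumes "is_subring k" "field_hom_on k h"
  shows "h 0 = 0" "h 1 = 1" "x \<in> k \<Longrightarrow> y \<in> k \<Longrightarrow> h (x + y) = h x + h y"
    "x \<in> k \<Longrightarrow> y \<in> k \<Longrightarrow> h (x * y) = h x * h y" "x \<in> k \<Longrightarrow> h (- x) = - h x"
    "x \<in> k \<Longrightarrow> y \<in> k \<Longrightarrow> h (x - y) = h x - h y" "x \<in> k \<Longrightarrow> h (x ^ n) = h x ^ n"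
proof -
  note k = is_subringD[OF assms(1)]
  show add: "h (x + y) = h x + h y" if "x \<in> k" "y \<in> k" for x y
    using assms that by (auto simp: field_hom_on_def)
  show one: "h 1 = 1" using assms by (auto simp: field_hom_on_def)
  show mult: "h (x * y) = h x * h y" if "x \<in> k" "y \<in> k" for x y
    using assms that by (auto simp: field_hom_on_def)
  show zero: "h 0 = 0" using add[of 0 0] k(1) by (metis add.right_neutral add_left_cancel)
  show minus: "h (- x) = - h x" if "x \<in> k" for x
    using add[of x "- x"] k(5)[of x] that zero by (simp add: eq_neg_iff_add_eq_0 add.commute)
  show "h (x - y) = h x - h y" if "x \<in> k" "y \<in> k"
    using add[of x "- y"] k(5)[of y] minus that by simp
  show "h (x ^ n) = h x ^ n" if "x \<in> k"
    by (induction n) (simp_all add: one mult that is_subring_power[OF assms(1)])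
qed

lemma field_hom_on_inverse:
  assumes "is_subfield k" "field_hom_on k h" "x \<in> k"
  shows "h (inverse x) = inverse (h x)"
proof (cases "x = 0")
  case False
  note D = field_hom_onD[OF is_subfield_is_subring[OF assms(1)] assms(2)]
  have "h x * h (inverse x) = 1"
    using D(4)[OF assms(3) is_subfield_inverse[OF assms(1,3)]] D(2) False by simp
  then show ?thesis by (simp add: inverse_unique)
qed (use field_hom_onD(1)[OF is_subfield_is_subring[OF assms(1)] assms(2)] in simp)

lemma field_hom_on_inj_on:
  assumes "is_subfield k" "field_hom_on k h"
  shows "inj_on h k"
proof (rule inj_onI)
  fix x y assume xy: "x \<in> k" "y \<in> k" "h x = h y"
  note D = field_hom_onD[OF is_subfield_is_subring[OF assms(1)] assms(2)]
  have d: "x - y \<in> k" using xy by (intro is_subfieldD[OF assms(1)])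
  have "h ((x - y) * inverse (x - y)) = 0"
    using D(4)[OF d is_subfield_inverse[OF assms(1) d]] D(6)[OF xy(1,2)] xy(3) by simp
  then have "x - y = 0" using D(2) by (metis right_inverse zero_neq_one)
  then show "x = y" by simp
qed

lemma is_subfield_image:
  assumes "is_subfield k" "field_hom_on k h"
  shows "is_subfield (h ` k)"
proof -
  note D = field_hom_onD[OF is_subfield_is_subring[OF assms(1)] assms(2)] and k = is_subfieldD[OF assms(1)]
  show ?thesis unfolding is_subfield_def
  proof (intro conjI ballI)
    show "0 \<in> h ` k" "1 \<in> h ` k" using D(1,2) k(1,2) by (metis image_eqI)+
    fix x y assume "x \<in> h ` k" "y \<in> h ` k"
    then obtain a b where "a \<in> k" "b \<in> k" "x = h a" "y = h b" by blast
    then have "x + y = h (a + b)" "x * y = h (a * b)" "- x = h (- a)" "inverse x = h (inverse a)"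
      "a + b \<in> k" "a * b \<in> k" "- a \<in> k" "inverse a \<in> k"
      using D field_hom_on_inverse[OF assms] k is_subfield_inverse[OF assms(1)] by simp_all
    then show "x + y \<in> h ` k" "x * y \<in> h ` k" "- x \<in> h ` k" "inverse x \<in> h ` k" by simp_all
  qed
qed

lemma is_subfield_vimage:
  assumes "field_hom_on UNIV h" "is_subfield k"
  shows "is_subfield (h -` k)"
proof -
  have s: "is_subring (UNIV :: 'a set)" using is_subfield_is_subring is_subfield_UNIV by blast
  show ?thesis
    using field_hom_onD[OF s assms(1)] field_hom_on_inverse[OF is_subfield_UNIV assms(1)] assms(2)
    unfolding is_subfield_def by simp
qed

lemma field_hom_on_map_poly:
  assumes "is_subring k" "field_hom_on k h" "poly_over k p" "poly_over k q"
  shows "map_poly h (p + q) = map_poly h p + map_poly h q"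
    "map_poly h (p * q) = map_poly h p * map_poly h q"
    "map_poly h (p - q) = map_poly h p - map_poly h q"
    "map_poly h (- p) = - map_poly h p"
proof -
  note D = field_hom_onD[OF assms(1,2)]
  have c: "coeff p i \<in> k" "coeff q i \<in> k" for i using assms by (auto simp: poly_over_def)
  have hs: "h (sum f {..n}) = (\<Sum>i\<le>n. h (f i))" if "\<And>i. f i \<in> k" for f and n :: nat
    by (induction n) (auto simp: D that is_subring_sum[OF assms(1)])
  show "map_poly h (p + q) = map_poly h p + map_poly h q"
    "map_poly h (p - q) = map_poly h p - map_poly h q" "map_poly h (- p) = - map_poly h p"
    by (auto simp: poly_eq_iff coeff_map_poly D c)
  show "map_poly h (p * q) = map_poly h p * map_poly h q"
    by (auto simp: poly_eq_iff coeff_map_poly D c coeff_mult hs is_subringD(4)[OF assms(1)])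
qed

lemma field_hom_on_poly:
  assumes "is_subring k" "field_hom_on k h" "poly_over k p" "x \<in> k"
  shows "h (poly p x) = poly (map_poly h p) (h x)"
  using assms(3)
  by (induction p) (auto simp: map_poly_pCons field_hom_onD[OF assms(1,2)] assms(4) poly_in_subring[OF assms(1)] is_subringD(4)[OF assms(1)])

lemma map_poly_fix: "(\<And>x. x \<in> k \<Longrightarrow> h x = x) \<Longrightarrow> poly_over k p \<Longrightarrow> map_poly h p = p"
  by (rule poly_eqI) (metis coeff_map_poly poly_over_def coeff_eq_0 lessI)

lemma field_hom_extends_adjoin:
  fixes \<phi> :: "'b::field \<Rightarrow> 'a::field"
  assumes k: "is_subfield k" and \<phi>: "field_hom_on k \<phi>" and m: "is_min_poly k b m"
    and root: "poly (map_poly \<phi> m) \<beta> = 0"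
  shows "\<exists>\<psi>. field_hom_on (adjoin k b) \<psi> \<and> (\<forall>x\<in>k. \<psi> x = \<phi> x) \<and> \<psi> b = \<beta>"
proof -
  note kr = is_subfield_is_subring[OF k]
  note c = poly_over_closed[OF kr]
  note mp = field_hom_on_map_poly[OF kr \<phi>]
  note D = field_hom_onD[OF kr \<phi>]
  have m': "poly_over k m" using m by (simp add: is_min_poly_def)
  have zero: "poly (map_poly \<phi> g) \<beta> = 0" if g: "poly_over k g" "poly g b = 0" for g
  proof -
    obtain q where "poly_over k q" "g = m * q" using is_min_poly_dvd[OF k m g] by blast
    then show ?thesis using mp(2)[OF m', of q] root by simp
  qed
  \<comment> \<open>The choice of \<open>g\<close> is immaterial: two candidates differ by a
    multiple of \<open>m\<close>, which \<open>\<phi>\<close> turns into a polynomial vanishing at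
    \<open>\<beta>\<close>.\<close>
  define \<psi> where "\<psi> y = poly (map_poly \<phi> (SOME g. poly_over k g \<and> poly g b = y)) \<beta>" for y
  have \<psi>: "\<psi> (poly g b) = poly (map_poly \<phi> g) \<beta>" if g: "poly_over k g" for g
  proof -
    let ?g = "SOME g'. poly_over k g' \<and> poly g' b = poly g b"
    have g': "poly_over k ?g \<and> poly ?g b = poly g b" by (rule someI[of _ g]) (simp add: g)
    then have "poly (map_poly \<phi> (?g - g)) \<beta> = 0" using g by (intro zero) (auto simp: c)
    then show ?thesis using mp(3)[of ?g g] g g' by (simp add: \<psi>_def)
  qed
  have "field_hom_on (adjoin k b) \<psi>"
    unfolding field_hom_on_def adjoin_def
  proof (safe)
    show "\<psi> 1 = 1" using \<psi>[of 1] by (simp add: c map_poly_1 D)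
    fix f g assume fg: "poly_over k f" "poly_over k g"
    show "\<psi> (poly f b + poly g b) = \<psi> (poly f b) + \<psi> (poly g b)"
      using \<psi>[of "f + g"] \<psi> fg mp(1)[OF fg] by (simp add: c)
    show "\<psi> (poly f b * poly g b) = \<psi> (poly f b) * \<psi> (poly g b)"
      using \<psi>[of "f * g"] \<psi> fg mp(2)[OF fg] by (simp add: c)
  qed
  moreover have "\<psi> x = \<phi> x" if "x \<in> k" for x
    using \<psi>[of "[:x:]"] that by (simp add: c map_poly_pCons D)
  moreover have "\<psi> b = \<beta>"
    using \<psi>[of "[:0, 1:]"] is_subringD[OF kr] by (simp add: c map_poly_pCons D)
  ultimately show ?thesis by blast
qed

text \<open>Zorn's lemma is applied to graphs. The total functions of the type carry arbitrary
  values outside \<open>L\<close>, whereas graphs over \<open>L\<close> are ordered by inclusion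
  exactly as partial homomorphisms are by extension.\<close>

lemma field_hom_extends:
  fixes \<phi> :: "'b::field \<Rightarrow> 'a::alg_closed_field"
  assumes k: "is_subfield k" and K: "is_subfield K" "k \<subseteq> K" "\<And>x. x \<in> K \<Longrightarrow> algebraic_over k x"
    and \<phi>: "field_hom_on k \<phi>"
  shows "\<exists>\<psi>. field_hom_on K \<psi> \<and> (\<forall>x\<in>k. \<psi> x = \<phi> x)"
proof -
  define ok where "ok L \<psi> \<longleftrightarrow> is_subfield L \<and> k \<subseteq> L \<and> L \<subseteq> K \<and> field_hom_on L \<psi> \<and> (\<forall>x\<in>k. \<psi> x = \<phi> x)" for L \<psi>
  define gr where "gr L \<psi> = (\<lambda>x. (x, \<psi> x)) ` L" for L and \<psi> :: "'b \<Rightarrow> 'a"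
  define Gr where "Gr = {gr L \<psi> | L \<psi>. ok L \<psi>}"
  have "\<exists>M\<in>Gr. \<forall>X\<in>Gr. M \<subseteq> X \<longrightarrow> X = M"
  proof (rule subset_Zorn_nonempty)
    have "ok k \<phi>" using k K \<phi> by (auto simp: ok_def)
    then show "Gr \<noteq> {}" by (auto simp: Gr_def)
    fix C assume "C \<noteq> {}" and C: "subset.chain Gr C"
    define \<psi> where "\<psi> x = (THE y. (x, y) \<in> \<Union>C)" for x
    define L where "L = fst ` \<Union>C"
    \<comment> \<open>Any two points of the union lie in a single member of the chain. Thus the
      union is the graph of a function, and each field or homomorphism axiom can be checked in one
      member.\<close>
    have dir: "\<exists>L' \<psi>'. ok L' \<psi>' \<and> gr L' \<psi>' \<in> C \<and> P \<in> gr L' \<psi>' \<and> Q \<in> gr L' \<psi>'"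
      if PQ: "P \<in> \<Union>C" "Q \<in> \<Union>C" for P Q
    proof -
      obtain X Y where XY: "X \<in> C" "Y \<in> C" "P \<in> X" "Q \<in> Y" using PQ by blast
      then have "X \<subseteq> Y \<or> Y \<subseteq> X" using C unfolding subset.chain_def by blast
      then obtain Z where Z: "Z \<in> C" "P \<in> Z" "Q \<in> Z" using XY by blast
      then have "Z \<in> Gr" using C unfolding subset.chain_def by blast
      then show ?thesis using Z unfolding Gr_def by blast
    qed
    have uniq: "y = z" if yz: "(x, y) \<in> \<Union>C" "(x, z) \<in> \<Union>C" for x y z
      using dir[OF yz] by (auto simp: gr_def)
    have agree: "\<psi> x = \<psi>' x" if "gr L' \<psi>' \<in> C" "x \<in> L'" for L' \<psi>' x
      unfolding \<psi>_def
    proof (rule the_equality)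
      show *: "(x, \<psi>' x) \<in> \<Union>C" using that by (auto simp: gr_def)
      show "y = \<psi>' x" if "(x, y) \<in> \<Union>C" for y using uniq[OF that *] .
    qed
    have sub: "L' \<subseteq> L" if "gr L' \<psi>' \<in> C" for L' \<psi>' using that unfolding L_def gr_def by force
    have dir': "\<exists>L' \<psi>'. ok L' \<psi>' \<and> gr L' \<psi>' \<in> C \<and> x \<in> L' \<and> y \<in> L'" if xy: "x \<in> L" "y \<in> L" for x y
    proof -
      obtain a b where ab: "(x, a) \<in> \<Union>C" "(y, b) \<in> \<Union>C" using xy unfolding L_def by force
      then show ?thesis using dir[OF ab] by (auto simp: gr_def)
    qed
    obtain X where "X \<in> C" using \<open>C \<noteq> {}\<close> by blast
    moreover from this have "X \<in> Gr" using C unfolding subset.chain_def by blast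
    ultimately obtain L0 \<psi>0 where L0: "ok L0 \<psi>0" "gr L0 \<psi>0 \<in> C" unfolding Gr_def by blast
    have kL: "k \<subseteq> L" using L0 sub by (auto simp: ok_def)
    have "ok L \<psi>" unfolding ok_def
    proof (intro conjI)
      show "is_subfield L" unfolding is_subfield_def
      proof (intro conjI ballI)
        show "0 \<in> L" "1 \<in> L" using kL is_subfieldD[OF k] by auto
        fix x y assume "x \<in> L" "y \<in> L"
        then obtain L' \<psi>' where L': "ok L' \<psi>'" "gr L' \<psi>' \<in> C" "x \<in> L'" "y \<in> L'" using dir' by blast
        then have "is_subfield L'" by (simp add: ok_def)
        then show "x + y \<in> L" "x * y \<in> L" "- x \<in> L" "inverse x \<in> L"
          using L' sub[OF L'(2)] unfolding is_subfield_def by blast+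
      qed
      show "L \<subseteq> K" using dir' by (force simp: ok_def)
      show "field_hom_on L \<psi>" unfolding field_hom_on_def
      proof (intro conjI ballI)
        show "\<psi> 1 = 1"
        proof -
          have "field_hom_on L0 \<psi>0" "1 \<in> L0" using L0 is_subfieldD(2) by (auto simp: ok_def)
          then show ?thesis using agree[OF L0(2)] by (simp add: field_hom_on_def)
        qed
        fix x y assume "x \<in> L" "y \<in> L"
        then obtain L' \<psi>' where L': "ok L' \<psi>'" "gr L' \<psi>' \<in> C" "x \<in> L'" "y \<in> L'" using dir' by blast
        then have L'': "is_subfield L'" "field_hom_on L' \<psi>'" by (simp_all add: ok_def)
        then have "x + y \<in> L'" "x * y \<in> L'" using L' unfolding is_subfield_def by blast+
        then show "\<psi> (x + y) = \<psi> x + \<psi> y" "\<psi> (x * y) = \<psi> x * \<psi> y"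
          using L' L'' agree[OF L'(2)] by (auto simp: field_hom_on_def)
      qed
      show "\<forall>x\<in>k. \<psi> x = \<phi> x"
        using L0 agree[OF L0(2)] by (auto simp: ok_def)
    qed fact
    moreover have "\<Union>C = gr L \<psi>"
    proof
      show "\<Union>C \<subseteq> gr L \<psi>"
      proof
        fix P assume "P \<in> \<Union>C"
        then obtain L' \<psi>' where L': "ok L' \<psi>'" "gr L' \<psi>' \<in> C" "P \<in> gr L' \<psi>'" using dir by blast
        then show "P \<in> gr L \<psi>" using sub[OF L'(2)] agree[OF L'(2)] by (force simp: gr_def)
      qed
      show "gr L \<psi> \<subseteq> \<Union>C"
      proof
        fix P assume "P \<in> gr L \<psi>"
        then obtain x where x: "x \<in> L" "P = (x, \<psi> x)" by (auto simp: gr_def)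
        then obtain L' \<psi>' where L': "gr L' \<psi>' \<in> C" "x \<in> L'" using dir' by blast
        then have "P \<in> gr L' \<psi>'" using agree[OF L'] x by (auto simp: gr_def)
        then show "P \<in> \<Union>C" using L'(1) by blast
      qed
    qed
    ultimately show "\<Union>C \<in> Gr" unfolding Gr_def by blast
  qed
  then obtain M where M: "M \<in> Gr" "\<forall>X\<in>Gr. M \<subseteq> X \<longrightarrow> X = M" by blast
  then obtain L \<psi> where L: "ok L \<psi>" "M = gr L \<psi>" unfolding Gr_def by blast
  have max: "gr L' \<psi>' = gr L \<psi>" if "ok L' \<psi>'" "gr L \<psi> \<subseteq> gr L' \<psi>'" for L' \<psi>'
  proof -
    have "gr L' \<psi>' \<in> Gr" using that(1) unfolding Gr_def by blast
    then show ?thesis using M(2) that(2) L(2) by blast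
  qed
  have L': "is_subfield L" "k \<subseteq> L" "L \<subseteq> K" "field_hom_on L \<psi>" "\<forall>x\<in>k. \<psi> x = \<phi> x" using L by (auto simp: ok_def)
  note Lr = is_subfield_is_subring[OF L'(1)]
  \<comment> \<open>A maximal domain is all of \<open>K\<close>: the transported minimal polynomial
    of \<open>b\<close> has a root in the algebraically closed target, and sending \<open>b\<close>
    there extends \<open>\<psi>\<close>.\<close>
  have "b \<in> L" if b: "b \<in> K" for b
  proof -
    have alg: "algebraic_over L b" using K(3)[OF b] L'(2) by (rule algebraic_over_mono)
    obtain m where m: "is_min_poly L b m" using is_min_poly_exists[OF L'(1) alg] by blast
    have "degree (map_poly \<psi> m) = degree m"
      using m field_hom_onD[OF Lr L'(4)] by (intro map_poly_degree_eq) (auto simp: is_min_poly_def)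
    then have "\<exists>\<beta>. poly (map_poly \<psi> m) \<beta> = 0"
      using is_min_poly_degree_pos[OF m] by (intro alg_closed_imp_poly_has_root) auto
    then obtain \<beta> where \<beta>: "poly (map_poly \<psi> m) \<beta> = 0" by blast
    obtain \<psi>' where \<psi>': "field_hom_on (adjoin L b) \<psi>'" "\<forall>x\<in>L. \<psi>' x = \<psi> x"
      using field_hom_extends_adjoin[OF L'(1) L'(4) m \<beta>] by blast
    have sub: "L \<subseteq> adjoin L b" "b \<in> adjoin L b" using adjoin_superset[OF Lr] adjoin_generator[OF Lr] by blast+
    have "adjoin L b \<subseteq> K" using adjoin_minimal[OF is_subfield_is_subring[OF K(1)] L'(3) b] .
    then have "ok (adjoin L b) \<psi>'"
      unfolding ok_def using is_subfield_adjoin[OF L'(1) alg] L' sub \<psi>' by auto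
    moreover have "gr L \<psi> \<subseteq> gr (adjoin L b) \<psi>'" using sub(1) \<psi>'(2) by (force simp: gr_def)
    ultimately have "gr (adjoin L b) \<psi>' = gr L \<psi>" by (rule max)
    then have "fst ` gr (adjoin L b) \<psi>' = fst ` gr L \<psi>" by simp
    then have "adjoin L b = L" unfolding gr_def by (simp add: image_image)
    then show ?thesis using sub(2) by simp
  qed
  then have "L = K" using L'(3) by blast
  then show ?thesis using L' by blast
qed

subsection \<open>Euclidean subrings and their fields of fractions\<close>

lemma poly_cong:
  assumes subring: "is_subring A" and m: "poly_over A m" and xy: "x \<in> A" "y \<in> A"
  shows "\<exists>z\<in>A. poly m x - poly m y = (x - y) * z"
  using m
proof (induction m)
  case 0
  then show ?case using is_subringD(1)[OF subring] by auto
next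
  case (pCons a m)
  then obtain z where z: "z \<in> A" "poly m x - poly m y = (x - y) * z" by auto
  have "poly m y \<in> A" using pCons.prems xy by (intro poly_in_subring[OF subring]) auto
  moreover have "poly (pCons a m) x - poly (pCons a m) y = (x - y) * poly m y + x * (poly m x - poly m y)"
    by (simp add: algebra_simps)
  then have "poly (pCons a m) x - poly (pCons a m) y = (x - y) * (poly m y + x * z)"
    unfolding z(2) by (simp add: algebra_simps)
  moreover have "poly m y + x * z \<in> A" using calculation z xy is_subringD[OF subring] by simp
  ultimately show ?case by blast
qed

text \<open>The condition \<open>inverse b \<notin> A\<close> says that \<open>b\<close> is not a
  unit. The last assumption says that a nonconstant polynomial takes, on every progression
  \<open>u + e * x\<close>, a nonzero value that does not divide \<open>c\<close>. It supplies new
  primes in Euclid's argument, and excludes fields as well as discrete valuation rings, where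
  \<open>1 + p X\<close> has only unit values.\<close>

locale euclidean_subring =
  fixes A :: "'a::field set" and \<delta> :: "'a \<Rightarrow> nat"
  assumes subring: "is_subring A"
    and division: "\<And>a b. a \<in> A \<Longrightarrow> b \<in> A \<Longrightarrow> b \<noteq> 0 \<Longrightarrow> \<exists>q\<in>A. \<exists>r\<in>A. a = q * b + r \<and> (r = 0 \<or> \<delta> r < \<delta> b)"
    and size_mult: "\<And>a b. a \<in> A \<Longrightarrow> b \<in> A \<Longrightarrow> a \<noteq> 0 \<Longrightarrow> b \<noteq> 0 \<Longrightarrow> inverse b \<notin> A \<Longrightarrow> \<delta> a < \<delta> (a * b)"
    and nonunit_value: "\<And>m u c e. poly_over A m \<Longrightarrow> degree m > 0 \<Longrightarrow> u \<in> A \<Longrightarrow> c \<in> A \<Longrightarrow> e \<in> A \<Longrightarrow>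
      c \<noteq> 0 \<Longrightarrow> e \<noteq> 0 \<Longrightarrow> \<exists>x\<in>A. poly m (u + e * x) \<noteq> 0 \<and> c / poly m (u + e * x) \<notin> A"
begin

lemmas ring = is_subringD[OF subring]

section \<open>Divisibility and prime elements\<close>

definition divides :: "'a \<Rightarrow> 'a \<Rightarrow> bool" where
  "divides p x \<longleftrightarrow> (\<exists>z\<in>A. x = p * z)"

text \<open>Prime elements are characterised by \<open>A / p A\<close> being a field.\<close>

definition prime_elt :: "'a \<Rightarrow> bool" where
  "prime_elt p \<longleftrightarrow> p \<in> A \<and> p \<noteq> 0 \<and> inverse p \<notin> A \<and>
     (\<forall>x\<in>A. \<not> divides p x \<longrightarrow> (\<exists>y\<in>A. divides p (x * y - 1)))"

lemma dividesI: "z \<in> A \<Longrightarrow> x = p * z \<Longrightarrow> divides p x"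
  unfolding divides_def by blast

lemma divides_add: "divides p x \<Longrightarrow> divides p y \<Longrightarrow> divides p (x + y)"
  unfolding divides_def by (metis distrib_left ring(3))

lemma divides_minus: "divides p x \<Longrightarrow> divides p (- x)"
  unfolding divides_def by (metis mult_minus_right ring(5))

lemma divides_diff: "divides p x \<Longrightarrow> divides p y \<Longrightarrow> divides p (x - y)"
  using divides_add[of p x "- y"] divides_minus by simp

lemma divides_mult: "divides p x \<Longrightarrow> y \<in> A \<Longrightarrow> divides p (y * x)"
  unfolding divides_def by (metis mult.left_commute ring(4))

lemma divides_trans: "divides p x \<Longrightarrow> divides x y \<Longrightarrow> divides p y"
  unfolding divides_def by (metis mult.assoc ring(4))

lemma divides_self: "divides p p"
  unfolding divides_def using ring(2) by (metis mult.right_neutral)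

lemma divides_power_le: "p \<in> A \<Longrightarrow> i \<le> j \<Longrightarrow> divides (p ^ i) (p ^ j)"
  unfolding divides_def using is_subring_power[OF subring, of p "j - i"]
  by (metis le_add_diff_inverse power_add)

text \<open>A nonunit divisor \<open>p\<close> of \<open>n\<close> of least size works. For
  \<open>x\<close> not divisible by \<open>p\<close>, let \<open>g\<close> be a greatest common
  divisor of \<open>p\<close> and \<open>x\<close>. If \<open>g\<close> is a unit, Bezout's identity
  inverts \<open>x\<close> modulo \<open>p\<close>; otherwise minimality makes \<open>g\<close> an
  associate of \<open>p\<close>, and \<open>p\<close> divides \<open>x\<close> after all.\<close>

lemma prime_elt_exists:
  assumes n: "n \<in> A" "n \<noteq> 0" "inverse n \<notin> A"
  shows "\<exists>p. prime_elt p \<and> divides p n"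
proof -
  let ?P = "\<lambda>p. p \<in> A \<and> inverse p \<notin> A \<and> divides p n"
  have "?P n" using n divides_self by blast
  then obtain p where p: "?P p" and pmin: "\<And>g. ?P g \<Longrightarrow> \<delta> p \<le> \<delta> g"
    using ex_has_least_nat[of ?P n \<delta>] by blast
  have p0: "p \<noteq> 0" using p n by (auto simp: divides_def)
  have "\<exists>y\<in>A. divides p (x * y - 1)" if x: "x \<in> A" "\<not> divides p x" for x
  proof -
    \<comment> \<open>The nonzero elements of the ideal generated by \<open>p\<close> and
      \<open>x\<close>; one of least size generates the ideal.\<close>
    let ?I = "\<lambda>g. g \<noteq> 0 \<and> (\<exists>a\<in>A. \<exists>b\<in>A. g = a * p + b * x)"
    have Ip: "?I p" using p0 ring by (intro conjI bexI[of _ 1] bexI[of _ 0]) auto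
    obtain g where g: "?I g" and gmin: "\<And>h. ?I h \<Longrightarrow> \<delta> g \<le> \<delta> h"
      using ex_has_least_nat[of ?I p \<delta>] Ip by blast
    obtain a b where ab: "a \<in> A" "b \<in> A" "g = a * p + b * x" using g by blast
    have gA: "g \<in> A" using ab p x ring by simp
    have div: "divides g (c * p + d * x)" if cd: "c \<in> A" "d \<in> A" for c d
    proof -
      obtain q r where qr: "q \<in> A" "r \<in> A" "c * p + d * x = q * g + r" "r = 0 \<or> \<delta> r < \<delta> g"
        using division[of "c * p + d * x" g] cd p x gA g ring by auto
      have "r = (c - q * a) * p + (d - q * b) * x" using qr ab by (simp add: algebra_simps)
      moreover have "c - q * a \<in> A" "d - q * b \<in> A" using cd ab qr ring by simp_all
      ultimately have "r = 0" using gmin[of r] qr(4) by (metis linorder_not_less)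
      then show ?thesis using qr by (auto simp: divides_def mult.commute)
    qed
    have gp: "divides g p" using div[of 1 0] ring by simp
    have gx: "divides g x" using div[of 0 1] ring by simp
    show ?thesis
    proof (cases "inverse g \<in> A")
      case True
      have "g * inverse g = 1" using g by simp
      then have "x * (b * inverse g) - 1 = p * (- (a * inverse g))"
        unfolding ab(3) by (simp add: algebra_simps)
      moreover have "b * inverse g \<in> A" "- (a * inverse g) \<in> A" using True ab ring by simp_all
      ultimately show ?thesis unfolding divides_def by blast
    next
      case False
      then have "\<delta> p \<le> \<delta> g" using pmin gA gp p divides_trans by blast
      moreover obtain w where w: "w \<in> A" "p = g * w" using gp by (auto simp: divides_def)
      ultimately have "inverse w \<in> A" using size_mult[OF gA w(1)] g p0 by fastforce
      moreover have "g = p * inverse w" using w p0 by simp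
      ultimately have "divides p g" by (auto simp: divides_def)
      then show ?thesis using gx x divides_trans by blast
    qed
  qed
  then show ?thesis using p p0 unfolding prime_elt_def by blast
qed

lemma prime_elt_mult:
  assumes p: "prime_elt p" and xy: "x \<in> A" "y \<in> A" "\<not> divides p x" "\<not> divides p y"
  shows "\<not> divides p (x * y)"
proof
  assume d: "divides p (x * y)"
  obtain z where z: "z \<in> A" "divides p (x * z - 1)" using p xy by (auto simp: prime_elt_def)
  have "divides p (z * (x * y) - y * (x * z - 1))"
    using divides_diff[OF divides_mult[OF d z(1)] divides_mult[OF z(2) xy(2)]] .
  moreover have "z * (x * y) - y * (x * z - 1) = y" by (simp add: algebra_simps)
  ultimately show False using xy by simp
qed

lemma prime_elt_one: "prime_elt p \<Longrightarrow> \<not> divides p 1"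
  unfolding prime_elt_def divides_def by (metis inverse_unique)

lemma prime_elt_power:
  assumes "prime_elt p" "x \<in> A" "\<not> divides p x"
  shows "\<not> divides p (x ^ n)"
  by (induction n) (use assms prime_elt_one prime_elt_mult is_subring_power[OF subring] in auto)

text \<open>Dividing by the nonunit \<open>p\<close> lowers the size, so the factors
  \<open>p\<close> run out. The exponent plays the role of the valuation at
  \<open>p\<close>.\<close>

lemma prime_elt_exponent:
  assumes p: "prime_elt p" and x: "x \<in> A" "x \<noteq> 0"
  shows "\<exists>n z. z \<in> A \<and> x = p ^ n * z \<and> \<not> divides p z"
  using x
proof (induction "\<delta> x" arbitrary: x rule: less_induct)
  case less
  show ?case
  proof (cases "divides p x")
    case False
    with less.prems show ?thesis by (intro exI[of _ 0] exI[of _ x]) auto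
  next
    case True
    then obtain y where y: "y \<in> A" "x = p * y" by (auto simp: divides_def)
    with less.prems have y0: "y \<noteq> 0" by auto
    then have "\<delta> y < \<delta> x" using size_mult[of y p] p y by (auto simp: prime_elt_def mult.commute)
    then obtain n z where "z \<in> A" "y = p ^ n * z" "\<not> divides p z" using less.hyps y y0 by blast
    then show ?thesis using y by (intro exI[of _ "Suc n"] exI[of _ z]) auto
  qed
qed

text \<open>One half of the uniqueness of exponents; used in both directions it gives
  equality.\<close>

lemma exponent_le:
  assumes p: "p \<in> A" "p \<noteq> 0" and "x \<in> A" "y \<in> A" "\<not> divides p x" "p ^ i * x = p ^ j * y"
  shows "j \<le> i"
proof (rule ccontr)
  assume "\<not> j \<le> i"
  then obtain d where d: "j = i + Suc d" by (metis add_Suc_right less_imp_Suc_add linorder_not_le)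
  then have "p ^ i * x = p ^ i * (p * (p ^ d * y))" using assms by (simp add: power_add mult_ac)
  then have x: "x = p * (p ^ d * y)" using p by simp
  have "p ^ d * y \<in> A" using assms is_subring_power[OF subring] ring by simp
  then show False using x assms by (auto simp: divides_def)
qed

section \<open>Hensel lifting by approximate roots\<close>

lemma poly_taylor2:
  assumes "poly_over A m" "x \<in> A" "y \<in> A"
  shows "\<exists>z\<in>A. poly m (x + y) = poly m x + y * poly (pderiv m) x + y ^ 2 * z"
  using assms(1)
proof (induction m)
  case 0
  then show ?case using ring by auto
next
  case (pCons a m)
  then obtain z where z: "z \<in> A" "poly m (x + y) = poly m x + y * poly (pderiv m) x + y ^ 2 * z" by auto
  have "poly (pderiv m) x \<in> A" using pCons.prems assms by (intro poly_in_subring[OF subring] poly_over_closed[OF subring]) auto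
  then show ?case using z assms ring
    by (intro bexI[of _ "poly (pderiv m) x + (x + y) * z"])
       (simp_all add: pderiv_pCons power2_eq_square algebra_simps)
qed

lemma poly_divides_cong:
  assumes "poly_over A m" "x \<in> A" "y \<in> A" "divides d (x - y)"
  shows "divides d (poly m x - poly m y)"
  using poly_cong[OF subring assms(1-3)] divides_mult[OF assms(4)] by (auto simp: mult.commute)

text \<open>Newton's correction \<open>- m(u) / m'(u)\<close>, in which division by the derivative
  is replaced by multiplication with its inverse \<open>y\<close> modulo \<open>p\<close>.\<close>

lemma hensel_step:
  assumes p: "prime_elt p" and m: "poly_over A m" and u: "u \<in> A" "divides (p ^ Suc k) (poly m u)"
    "\<not> divides p (poly (pderiv m) u)"
  shows "\<exists>v\<in>A. divides (p ^ Suc (Suc k)) (poly m v) \<and> divides (p ^ Suc k) (v - u)"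
proof -
  have pA: "p \<in> A" using p by (simp add: prime_elt_def)
  have P: "p ^ i \<in> A" for i using is_subring_power[OF subring pA] .
  have d: "poly (pderiv m) u \<in> A" using m u by (intro poly_in_subring[OF subring] poly_over_closed[OF subring])
  obtain y where y: "y \<in> A" "divides p (poly (pderiv m) u * y - 1)" using p d u by (auto simp: prime_elt_def)
  obtain t where t: "t \<in> A" "poly (pderiv m) u * y - 1 = p * t" using y by (auto simp: divides_def)
  obtain c where c: "c \<in> A" "poly m u = p ^ Suc k * c" using u by (auto simp: divides_def)
  define h where "h = - (p ^ Suc k * (c * y))"
  have h: "h \<in> A" unfolding h_def by (intro ring P c y)
  obtain z where z: "z \<in> A" "poly m (u + h) = poly m u + h * poly (pderiv m) u + h ^ 2 * z"
    using poly_taylor2[OF m u(1) h] by blast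
  have "poly m u + h * poly (pderiv m) u = - (p ^ Suc k * c * (poly (pderiv m) u * y - 1))"
    by (simp add: c(2) h_def algebra_simps)
  also have "\<dots> = p ^ Suc (Suc k) * (- (c * t))" unfolding t by (simp add: mult_ac)
  finally have "divides (p ^ Suc (Suc k)) (poly m u + h * poly (pderiv m) u)"
    by (rule dividesI[rotated]) (intro ring c t)
  \<comment> \<open>The quadratic term carries the exponent
    \<open>2 * (k + 1) = (k + 2) + k\<close>. This is why the lifting has to start from exponent
    one.\<close>
  moreover have "h ^ 2 * z = p ^ Suc (Suc k) * (p ^ k * ((c * y) ^ 2 * z))"
    by (simp add: h_def power2_eq_square mult_ac)
  then have "divides (p ^ Suc (Suc k)) (h ^ 2 * z)"
    by (rule dividesI[rotated]) (intro ring is_subring_power[OF subring] P c y z)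
  ultimately have "divides (p ^ Suc (Suc k)) (poly m (u + h))" unfolding z(2) by (rule divides_add)
  moreover have "u + h - u = p ^ Suc k * (- (c * y))" by (simp add: h_def)
  then have "divides (p ^ Suc k) (u + h - u)" by (rule dividesI[rotated]) (intro ring c y)
  moreover have "u + h \<in> A" using u h ring by simp
  ultimately show ?thesis by blast
qed

text \<open>A substitute for a root in the completion. The element \<open>v\<close> determines the
  root modulo \<open>p ^ 2\<close>, which is enough to recognise valuation one, while
  \<open>w\<close> follows it to any precision \<open>k\<close> demanded later.\<close>

lemma hensel:
  assumes p: "prime_elt p" and m: "poly_over A m" and u: "u \<in> A" "divides p (poly m u)"
    "\<not> divides p (poly (pderiv m) u)"
  shows "\<exists>v\<in>A. divides p (v - u) \<and> (\<forall>k. \<exists>w\<in>A. divides (p ^ k) (poly m w) \<and> divides (p ^ 2) (w - v))"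
proof -
  have pA: "p \<in> A" using p by (simp add: prime_elt_def)
  have d: "poly_over A (pderiv m)" using m by (rule poly_over_closed[OF subring])
  have keep: "\<not> divides p (poly (pderiv m) w)" if w: "w \<in> A" "divides p (w - u)" for w
  proof
    assume "divides p (poly (pderiv m) w)"
    then have "divides p (poly (pderiv m) w - (poly (pderiv m) w - poly (pderiv m) u))"
      using poly_divides_cong[OF d w(1) u(1) w(2)] by (rule divides_diff)
    then show False using u by simp
  qed
  \<comment> \<open>One step settles \<open>v\<close>; all later steps move by multiples of
    \<open>p ^ 2\<close> only.\<close>
  obtain v where v: "v \<in> A" "divides (p ^ 2) (poly m v)" "divides p (v - u)"
    using hensel_step[OF p m u(1), of 0] u by (auto simp: power2_eq_square)
  have p2: "divides p x" if "divides (p ^ 2) x" for x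
    using that divides_power_le[OF pA, of 1 2] divides_trans by auto
  have *: "\<exists>w\<in>A. divides (p ^ Suc (Suc k)) (poly m w) \<and> divides (p ^ 2) (w - v)" for k
  proof (induction k)
    case 0
    have "divides (p ^ 2) (v - v)" using ring by (auto simp: divides_def)
    then show ?case using v by (auto simp: power2_eq_square)
  next
    case (Suc k)
    then obtain w where w: "w \<in> A" "divides (p ^ Suc (Suc k)) (poly m w)" "divides (p ^ 2) (w - v)" by blast
    have "divides p (w - u)" using divides_add[OF p2[OF w(3)] v(3)] by simp
    then have "\<not> divides p (poly (pderiv m) w)" using keep w(1) by blast
    then obtain x where x: "x \<in> A" "divides (p ^ Suc (Suc (Suc k))) (poly m x)" "divides (p ^ Suc (Suc k)) (x - w)"
      using hensel_step[OF p m w(1,2)] by blast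
    have "divides (p ^ 2) (x - w)"
      using x(3) divides_power_le[OF pA, of 2 "Suc (Suc k)"] divides_trans by auto
    then have "divides (p ^ 2) (x - v)" using divides_add[OF _ w(3), of "x - w"] by simp
    then show ?case using x by blast
  qed
  have "\<exists>w\<in>A. divides (p ^ k) (poly m w) \<and> divides (p ^ 2) (w - v)" for k
  proof -
    obtain w where w: "w \<in> A" "divides (p ^ Suc (Suc k)) (poly m w)" "divides (p ^ 2) (w - v)" using *[of k] by blast
    have "divides (p ^ k) (poly m w)" using w(2) divides_power_le[OF pA, of k "Suc (Suc k)"] divides_trans by auto
    then show ?thesis using w by blast
  qed
  then show ?thesis using v by blast
qed

text \<open>Euclid's argument: \<open>m (u + m u * d * x)\<close> is \<open>m u\<close> times an element congruent to \<open>1\<close> modulo \<open>d\<close>.\<close>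

lemma prime_divisor_of_value:
  assumes m: "poly_over A m" "degree m > 0" and d: "d \<in> A" "d \<noteq> 0"
  shows "\<exists>u\<in>A. \<exists>p. prime_elt p \<and> divides p (poly m u) \<and> \<not> divides p d"
proof -
  obtain u where u: "u \<in> A" "poly m u \<noteq> 0"
    using nonunit_value[OF m, of 0 1 1] ring by auto
  define c where "c = poly m u"
  have c: "c \<in> A" "c \<noteq> 0" using u m poly_in_subring[OF subring] by (auto simp: c_def)
  \<comment> \<open>With the value \<open>c\<close> itself as the element not to be divided, the
    quotient \<open>n\<close> of the new value by \<open>c\<close> is a nonzero nonunit and so has a
    prime divisor.\<close>
  obtain x where x: "x \<in> A" "poly m (u + c * d * x) \<noteq> 0" "c / poly m (u + c * d * x) \<notin> A"
    using nonunit_value[OF m u(1) c(1), of "c * d"] c d ring by auto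
  have v: "u + c * d * x \<in> A" using u c d x ring by simp
  obtain z where z: "z \<in> A" "poly m (u + c * d * x) - poly m u = (u + c * d * x - u) * z"
    using poly_cong[OF subring m(1) v u(1)] by blast
  define n where "n = 1 + d * (x * z)"
  have n: "poly m (u + c * d * x) = c * n" using z by (simp add: n_def c_def algebra_simps)
  have nA: "n \<in> A" using d x z ring by (simp add: n_def)
  have "c / (c * n) = inverse n" using c by (simp add: field_simps)
  then have "n \<noteq> 0" "inverse n \<notin> A" using x c unfolding n by auto
  then obtain p where p: "prime_elt p" "divides p n" using prime_elt_exists[OF nA] by blast
  have "\<not> divides p d"
  proof
    assume "divides p d"
    then have "divides p (x * z * d)" using x z ring by (intro divides_mult) auto
    then have "divides p (n - x * z * d)" using p by (intro divides_diff)
    then show False using prime_elt_one[OF p(1)] by (simp add: n_def mult_ac)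
  qed
  moreover have "divides p (poly m (u + c * d * x))" unfolding n using p c by (intro divides_mult)
  ultimately show ?thesis using p v by blast
qed

section \<open>Fields of fractions and common denominators\<close>

definition quot_field :: "'a set" where "quot_field = {a / b | a b. a \<in> A \<and> b \<in> A \<and> b \<noteq> 0}"

lemma quot_field_superset: "A \<subseteq> quot_field"
  unfolding quot_field_def using ring(2) by (force intro: exI[of _ 1])

lemma is_subfield_quot_field: "is_subfield quot_field"
proof -
  have I: "a / b \<in> quot_field" if "a \<in> A" "b \<in> A" "b \<noteq> 0" for a b using that by (auto simp: quot_field_def)
  show ?thesis unfolding is_subfield_def
  proof (intro conjI ballI)
    show "0 \<in> quot_field" "1 \<in> quot_field" using quot_field_superset ring by auto
    fix x y assume "x \<in> quot_field" "y \<in> quot_field"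
    then obtain a b c d where x: "x = a / b" "a \<in> A" "b \<in> A" "b \<noteq> 0" and y: "y = c / d" "c \<in> A" "d \<in> A" "d \<noteq> 0"
      by (auto simp: quot_field_def)
    have "x + y = (a * d + c * b) / (b * d)" "x * y = (a * c) / (b * d)" "- x = (- a) / b"
      using x y by (simp_all add: add_frac_eq)
    then show "x + y \<in> quot_field" "x * y \<in> quot_field" "- x \<in> quot_field"
      using x y by (simp_all only: x(1) y(1)) (intro I ring; simp)+
    show "inverse x \<in> quot_field"
    proof (cases "a = 0")
      case True then show ?thesis using x \<open>0 \<in> quot_field\<close> by simp
    next
      case False then show ?thesis using I[of b a] x by simp
    qed
  qed
qed

lemma clear_denominators:
  assumes "poly_over quot_field p"
  shows "\<exists>e\<in>A. e \<noteq> 0 \<and> poly_over A (smult e p)"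
  using assms
proof (induction p)
  case 0
  then show ?case using ring by (intro bexI[of _ 1]) (auto simp: poly_over_closed[OF subring])
next
  case (pCons a p)
  then obtain e where e: "e \<in> A" "e \<noteq> 0" "poly_over A (smult e p)" by auto
  obtain x y where xy: "a = x / y" "x \<in> A" "y \<in> A" "y \<noteq> 0" using pCons.prems by (auto simp: quot_field_def)
  have "smult (e * y) (pCons a p) = pCons (e * x) (smult y (smult e p))" using xy by (simp add: mult.commute)
  also have "poly_over A \<dots>" using xy e ring by (simp add: poly_over_closed[OF subring] del: smult_smult)
  finally show ?case using e xy ring by (intro bexI[of _ "e * y"]) auto
qed

text \<open>Elements of the extension become, up to one common factor \<open>D\<close>, values at
  \<open>\<theta>\<close> of polynomials over \<open>A\<close>. These can also be evaluated at
  approximate roots inside \<open>A\<close>, which is how reduction at a place is expressed.\<close>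

lemma clear_denominators_adjoin:
  assumes "finite X" "X \<subseteq> adjoin quot_field \<theta>"
  shows "\<exists>D\<in>A. D \<noteq> 0 \<and> (\<forall>x\<in>X. \<exists>\<rho>. poly_over A \<rho> \<and> D * x = poly \<rho> \<theta>)"
  using assms
proof (induction X rule: finite_induct)
  case empty
  then show ?case using ring by (intro bexI[of _ 1]) auto
next
  case (insert y X)
  then obtain D where D: "D \<in> A" "D \<noteq> 0" "\<forall>x\<in>X. \<exists>\<rho>. poly_over A \<rho> \<and> D * x = poly \<rho> \<theta>" by auto
  obtain g where g: "poly_over quot_field g" "y = poly g \<theta>" using insert.prems by (auto simp: adjoin_def)
  obtain e where e: "e \<in> A" "e \<noteq> 0" "poly_over A (smult e g)" using clear_denominators[OF g(1)] by blast
  have "\<exists>\<rho>. poly_over A \<rho> \<and> D * e * x = poly \<rho> \<theta>" if x: "x \<in> insert y X" for x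
  proof (cases "x = y")
    case True
    have "poly_over A (smult D (smult e g))" using poly_over_closed(9)[OF subring D(1) e(3)] .
    moreover have "D * e * x = poly (smult D (smult e g)) \<theta>" using True g by simp
    ultimately show ?thesis by blast
  next
    case False
    then obtain \<rho> where "poly_over A \<rho>" "D * x = poly \<rho> \<theta>" using D x by auto
    then show ?thesis using e
      by (intro exI[of _ "smult e \<rho>"]) (auto simp: poly_over_closed[OF subring] mult_ac)
  qed
  then show ?case using D e ring by (intro bexI[of _ "D * e"]) auto
qed

lemma divides_prod_list:
  "x \<in> set xs \<Longrightarrow> set xs \<subseteq> A \<Longrightarrow> divides p x \<Longrightarrow> divides p (prod_list xs)"
proof (induction xs)
  case (Cons y xs)
  have "prod_list xs \<in> A" using Cons.prems by (intro is_subring_prod_list[OF subring]) auto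
  then show ?case using Cons divides_mult[of p y "prod_list xs"] divides_mult[of p "prod_list xs" y]
    by (auto simp: mult.commute)
qed simp

lemma prime_elt_prod_list:
  assumes "prime_elt p" "\<And>x. x \<in> set xs \<Longrightarrow> x \<in> A \<and> \<not> divides p x"
  shows "\<not> divides p (prod_list xs)"
  using assms(2)
proof (induction xs)
  case Nil
  then show ?case using prime_elt_one assms by simp
next
  case (Cons y xs)
  have "prod_list xs \<in> A" using Cons.prems by (intro is_subring_prod_list[OF subring]) auto
  then show ?case using Cons prime_elt_mult[OF assms(1)] by simp
qed

lemma poly_prod_list_map: "poly (prod_list (map f xs)) y = (\<Prod>x\<leftarrow>xs. poly (f x) y)"
  by (induction xs) auto

text \<open>
  Modulo a suitable prime \<open>p\<close> of \<open>A\<close>, the minimal polynomial of \<open>\<theta>\<close> has a simple root. This gives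
  an unramified place of degree one, and \<open>s\<close> is chosen such that \<open>s - r\<close> has valuation \<open>1\<close> there
  while all \<open>s - x\<close> are units. The place is represented by the approximate roots from \<open>hensel\<close>.
\<close>

lemma exists_nonsquare_value:
  assumes f: "poly_over quot_field f" "poly f \<theta> = 0" "poly (pderiv f) \<theta> \<noteq> 0"
    and r: "r \<in> adjoin quot_field \<theta>" "set rs \<subseteq> adjoin quot_field \<theta>" "r \<notin> set rs" and q: "odd q"
  shows "\<exists>s\<in>A. \<forall>w\<in>adjoin quot_field \<theta>. ((s - r) * (\<Prod>x\<leftarrow>rs. s - x)) ^ q \<noteq> w ^ 2"
proof -
  note Q = is_subfield_quot_field
  note Qr = is_subfield_is_subring[OF Q]
  note P = poly_over_closed[OF subring]
  have toQ: "poly_over quot_field g" if "poly_over A g" for g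
    using that quot_field_superset by (rule poly_over_mono)
  have "f \<noteq> 0" using f(3) by auto
  then have alg: "algebraic_over quot_field \<theta>" using f by (auto simp: algebraic_over_def)
  obtain m0 where m0: "is_min_poly quot_field \<theta> m0" using is_min_poly_exists[OF Q alg] by blast
  then have m0': "poly_over quot_field m0" "poly m0 \<theta> = 0" "m0 \<noteq> 0" using is_min_poly_nonzero by (auto simp: is_min_poly_def)
  obtain e0 where e0: "e0 \<in> A" "e0 \<noteq> 0" "poly_over A (smult e0 m0)" using clear_denominators[OF m0'(1)] by blast
  \<comment> \<open>The leading coefficient is now \<open>e0\<close>, so \<open>\<theta>\<close>
    need not be integral over \<open>A\<close>; only divisibility over the field of fractions is
    used below.\<close>
  define m where "m = smult e0 m0"
  have m: "poly_over A m" "poly m \<theta> = 0" "degree m > 0"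
    using e0 m0' is_min_poly_degree_pos[OF m0] by (auto simp: m_def)
  have mdvd: "\<exists>h. poly_over quot_field h \<and> g = m * h" if g: "poly_over quot_field g" "poly g \<theta> = 0" for g
  proof -
    obtain h where h: "poly_over quot_field h" "g = m0 * h" using is_min_poly_dvd[OF Q m0 g] by blast
    have "inverse e0 \<in> quot_field" using e0 quot_field_superset is_subfield_inverse[OF Q] by blast
    then have "poly_over quot_field (smult (inverse e0) h)" using h by (intro poly_over_closed[OF Qr])
    moreover have "g = m * smult (inverse e0) h" using h e0 by (simp add: m_def)
    ultimately show ?thesis by blast
  qed
  have m': "poly (pderiv m) \<theta> \<noteq> 0"
  proof -
    obtain h where "f = m * h" using mdvd[OF f(1,2)] by blast
    then show ?thesis using f(3) m(2) by (auto simp: pderiv_mult)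
  qed
  have "finite (insert r (set rs))" "insert r (set rs) \<subseteq> adjoin quot_field \<theta>" using r by auto
  from clear_denominators_adjoin[OF this]
  obtain D where D: "D \<in> A" "D \<noteq> 0" "\<forall>x\<in>insert r (set rs). \<exists>\<rho>. poly_over A \<rho> \<and> D * x = poly \<rho> \<theta>" by blast
  obtain \<rho> where \<rho>: "\<forall>x\<in>insert r (set rs). poly_over A (\<rho> x) \<and> D * x = poly (\<rho> x) \<theta>"
    using bchoice[OF D(3)] by blast
  have \<rho>A: "poly_over A (\<rho> x)" if "x = r \<or> x \<in> set rs" for x using \<rho> that by blast
  have \<rho>\<theta>: "poly (\<rho> x) \<theta> = D * x" if "x = r \<or> x \<in> set rs" for x using \<rho> that by auto
  \<comment> \<open>One polynomial gathers everything that must be a unit at the place: the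
    denominator \<open>D\<close>, the derivative of \<open>m\<close> for the simple root, and the
    differences that separate \<open>r\<close> from the members of \<open>rs\<close>.\<close>
  define g where "g = smult D (pderiv m * (\<Prod>x\<leftarrow>rs. \<rho> r - \<rho> x))"
  have gA: "poly_over A g" unfolding g_def
    by (intro P poly_over_prod_list[OF subring] D m) (auto intro!: P(6) \<rho>A)
  have "(\<Prod>x\<leftarrow>rs. D * r - poly (\<rho> x) \<theta>) \<noteq> 0"
    using D(2) r(3) \<rho>\<theta> by (auto simp: prod_list_zero_iff)
  then have g\<theta>: "poly g \<theta> \<noteq> 0"
    using m' D(2) \<rho>\<theta>[of r] by (simp add: g_def poly_prod_list_map)
  \<comment> \<open>The relation \<open>u * g - 1 = m * h\<close> obtained from this inverse is a
    Bezout identity for \<open>g\<close> and \<open>m\<close>. After clearing its denominators, a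
    prime dividing values of both at the same point must divide \<open>e1 * e2\<close>, which the
    choice of \<open>p\<close> forbids.\<close>
  obtain u where u: "poly_over quot_field u" "poly u \<theta> * poly g \<theta> = 1"
    using poly_value_inverse[OF Q alg toQ[OF gA] g\<theta>] by blast
  have "\<exists>h. poly_over quot_field h \<and> u * g - 1 = m * h"
    using u toQ[OF gA] by (intro mdvd) (auto simp: poly_over_closed[OF Qr])
  then obtain h where h: "poly_over quot_field h" "u * g - 1 = m * h" by blast
  obtain e1 where e1: "e1 \<in> A" "e1 \<noteq> 0" "poly_over A (smult e1 u)" using clear_denominators[OF u(1)] by blast
  obtain e2 where e2: "e2 \<in> A" "e2 \<noteq> 0" "poly_over A (smult e2 h)" using clear_denominators[OF h(1)] by blast
  have "e1 * e2 \<in> A" "e1 * e2 \<noteq> 0" using e1 e2 ring by auto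
  from prime_divisor_of_value[OF m(1,3) this]
  obtain u0 p where p: "u0 \<in> A" "prime_elt p" "divides p (poly m u0)" "\<not> divides p (e1 * e2)" by blast
  have pA: "p \<in> A" "p \<noteq> 0" using p by (auto simp: prime_elt_def)
  have pg: "\<not> divides p (poly g u0)"
  proof
    assume a: "divides p (poly g u0)"
    have "poly (u * g - 1) u0 = poly (m * h) u0" by (simp only: h)
    then have "1 = poly u u0 * poly g u0 - poly h u0 * poly m u0" by (simp add: algebra_simps)
    then have "e1 * e2 = e2 * poly (smult e1 u) u0 * poly g u0 - e1 * poly (smult e2 h) u0 * poly m u0"
      by (metis (no_types, opaque_lifting) poly_smult mult.assoc mult.commute mult.right_neutral right_diff_distrib)
    moreover have "poly (smult e1 u) u0 \<in> A" "poly (smult e2 h) u0 \<in> A"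
      using poly_in_subring[OF subring] e1 e2 p by blast+
    then have "divides p (e2 * poly (smult e1 u) u0 * poly g u0 - e1 * poly (smult e2 h) u0 * poly m u0)"
      using a p(3) e1(1) e2(1) by (intro divides_diff divides_mult ring)
    ultimately show False using p(4) by metis
  qed
  have \<rho>u: "poly (\<rho> r - \<rho> x) w \<in> A" "poly (\<rho> x) w \<in> A" if "x = r \<or> x \<in> set rs" "w \<in> A" for x w
    using that by (intro poly_in_subring[OF subring] P(6) \<rho>A; simp)+
  have gu0: "poly g u0 = D * (poly (pderiv m) u0 * (\<Prod>x\<leftarrow>rs. poly (\<rho> r - \<rho> x) u0))"
    by (simp add: g_def poly_prod_list_map)
  have inA: "(\<Prod>x\<leftarrow>rs. poly (\<rho> r - \<rho> x) u0) \<in> A" "poly (pderiv m) u0 \<in> A"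
  proof -
    show "poly (pderiv m) u0 \<in> A" using P(10)[OF m(1)] p(1) by (rule poly_in_subring[OF subring])
    show "(\<Prod>x\<leftarrow>rs. poly (\<rho> r - \<rho> x) u0) \<in> A"
      using \<rho>u(1)[OF _ p(1)] by (intro is_subring_prod_list[OF subring]) (auto simp del: poly_diff)
  qed
  have pD: "\<not> divides p D"
    using pg divides_mult[of p D "poly (pderiv m) u0 * (\<Prod>x\<leftarrow>rs. poly (\<rho> r - \<rho> x) u0)"] inA ring
    unfolding gu0 by (auto simp: mult.commute)
  have pm': "\<not> divides p (poly (pderiv m) u0)"
    using pg divides_mult[of p "poly (pderiv m) u0" "D * (\<Prod>x\<leftarrow>rs. poly (\<rho> r - \<rho> x) u0)"] inA D ring
    unfolding gu0 by (auto simp: mult_ac)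
  have p\<rho>: "\<not> divides p (poly (\<rho> r - \<rho> x) u0)" if x: "x \<in> set rs" for x
  proof
    assume "divides p (poly (\<rho> r - \<rho> x) u0)"
    then have "divides p (\<Prod>x\<leftarrow>rs. poly (\<rho> r - \<rho> x) u0)"
      using \<rho>u p(1) x by (intro divides_prod_list[of "poly (\<rho> r - \<rho> x) u0"]) (auto simp del: poly_diff)
    then have "divides p (D * poly (pderiv m) u0 * (\<Prod>x\<leftarrow>rs. poly (\<rho> r - \<rho> x) u0))"
      using D inA by (intro divides_mult ring)
    then show False using pg unfolding gu0 by (simp only: mult.assoc)
  qed
  obtain v where v: "v \<in> A" "divides p (v - u0)"
    and approx: "\<And>k. \<exists>w\<in>A. divides (p ^ k) (poly m w) \<and> divides (p ^ 2) (w - v)"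
    using hensel[OF p(2) m(1) p(1,3) pm'] by blast
  obtain y where y: "y \<in> A" "divides p (D * y - 1)" using p(2) D(1) pD by (auto simp: prime_elt_def)
  obtain t where t: "t \<in> A" "D * y - 1 = p * t" using y(2) by (auto simp: divides_def)
  define b where "b = poly (\<rho> r) v"
  \<comment> \<open>Since \<open>D * y = 1 + p * t\<close>, the factor
    \<open>y * (1 - p * t)\<close> inverts \<open>D\<close> modulo \<open>p ^ 2\<close>. Hence
    \<open>D * s\<close> is congruent to \<open>b + p\<close> modulo \<open>p ^ 2\<close>, and it
    differs from the approximate value \<open>b\<close> of \<open>D * r\<close> by exactly one
    factor \<open>p\<close>.\<close>
  define s where "s = y * (1 - p * t) * (b + p)"
  have bA: "b \<in> A" unfolding b_def using \<rho>u v by blast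
  have sA: "s \<in> A" unfolding s_def by (intro ring y pA t bA)
  have Dy: "D * y = 1 + p * t" using t(2) by (simp add: algebra_simps)
  have "D * s = (D * y) * (1 - p * t) * (b + p)" by (simp add: s_def)
  also have "\<dots> = b + p - p ^ 2 * (t ^ 2 * (b + p))" unfolding Dy by (simp add: power2_eq_square algebra_simps)
  finally have Ds: "D * s = b + p - p ^ 2 * (t ^ 2 * (b + p))" .
  have DsA: "D * s \<in> A" using D sA ring by simp
  define H where "H w = (D * s - poly (\<rho> r) w) * (\<Prod>x\<leftarrow>rs. D * s - poly (\<rho> x) w)" for w
  \<comment> \<open>Agreement of \<open>w\<close> with \<open>v\<close> modulo \<open>p ^ 2\<close>
    keeps the first factor at valuation one, whatever higher precision is asked of \<open>w\<close>;
    the remaining factors are units at \<open>p\<close>.\<close>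
  have HA: "\<exists>N\<in>A. H w = p * N \<and> \<not> divides p N" if w: "w \<in> A" "divides (p ^ 2) (w - v)" for w
  proof -
    obtain z where z: "z \<in> A" "poly (\<rho> r) w - b = p ^ 2 * z"
      using poly_divides_cong[OF _ w(1) v(1) w(2), of "\<rho> r"] \<rho>A unfolding b_def by (auto simp: divides_def)
    define n where "n = 1 - p * (t ^ 2 * (b + p) + z)"
    have nA: "n \<in> A" unfolding n_def power2_eq_square by (intro ring pA t bA z)
    have eq: "D * s - poly (\<rho> r) w = p * n"
    proof -
      have "poly (\<rho> r) w = b + p ^ 2 * z" using z(2) by (simp add: algebra_simps)
      then show ?thesis unfolding Ds n_def by (simp add: power2_eq_square algebra_simps)
    qed
    have pn: "\<not> divides p n"
    proof
      assume "divides p n"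
      moreover have "divides p (p * (t ^ 2 * (b + p) + z))"
        by (rule dividesI[OF _ refl]) (unfold power2_eq_square, intro ring pA t bA z)
      ultimately have "divides p (n + p * (t ^ 2 * (b + p) + z))" by (rule divides_add)
      then show False using prime_elt_one[OF p(2)] by (simp add: n_def)
    qed
    have px: "D * s - poly (\<rho> x) w \<in> A \<and> \<not> divides p (D * s - poly (\<rho> x) w)" if x: "x \<in> set rs" for x
    proof
      have x': "x = r \<or> x \<in> set rs" using x by simp
      show "D * s - poly (\<rho> x) w \<in> A" using DsA \<rho>u(2)[OF x' w(1)] ring by simp
      show "\<not> divides p (D * s - poly (\<rho> x) w)"
      proof
        assume a: "divides p (D * s - poly (\<rho> x) w)"
        have "divides (p ^ 1) (p ^ 2)" by (rule divides_power_le[OF pA(1)]) simp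
        then have "divides p (w - v)" using w(2) divides_trans by auto
        then have wu: "divides p (w - u0)" using divides_add[OF _ v(2), of "w - v"] by simp
        have 1: "divides p (poly (\<rho> x) w - poly (\<rho> x) u0)"
          using poly_divides_cong[OF \<rho>A[OF x'] w(1) p(1) wu] .
        have 2: "divides p (b - poly (\<rho> r) u0)"
          unfolding b_def using poly_divides_cong[OF \<rho>A v(1) p(1) v(2)] by blast
        have "D * s - b = p * (1 - p * (t ^ 2 * (b + p)))" unfolding Ds by (simp add: power2_eq_square algebra_simps)
        then have 3: "divides p (D * s - b)"
          by (rule dividesI[rotated]) (unfold power2_eq_square, intro ring pA t bA)
        \<comment> \<open>Modulo \<open>p\<close> the terms can be replaced by
          \<open>poly (\<rho> r) u0\<close> and \<open>poly (\<rho> x) u0\<close>, whose difference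
          is not divisible by \<open>p\<close>.\<close>
        have "divides p (((D * s - poly (\<rho> x) w) + (poly (\<rho> x) w - poly (\<rho> x) u0))
            - ((D * s - b) + (b - poly (\<rho> r) u0)))"
          by (intro divides_diff divides_add a 1 2 3)
        then show False using p\<rho>[OF x] by simp
      qed
    qed
    have "\<not> divides p (\<Prod>x\<leftarrow>rs. D * s - poly (\<rho> x) w)"
      using px by (intro prime_elt_prod_list[OF p(2)]) auto
    moreover have "(\<Prod>x\<leftarrow>rs. D * s - poly (\<rho> x) w) \<in> A"
      using px by (intro is_subring_prod_list[OF subring]) auto
    ultimately show ?thesis
      using prime_elt_mult[OF p(2) nA _ pn] nA ring unfolding H_def eq
      by (intro bexI[of _ "n * (\<Prod>x\<leftarrow>rs. D * s - poly (\<rho> x) w)"]) (auto simp: mult.assoc)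
  qed
  have "((s - r) * (\<Prod>x\<leftarrow>rs. s - x)) ^ q \<noteq> W ^ 2" if W: "W \<in> adjoin quot_field \<theta>" for W
  proof
    assume sq: "((s - r) * (\<Prod>x\<leftarrow>rs. s - x)) ^ q = W ^ 2"
    obtain a G where aG: "a \<in> A" "a \<noteq> 0" "poly_over A G" "a * W = poly G \<theta>"
      using clear_denominators_adjoin[of "{W}" \<theta>] W by auto
    \<comment> \<open>The power of \<open>D\<close> that turns the \<open>q\<close>-th power of the
      product into that of \<open>H \<theta>\<close>: there are \<open>Suc (length rs)\<close>
      linear factors, each raised to \<open>q\<close>.\<close>
    define d where "d = D ^ (Suc (length rs) * q)"
    have d: "d \<in> A" "\<not> divides p d"
      using D(1) pD prime_elt_power[OF p(2)] is_subring_power[OF subring] by (auto simp: d_def)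
    have H\<theta>: "H \<theta> = D ^ Suc (length rs) * ((s - r) * (\<Prod>x\<leftarrow>rs. s - x))"
    proof -
      have "(\<Prod>x\<leftarrow>xs. D * s - poly (\<rho> x) \<theta>) = D ^ length xs * (\<Prod>x\<leftarrow>xs. s - x)" if "set xs \<subseteq> set rs" for xs
        using that by (induction xs) (auto simp: \<rho>\<theta> algebra_simps)
      then have "(\<Prod>x\<leftarrow>rs. D * s - poly (\<rho> x) \<theta>) = D ^ length rs * (\<Prod>x\<leftarrow>rs. s - x)" by blast
      then show ?thesis by (simp add: H_def \<rho>\<theta> algebra_simps)
    qed
    define Hp where "Hp = ([:D * s:] - \<rho> r) * (\<Prod>x\<leftarrow>rs. [:D * s:] - \<rho> x)"
    have Hp: "poly_over A Hp" "poly Hp w = H w" for w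
    proof -
      show "poly_over A Hp" unfolding Hp_def
        by (intro P poly_over_prod_list[OF subring]) (auto intro!: P DsA \<rho>A)
      show "poly Hp w = H w" by (simp add: Hp_def H_def poly_prod_list_map)
    qed
    \<comment> \<open>The assumed square equation, cleared of denominators, says that
      \<open>Z\<close> vanishes at \<open>\<theta>\<close>. So \<open>Z\<close> is a multiple of
      \<open>m\<close> and becomes highly divisible by \<open>p\<close> at an approximate
      root.\<close>
    define Z where "Z = smult (a ^ 2) (Hp ^ q) - smult d (G ^ 2)"
    have ZA: "poly_over A Z" unfolding Z_def
      by (intro P poly_over_power[OF subring] is_subring_power[OF subring] Hp aG d)
    have "poly Z \<theta> = a ^ 2 * (H \<theta>) ^ q - d * (a * W) ^ 2" by (simp add: Z_def Hp aG(4))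
    also have "\<dots> = 0" unfolding H\<theta> power_mult_distrib sq[symmetric] d_def power_mult by simp
    finally have "poly Z \<theta> = 0" .
    then obtain h' where h': "poly_over quot_field h'" "Z = m * h'" using mdvd[OF toQ[OF ZA]] by blast
    obtain e where e: "e \<in> A" "e \<noteq> 0" "poly_over A (smult e h')" using clear_denominators[OF h'(1)] by blast
    obtain \<alpha> a1 where a1: "a1 \<in> A" "a = p ^ \<alpha> * a1" "\<not> divides p a1"
      using prime_elt_exponent[OF p(2) aG(1,2)] by blast
    obtain \<epsilon> e1 where e1: "e1 \<in> A" "e = p ^ \<epsilon> * e1" "\<not> divides p e1"
      using prime_elt_exponent[OF p(2) e(1,2)] by blast
    \<comment> \<open>The exponent of \<open>p\<close> in \<open>a ^ 2 * H w ^ q\<close>. The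
      precision \<open>\<epsilon> + Suc l\<close> pays for the denominator \<open>e\<close> of the
      cofactor and still leaves one power of \<open>p\<close> more than \<open>l\<close>.\<close>
    define l where "l = 2 * \<alpha> + q"
    obtain w where w: "w \<in> A" "divides (p ^ (\<epsilon> + Suc l)) (poly m w)" "divides (p ^ 2) (w - v)"
      using approx by blast
    obtain N where N: "N \<in> A" "H w = p * N" "\<not> divides p N" using HA[OF w(1,3)] by blast
    obtain z0 where z0: "z0 \<in> A" "poly m w = p ^ (\<epsilon> + Suc l) * z0" using w(2) by (auto simp: divides_def)
    define z where "z = z0 * poly (smult e h') w"
    have zA: "z \<in> A" unfolding z_def using z0 e w poly_in_subring[OF subring] ring by blast
    have "p ^ \<epsilon> * (e1 * poly Z w) = e * poly Z w" by (simp add: e1)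
    also have "\<dots> = p ^ (\<epsilon> + Suc l) * z" by (simp add: h' z_def z0)
    also have "\<dots> = p ^ \<epsilon> * (p ^ Suc l * z)" by (simp add: power_add)
    finally have 1: "e1 * poly Z w = p ^ Suc l * z" using pA by simp
    define g1 where "g1 = poly G w"
    have g1A: "g1 \<in> A" unfolding g1_def using aG w poly_in_subring[OF subring] by blast
    have "poly Z w = a ^ 2 * (p * N) ^ q - d * g1 ^ 2" by (simp add: Z_def Hp N g1_def)
    also have "a ^ 2 * (p * N) ^ q = p ^ l * (a1 ^ 2 * N ^ q)"
      by (simp add: a1 l_def power_mult_distrib power_add power_mult power2_eq_square algebra_simps)
    finally have "poly Z w = p ^ l * (a1 ^ 2 * N ^ q) - d * g1 ^ 2" .
    then have "e1 * (p ^ l * (a1 ^ 2 * N ^ q)) - e1 * (d * g1 ^ 2) = p ^ Suc l * z"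
      using 1 by (metis right_diff_distrib)
    then have 2: "e1 * d * g1 ^ 2 = p ^ l * (e1 * (a1 ^ 2 * N ^ q) - p * z)" by (simp add: algebra_simps)
    define n where "n = e1 * (a1 ^ 2 * N ^ q) - p * z"
    have pw: "a1 ^ 2 \<in> A" "N ^ q \<in> A" using a1 N is_subring_power[OF subring] by blast+
    have nA: "n \<in> A" unfolding n_def by (intro ring e1 pw pA zA)
    have pn: "\<not> divides p n"
    proof
      assume "divides p n"
      then have "divides p (n + p * z)" using dividesI[OF zA refl] by (rule divides_add)
      then have "divides p (e1 * (a1 ^ 2 * N ^ q))" by (simp add: n_def)
      moreover have "\<not> divides p (e1 * (a1 ^ 2 * N ^ q))"
        using pw e1 a1 N ring by (intro prime_elt_mult prime_elt_power p) auto
      ultimately show False by blast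
    qed
    then have "n \<noteq> 0" using ring(1) by (auto simp: divides_def)
    then have "g1 \<noteq> 0" using 2 pA by (auto simp: n_def)
    then obtain \<gamma> g2 where g2: "g2 \<in> A" "g1 = p ^ \<gamma> * g2" "\<not> divides p g2"
      using prime_elt_exponent[OF p(2) g1A] by blast
    have g22: "g2 ^ 2 \<in> A" "\<not> divides p (g2 ^ 2)"
      using g2 is_subring_power[OF subring] prime_elt_power[OF p(2)] by blast+
    have ed: "e1 * d \<in> A" "\<not> divides p (e1 * d)"
      using ring(4)[OF e1(1) d(1)] prime_elt_mult[OF p(2) e1(1) d(1) e1(3) d(2)] by auto
    have edg: "e1 * d * g2 ^ 2 \<in> A" "\<not> divides p (e1 * d * g2 ^ 2)"
      using ring(4)[OF ed(1) g22(1)] prime_elt_mult[OF p(2) ed(1) g22(1) ed(2) g22(2)] by auto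
    \<comment> \<open>The square side has the even exponent \<open>2 * \<gamma>\<close>, the other
      side has \<open>l = 2 * \<alpha> + q\<close>, which is odd.\<close>
    have "p ^ (2 * \<gamma>) * (e1 * d * g2 ^ 2) = p ^ l * n"
      unfolding 2[unfolded g2(2), folded n_def, symmetric]
      by (simp add: power_mult_distrib power_mult mult_ac flip: power_mult)
    then have "2 * \<gamma> = l"
      using exponent_le[OF pA edg(1) nA edg(2), of "2 * \<gamma>" l] exponent_le[OF pA nA edg(1) pn, of l "2 * \<gamma>"]
      by (metis le_antisym)
    then show False using q unfolding l_def by presburger
  qed
  then show ?thesis using sA by blast
qed

end

subsection \<open>The integers and polynomial rings as Euclidean subrings\<close>

lemma is_subring_range_of_int: "is_subring (range of_int :: 'a::field set)"
  unfolding is_subring_def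
  by (auto simp flip: of_int_add of_int_mult of_int_minus) (metis of_int_0 of_int_1 rangeI)+

text \<open>For the last locale assumption: if every value were zero or a divisor of
  \<open>c\<close>, then only finitely many values would occur, each at finitely many points, while
  the progression \<open>u + e * n\<close> is infinite.\<close>

lemma euclidean_subring_int:
  assumes char: "CHAR('a::field) = 0"
  shows "euclidean_subring (range of_int :: 'a set) (\<lambda>x. nat \<bar>inv of_int x\<bar>)"
proof
  have z: "of_int n = (0 :: 'a) \<longleftrightarrow> n = 0" for n
    by (simp add: of_int_eq_0_iff_char_dvd char)
  have inj: "inj (of_int :: int \<Rightarrow> 'a)"
  proof (rule injI)
    fix m n assume "of_int m = (of_int n :: 'a)"
    then have "of_int (m - n) = (0 :: 'a)" by simp
    then have "m - n = 0" using z by blast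
    then show "m = n" by simp
  qed
  note inv = inv_f_f[OF inj]
  note ring = is_subringD[OF is_subring_range_of_int]
  show "is_subring (range of_int :: 'a set)" by (rule is_subring_range_of_int)
  show "\<exists>q\<in>range of_int. \<exists>r\<in>range of_int. a = q * b + r \<and> (r = 0 \<or> nat \<bar>inv of_int r\<bar> < nat \<bar>inv of_int b\<bar>)"
    if ab: "a \<in> range of_int" "b \<in> range of_int" "b \<noteq> (0 :: 'a)" for a b
  proof -
    obtain m n where mn: "a = of_int m" "b = of_int n" using ab by blast
    then have n: "n \<noteq> 0" using ab by auto
    have "a = of_int (m div n) * b + of_int (m mod n)"
      unfolding mn by (simp flip: of_int_add of_int_mult)
    moreover have "nat \<bar>inv of_int (of_int (m mod n) :: 'a)\<bar> < nat \<bar>inv of_int b\<bar>"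
      using abs_mod_less[OF n, of m] by (simp add: mn inv)
    ultimately show ?thesis by blast
  qed
  show "nat \<bar>inv of_int a\<bar> < nat \<bar>inv of_int (a * b)\<bar>"
    if ab: "a \<in> range of_int" "b \<in> range of_int" "a \<noteq> 0" "b \<noteq> 0" "inverse b \<notin> range of_int" for a b :: 'a
  proof -
    obtain m n where mn: "a = of_int m" "b = of_int n" using ab by blast
    have m0: "m \<noteq> 0" "n \<noteq> 0" using ab mn by auto
    have "n \<noteq> 1" "n \<noteq> -1" using ab(5) mn ring(2) ring(5)[OF ring(2)] by auto
    then have n: "\<bar>n\<bar> > 1" using m0 by auto
    have "\<bar>m\<bar> * 1 < \<bar>m\<bar> * \<bar>n\<bar>" using m0 n by (intro mult_strict_left_mono) auto
    moreover have "inv of_int (a * b) = m * n" unfolding mn of_int_mult[symmetric] by (rule inv)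
    ultimately show ?thesis by (simp add: mn inv abs_mult)
  qed
  show "\<exists>x\<in>range of_int. poly m (u + e * x) \<noteq> 0 \<and> c / poly m (u + e * x) \<notin> range of_int"
    if m: "poly_over (range of_int) m" "0 < degree m" and u: "u \<in> range of_int" "c \<in> range of_int" "e \<in> range of_int"
      "c \<noteq> 0" "e \<noteq> 0" for m :: "'a poly" and u c e
  proof (rule ccontr)
    assume neg: "\<not> ?thesis"
    obtain c' where c': "c = of_int c'" using u by blast
    define V where "V = (of_int :: int \<Rightarrow> 'a) ` {-\<bar>c'\<bar>..\<bar>c'\<bar>}"
    have V: "poly m (u + e * x) \<in> V" if x: "x \<in> range of_int" for x
    proof (cases "poly m (u + e * x) = 0")
      case True
      have "of_int 0 \<in> V" unfolding V_def by (rule imageI) auto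
      then show ?thesis using True by simp
    next
      case False
      then have "c / poly m (u + e * x) \<in> range of_int" using neg x by blast
      then obtain k where k: "c / poly m (u + e * x) = of_int k" by blast
      have "u + e * x \<in> range of_int" by (intro ring u x)
      then obtain v where v: "poly m (u + e * x) = of_int v"
        using poly_in_subring[OF is_subring_range_of_int m(1)] by blast
      have "of_int c' = (of_int (k * v) :: 'a)" using k False by (simp add: c' v field_simps)
      then have "c' = k * v" by (rule injD[OF inj])
      moreover have "c' \<noteq> 0" using u c' by auto
      ultimately have "\<bar>v\<bar> \<le> \<bar>c'\<bar>" by (intro dvd_imp_le_int) auto
      then show ?thesis unfolding V_def v by (intro imageI) auto
    qed
    have "finite {y. poly (m - [:v:]) y = 0}" for v
      using m(2) by (intro poly_roots_finite) (metis degree_pCons_0 eq_iff_diff_eq_0 less_irrefl)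
    then have "finite (\<Union>v\<in>V. {y. poly (m - [:v:]) y = 0})" unfolding V_def by blast
    moreover have "range (\<lambda>n. u + e * of_int n) \<subseteq> (\<Union>v\<in>V. {y. poly (m - [:v:]) y = 0})"
      using V by auto
    ultimately have "finite (range (\<lambda>n. u + e * of_int n))" by (rule rev_finite_subset)
    moreover have "inj (\<lambda>n. u + e * of_int n)" using u(5) inj by (auto simp: inj_def)
    ultimately have "finite (UNIV :: int set)" by (rule finite_imageD)
    then show False by simp
  qed
qed

text \<open>Transcendence of \<open>t\<close> makes the representing polynomial unique, so its
  degree is a size. Counting divisors of \<open>c\<close> fails when \<open>k\<close> is infinite,
  and \<open>k\<close> may also be finite, so the last locale assumption is checked at the powers of
  \<open>t\<close>. If all values there were zero or divided \<open>c\<close>, their degrees would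
  be at most that of \<open>c'\<close>. The difference of the values at \<open>t ^ i\<close> and
  \<open>t ^ j\<close> is a multiple of \<open>e * (t ^ j - t ^ i)\<close>, whose degree is at least
  \<open>j\<close>; for large \<open>j\<close> it must vanish, and \<open>m\<close> would take one
  value infinitely often.\<close>

lemma euclidean_subring_poly:
  assumes k: "is_subfield k" and t: "\<not> algebraic_over k t"
  shows "euclidean_subring (adjoin k t) (\<lambda>x. degree (THE g. poly_over k g \<and> poly g t = x))"
proof
  note kr = is_subfield_is_subring[OF k]
  note P = poly_over_closed[OF kr]
  have uniq: "f = g" if "poly_over k f" "poly_over k g" "poly f t = poly g t" for f g
  proof -
    have "poly_over k (f - g)" "poly (f - g) t = 0" using that P by auto
    then show ?thesis using t unfolding algebraic_over_def by (metis eq_iff_diff_eq_0)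
  qed
  have rep: "(THE g. poly_over k g \<and> poly g t = poly f t) = f" if "poly_over k f" for f
    using uniq that by blast
  note ring = is_subringD[OF is_subring_adjoin[OF kr, of t]]
  have I: "poly g t \<in> adjoin k t" if "poly_over k g" for g using that by (auto simp: adjoin_def)
  show "is_subring (adjoin k t)" by (rule is_subring_adjoin[OF kr])
  show "\<exists>q\<in>adjoin k t. \<exists>r\<in>adjoin k t. a = q * b + r \<and> (r = 0 \<or>
      degree (THE g. poly_over k g \<and> poly g t = r) < degree (THE g. poly_over k g \<and> poly g t = b))"
    if ab: "a \<in> adjoin k t" "b \<in> adjoin k t" "b \<noteq> 0" for a b
  proof -
    obtain f g where fg: "poly_over k f" "poly_over k g" "a = poly f t" "b = poly g t"
      using ab unfolding adjoin_def by blast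
    then have g0: "g \<noteq> 0" using ab by auto
    obtain q r where qr: "poly_over k q" "poly_over k r" "f = g * q + r" "r = 0 \<or> degree r < degree g"
      using poly_over_divmod[OF k fg(2) g0 fg(1)] by blast
    have "a = poly q t * b + poly r t" by (simp add: fg qr)
    moreover have "poly r t = 0 \<or>
        degree (THE g. poly_over k g \<and> poly g t = poly r t) < degree (THE g. poly_over k g \<and> poly g t = b)"
      using qr(4) rep[OF qr(2)] rep[OF fg(2)] by (auto simp: fg(4))
    ultimately show ?thesis using I qr by blast
  qed
  show "degree (THE g. poly_over k g \<and> poly g t = a) < degree (THE g. poly_over k g \<and> poly g t = a * b)"
    if ab: "a \<in> adjoin k t" "b \<in> adjoin k t" "a \<noteq> 0" "b \<noteq> 0" "inverse b \<notin> adjoin k t" for a b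
  proof -
    obtain f g where fg: "poly_over k f" "poly_over k g" "a = poly f t" "b = poly g t"
      using ab unfolding adjoin_def by blast
    then have fg0: "f \<noteq> 0" "g \<noteq> 0" using ab by auto
    have "degree g > 0"
    proof (rule ccontr)
      assume "\<not> degree g > 0"
      then obtain c where c: "g = [:c:]" by (metis degree_0_id gr0I)
      then have "c \<in> k" using fg by simp
      then have "inverse b \<in> k" using c fg is_subfield_inverse[OF k] by simp
      then show False using ab(5) adjoin_superset[OF kr] by blast
    qed
    then have "degree f < degree (f * g)" using fg0 by (simp add: degree_mult_eq)
    moreover have "a * b = poly (f * g) t" by (simp add: fg)
    ultimately show ?thesis using rep[OF fg(1)] rep[OF P(7)[OF fg(1,2)]] by (simp only: fg(3))
  qed
  show "\<exists>x\<in>adjoin k t. poly m (u + e * x) \<noteq> 0 \<and> c / poly m (u + e * x) \<notin> adjoin k t"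
    if m: "poly_over (adjoin k t) m" "0 < degree m" and u: "u \<in> adjoin k t" "c \<in> adjoin k t" "e \<in> adjoin k t"
      "c \<noteq> 0" "e \<noteq> 0" for m u c e
  proof (rule ccontr)
    assume neg: "\<not> ?thesis"
    note Ar = is_subring_adjoin[OF kr, of t]
    obtain c' e' where ce: "poly_over k c'" "c = poly c' t" "poly_over k e'" "e = poly e' t"
      using u unfolding adjoin_def by blast
    have ce0: "c' \<noteq> 0" "e' \<noteq> 0" using u ce by auto
    have tA: "t ^ i \<in> adjoin k t" for i using is_subring_power[OF Ar adjoin_generator[OF kr]] .
    have arg: "u + e * t ^ i \<in> adjoin k t" for i using u tA[of i] ring by simp
    have val: "\<exists>v. poly_over k v \<and> poly m (u + e * t ^ i) = poly v t \<and> degree v \<le> degree c'" for i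
    proof (cases "poly m (u + e * t ^ i) = 0")
      case True
      then show ?thesis using P(1) by (intro exI[of _ 0]) auto
    next
      case False
      then have "c / poly m (u + e * t ^ i) \<in> adjoin k t" using neg tA by blast
      then obtain l where l: "poly_over k l" "c / poly m (u + e * t ^ i) = poly l t" unfolding adjoin_def by blast
      have "poly m (u + e * t ^ i) \<in> adjoin k t" using poly_in_subring[OF Ar m(1) arg] .
      then obtain v where v: "poly_over k v" "poly m (u + e * t ^ i) = poly v t" unfolding adjoin_def by blast
      have "poly c' t = poly (v * l) t" using l(2) False ce(2) v(2) by (simp add: field_simps)
      then have "c' = v * l" using uniq ce v l P(7) by blast
      then have "degree v \<le> degree c'" using ce0 by (simp add: degree_mult_eq)
      then show ?thesis using v by blast
    qed
    have eq: "poly m (u + e * t ^ i) = poly m (u + e * t ^ j)" if ij: "i < j" "degree c' < j" for i j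
    proof -
      obtain v w where v: "poly_over k v" "poly m (u + e * t ^ i) = poly v t" "degree v \<le> degree c'"
        and w: "poly_over k w" "poly m (u + e * t ^ j) = poly w t" "degree w \<le> degree c'"
        using val by metis
      obtain z where "z \<in> adjoin k t"
        "poly m (u + e * t ^ j) - poly m (u + e * t ^ i) = (u + e * t ^ j - (u + e * t ^ i)) * z"
        using poly_cong[OF Ar m(1) arg arg] by blast
      then obtain z' where z: "poly_over k z'" "poly w t - poly v t = e * (t ^ j - t ^ i) * poly z' t"
        unfolding adjoin_def v w by (auto simp: algebra_simps)
      let ?d = "monom 1 j - monom 1 i :: 'a poly"
      have deg: "degree ?d = j"
      proof (rule antisym)
        show "degree ?d \<le> j" using ij by (intro degree_diff_le) (auto simp: degree_monom_eq)
        show "j \<le> degree ?d" using ij by (intro le_degree) simp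
      qed
      have "poly (w - v) t = poly (e' * ?d * z') t" using z by (simp add: ce poly_monom)
      moreover have "poly_over k (e' * ?d * z')" using ce z is_subringD(2)[OF kr] by (intro P)
      ultimately have wv: "w - v = e' * ?d * z'" using uniq P(6)[OF w(1) v(1)] by blast
      have "z' = 0"
      proof (rule ccontr)
        assume "z' \<noteq> 0"
        moreover have "?d \<noteq> 0" using deg ij by auto
        ultimately have "degree (w - v) \<ge> j" unfolding wv using ce0 deg by (simp add: degree_mult_eq)
        moreover have "degree (w - v) \<le> degree c'" using v w by (intro degree_diff_le)
        ultimately show False using ij by simp
      qed
      then show ?thesis using v w wv by simp
    qed
    define j where "j = Suc (degree c')"
    let ?M = "m - [:poly m (u + e * t ^ j):]"
    have "?M \<noteq> 0" using m(2) by (metis degree_pCons_0 eq_iff_diff_eq_0 less_irrefl)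
    then have "finite {y. poly ?M y = 0}" by (rule poly_roots_finite)
    moreover have "poly ?M (u + e * t ^ i) = 0" if "j < i" for i
      using eq[OF that] that by (simp add: j_def)
    then have "(\<lambda>i. u + e * t ^ i) ` {j<..} \<subseteq> {y. poly ?M y = 0}" by auto
    ultimately have "finite ((\<lambda>i. u + e * t ^ i) ` {j<..})" by (rule rev_finite_subset)
    moreover have "inj_on (\<lambda>i. u + e * t ^ i) {j<..}"
    proof (rule inj_onI)
      fix i i' assume "u + e * t ^ i = u + e * t ^ i'"
      then have "poly (monom 1 i) t = poly (monom 1 i') t" using u(5) by (simp add: poly_monom)
      then have "monom (1::'a) i = monom 1 i'" using uniq P(4)[OF is_subringD(2)[OF kr]] by blast
      then show "i = i'" by (metis degree_monom_eq zero_neq_one)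
    qed
    ultimately have "finite {j<..}" by (rule finite_imageD)
    then show False using infinite_Ioi by blast
  qed
qed

text \<open>Positive degree provides a nonempty independent set. A relation for one member
  \<open>s\<close> is a relation among the monomials that involve \<open>s\<close> alone, so
  \<open>s\<close> is transcendental.\<close>

lemma transcendental_element_exists:
  assumes k: "is_subfield k" and deg: "transcendence_degree k F \<ge> 1"
  shows "\<exists>x\<in>F. \<not> algebraic_over k x"
proof -
  have "\<exists>S. finite S \<and> S \<subseteq> F \<and> algebraically_independent k S \<and> S \<noteq> {}"
  proof (rule ccontr)
    assume "\<not> ?thesis"
    then have "x \<le> 0" if "x \<in> {enat (card S) | S. finite S \<and> S \<subseteq> F \<and> algebraically_independent k S}" for x
      using that by (auto simp: zero_enat_def)
    then have "transcendence_degree k F \<le> 0" unfolding transcendence_degree_def by (rule Sup_least)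
    then show False using deg by simp
  qed
  then obtain S s where S: "finite S" "S \<subseteq> F" "algebraically_independent k S" "s \<in> S" by blast
  have "\<not> algebraic_over k s"
  proof
    assume "algebraic_over k s"
    then obtain p where p: "p \<noteq> 0" "poly_over k p" "poly p s = 0" by (auto simp: algebraic_over_def)
    \<comment> \<open>The exponent vector of the monomial \<open>s ^ i\<close>; the restriction to
      \<open>S\<close> places it in the extensional function space.\<close>
    define \<mu> where "\<mu> i = (\<lambda>x\<in>S. if x = s then i else 0)" for i :: nat
    have \<mu>s: "\<mu> i s = i" for i using S by (simp add: \<mu>_def)
    have inj: "inj_on \<mu> {..degree p}" by (rule inj_onI) (metis \<mu>s)
    have mon: "(\<Prod>x\<in>S. x ^ \<mu> i x) = s ^ i" for i
    proof -
      have "(\<Prod>x\<in>S. x ^ \<mu> i x) = s ^ \<mu> i s * (\<Prod>x\<in>S - {s}. x ^ \<mu> i x)"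
        using S by (intro prod.remove) auto
      also have "(\<Prod>x\<in>S - {s}. x ^ \<mu> i x) = 1" by (intro prod.neutral) (auto simp: \<mu>_def)
      finally show ?thesis by (simp add: \<mu>s)
    qed
    let ?M = "\<mu> ` {..degree p}" and ?c = "\<lambda>e. coeff p (e s)"
    have "(\<Sum>e\<in>?M. ?c e * (\<Prod>x\<in>S. x ^ e x)) = (\<Sum>i\<le>degree p. coeff p i * s ^ i)"
      by (simp add: sum.reindex[OF inj] mon \<mu>s)
    also have "\<dots> = 0" using p(3) by (simp add: poly_altdef)
    finally have "(\<Sum>e\<in>?M. ?c e * (\<Prod>x\<in>S. x ^ e x)) = 0" .
    moreover have "?M \<subseteq> S \<rightarrow>\<^sub>E UNIV" by (auto simp: \<mu>_def)
    moreover have "?c ` ?M \<subseteq> k" using p(2) by (auto simp: poly_over_def)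
    ultimately have "\<forall>e\<in>?M. ?c e = 0" using S(3) unfolding algebraically_independent_def by blast
    then have "coeff p (degree p) = 0" using \<mu>s by force
    then show False using p(1) by simp
  qed
  then show ?thesis using S by blast
qed

lemma number_field_over_euclidean_subring:
  fixes F :: "'a::field set"
  assumes "number_field F"
  shows "\<exists>A \<delta> S. euclidean_subring A \<delta> \<and> is_subfield F \<and> euclidean_subring.quot_field A \<subseteq> F \<and> finite S \<and>
    (\<forall>x\<in>S. algebraic_over (euclidean_subring.quot_field A) x) \<and>
    F = generated_subfield (euclidean_subring.quot_field A \<union> S)"
proof -
  from assms have char: "CHAR('a) = 0" and fin: "finite_extension rational_subfield F" by (auto simp: number_field_def)
  interpret euclidean_subring "range of_int :: 'a set" "\<lambda>x. nat \<bar>inv of_int x\<bar>"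
    by (rule euclidean_subring_int[OF char])
  have "of_int b = (0 :: 'a) \<longleftrightarrow> b = 0" for b by (simp add: of_int_eq_0_iff_char_dvd char)
  then have Q: "quot_field = rational_subfield"
    unfolding quot_field_def rational_subfield_def by (auto; metis)
  from fin have F: "is_subfield F" "rational_subfield \<subseteq> F" by (auto simp: finite_extension_def field_extension_def)
  obtain B where B: "B \<subseteq> F" "finite B" "\<forall>x\<in>F. \<exists>c. c ` B \<subseteq> quot_field \<and> x = (\<Sum>b\<in>B. c b * b)"
    using fin unfolding finite_extension_def Q by blast
  have "F \<subseteq> generated_subfield (quot_field \<union> B)"
  proof
    fix x assume "x \<in> F"
    then obtain c where c: "c ` B \<subseteq> quot_field" "x = (\<Sum>b\<in>B. c b * b)" using B by blast
    note G = is_subfield_is_subring[OF is_subfield_generated_subfield[of "quot_field \<union> B"]]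
    have "c b * b \<in> generated_subfield (quot_field \<union> B)" if "b \<in> B" for b
      using generated_subfield_superset[of "quot_field \<union> B"] that c(1) by (intro is_subringD(4)[OF G]) auto
    then show "x \<in> generated_subfield (quot_field \<union> B)" unfolding c(2) by (rule is_subring_sum[OF G])
  qed
  moreover have "generated_subfield (quot_field \<union> B) \<subseteq> F"
    using F B Q by (intro generated_subfield_minimal) auto
  moreover have "\<forall>x\<in>B. algebraic_over quot_field x"
    using B finite_extension_algebraic[OF fin] Q by auto
  ultimately show ?thesis
    using euclidean_subring_axioms F B Q
    by (intro exI[of _ "range of_int"] exI[of _ "\<lambda>x. nat \<bar>inv of_int x\<bar>"] exI[of _ B]) auto
qed

text \<open>The constants must be enlarged until one transcendental generator remains. Let
  \<open>T\<close> be a largest set of generators over which \<open>F\<close> is not algebraic, and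
  \<open>t\<close> a further generator. Then \<open>F\<close> is algebraic over
  \<open>K (insert t T)\<close>, and \<open>t\<close> is transcendental over \<open>K T\<close>,
  since otherwise \<open>F\<close> would be algebraic over \<open>K T\<close>. The Euclidean ring is
  the polynomial ring in \<open>t\<close> over \<open>K T\<close>.\<close>

lemma function_field_over_euclidean_subring:
  fixes F :: "'a::field set"
  assumes fg: "finitely_generated_extension k F" and deg: "transcendence_degree k F \<ge> 1"
  shows "\<exists>A \<delta> S. euclidean_subring A \<delta> \<and> is_subfield F \<and> euclidean_subring.quot_field A \<subseteq> F \<and> finite S \<and>
    (\<forall>x\<in>S. algebraic_over (euclidean_subring.quot_field A) x) \<and>
    F = generated_subfield (euclidean_subring.quot_field A \<union> S)"
proof -
  from fg have k: "is_subfield k" and F: "is_subfield F" "k \<subseteq> F"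
    by (simp_all add: finitely_generated_extension_def field_extension_def)
  from fg obtain S where S: "finite S" "F = generated_subfield (k \<union> S)"
    by (auto simp: finitely_generated_extension_def)
  have "k \<union> S \<subseteq> F" unfolding S(2) by (rule generated_subfield_superset)
  then have SF: "S \<subseteq> F" by simp
  define K where "K T = generated_subfield (k \<union> T)" for T
  have K: "is_subfield (K T)" "k \<union> T \<subseteq> K T" for T
    unfolding K_def by (rule is_subfield_generated_subfield generated_subfield_superset)+
  let ?P = "\<lambda>T. T \<subseteq> S \<and> (\<exists>x\<in>F. \<not> algebraic_over (K T) x)"
  have "K {} = k" unfolding K_def
    using generated_subfield_minimal[OF k, of k] generated_subfield_superset[of k] by auto
  then have "?P {}" using transcendental_element_exists[OF k deg] by auto
  moreover have "card T < Suc (card S)" if "?P T" for T using that S card_mono[of S T] by auto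
  ultimately obtain T where T: "?P T" and max: "\<And>T'. ?P T' \<Longrightarrow> card T' \<le> card T"
    using ex_has_greatest_nat[of ?P "{}" card "Suc (card S)"] by auto
  have "T \<noteq> S" using T algebraic_over_self[OF F(1)] S(2) by (auto simp: K_def)
  then obtain t where t: "t \<in> S" "t \<notin> T" using T by blast
  have "finite T" using T S finite_subset by blast
  then have "\<not> ?P (insert t T)" using max[of "insert t T"] t by auto
  then have alg1: "\<And>x. x \<in> F \<Longrightarrow> algebraic_over (K (insert t T)) x" using t T by blast
  note Tr = is_subfield_is_subring[OF K(1)[of T]]
  have ttr: "\<not> algebraic_over (K T) t"
  proof
    assume a: "algebraic_over (K T) t"
    have "K (insert t T) \<subseteq> adjoin (K T) t"
      unfolding K_def[of "insert t T"]
      using is_subfield_adjoin[OF K(1) a] adjoin_superset[OF Tr, of t] adjoin_generator[OF Tr, of t] K(2)[of T]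
      by (intro generated_subfield_minimal) auto
    then have "algebraic_over (K T) y" if "y \<in> K (insert t T)" for y
      using that finite_extension_algebraic[OF finite_extension_adjoin[OF finite_extension_refl[OF K(1)] a]] by blast
    then have "algebraic_over (K T) x" if "x \<in> F" for x
      using algebraic_over_trans[OF K(1) K(1) _ alg1[OF that]] by blast
    then show False using T by blast
  qed
  define \<delta> where "\<delta> = (\<lambda>x. degree (THE g. poly_over (K T) g \<and> poly g t = x))"
  interpret euclidean_subring "adjoin (K T) t" \<delta>
    unfolding \<delta>_def by (rule euclidean_subring_poly[OF K(1) ttr])
  have Q: "K (insert t T) \<subseteq> quot_field"
    unfolding K_def[of "insert t T"]
    using is_subfield_quot_field quot_field_superset adjoin_superset[OF Tr, of t] adjoin_generator[OF Tr, of t] K(2)[of T]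
    by (intro generated_subfield_minimal) auto
  have "K T \<subseteq> F" unfolding K_def using F SF T by (intro generated_subfield_minimal) auto
  then have "adjoin (K T) t \<subseteq> F" using t SF by (intro adjoin_minimal is_subfield_is_subring F) auto
  then have QF: "quot_field \<subseteq> F" using is_subfield_divide[OF F(1)] by (auto simp: quot_field_def)
  have "F \<subseteq> generated_subfield (quot_field \<union> S)"
    unfolding S(2) using K(2)[of "insert t T"] Q by (intro generated_subfield_mono) auto
  moreover have "generated_subfield (quot_field \<union> S) \<subseteq> F"
    using QF SF F(1) by (intro generated_subfield_minimal) auto
  moreover have "\<forall>x\<in>S. algebraic_over quot_field x"
    using alg1 SF Q algebraic_over_mono by blast
  ultimately show ?thesis using euclidean_subring_axioms F QF S(1) by blast
qed

subsection \<open>Primitive elements up to inseparability\<close>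

text \<open>The value \<open>1\<close> makes the power maps below the identity in characteristic
  zero, so that one argument covers all characteristics.\<close>

definition char_exponent :: "'a::field itself \<Rightarrow> nat" where
  "char_exponent _ = (if CHAR('a) = 0 then 1 else CHAR('a))"

lemma char_exponent_power_add:
  fixes x y :: "'a::field"
  shows "(x + y) ^ (char_exponent TYPE('a) ^ n) = x ^ (char_exponent TYPE('a) ^ n) + y ^ (char_exponent TYPE('a) ^ n)"
proof (cases "CHAR('a) = 0")
  case False
  then have "prime CHAR('a)" by (intro prime_CHAR_semidom) simp
  then show ?thesis using False freshmans_dream'[where 'a = 'a] by (simp add: char_exponent_def)
qed (simp add: char_exponent_def)

lemma char_exponent_power_inj:
  fixes x y :: "'a::field"
  assumes "x ^ (char_exponent TYPE('a) ^ n) = y ^ (char_exponent TYPE('a) ^ n)"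
  shows "x = y"
proof -
  have "((x - y) + y) ^ (char_exponent TYPE('a) ^ n) = (x - y) ^ (char_exponent TYPE('a) ^ n) + y ^ (char_exponent TYPE('a) ^ n)"
    by (rule char_exponent_power_add)
  then show ?thesis using assms by simp
qed

text \<open>Oddness ensures that an odd valuation stays odd when such a power is taken.\<close>

lemma char_exponent_odd:
  assumes "CHAR('a::field) \<noteq> 2"
  shows "odd (char_exponent TYPE('a) ^ n)"
proof (cases "CHAR('a) = 0")
  case False
  then have "prime CHAR('a)" by (intro prime_CHAR_semidom) simp
  then have "odd CHAR('a)" using assms by (metis primes_dvd_imp_eq two_is_prime_nat)
  then show ?thesis using False by (simp add: char_exponent_def)
qed (simp add: char_exponent_def)

lemma char_exponent_pos: "char_exponent TYPE('a::field) > 0"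
  by (simp add: char_exponent_def)

text \<open>Because this preimage is a subfield, that all powers of elements of a generated field
  lie in \<open>K\<close> needs to be checked on generators only.\<close>

lemma is_subfield_vimage_char_exponent_power:
  fixes K :: "'a::field set"
  assumes K: "is_subfield K"
  shows "is_subfield {y. y ^ (char_exponent TYPE('a) ^ n) \<in> K}"
proof -
  let ?q = "char_exponent TYPE('a) ^ n"
  note D = is_subfieldD[OF K]
  have q: "?q > 0" using char_exponent_pos[where 'a = 'a] by simp
  have minus: "(- x) ^ ?q = - (x ^ ?q)" for x :: 'a
  proof -
    have "(- x + x) ^ ?q = (- x) ^ ?q + x ^ ?q" by (rule char_exponent_power_add)
    moreover have "(- x + x) ^ ?q = 0" using q by (simp add: power_0_left)
    ultimately show ?thesis by (simp add: eq_neg_iff_add_eq_0)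
  qed
  show ?thesis unfolding is_subfield_def
    using D is_subfield_inverse[OF K] q
    by (auto simp: char_exponent_power_add power_mult_distrib power_inverse minus power_0_left)
qed

text \<open>Equivalent to separability of the minimal polynomial, because a simple root of a
  multiple is a simple root of the divisor vanishing there. This form passes to larger ground fields
  at once.\<close>

definition separable_over :: "'a::field set \<Rightarrow> 'a \<Rightarrow> bool" where
  "separable_over k x \<longleftrightarrow> (\<exists>f. poly_over k f \<and> poly f x = 0 \<and> poly (pderiv f) x \<noteq> 0)"

lemma separable_over_algebraic: "separable_over k x \<Longrightarrow> algebraic_over k x"
  unfolding separable_over_def algebraic_over_def by (metis pderiv_0 poly_0)

text \<open>A vanishing derivative forces the characteristic to divide every exponent that occurs,
  so \<open>m\<close> is a polynomial in a power of the variable. In characteristic zero the degree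
  would have to be zero.\<close>

lemma poly_zero_pderiv_frobenius:
  fixes m :: "'a::field poly"
  assumes m: "pderiv m = 0" "degree m > 0" "poly_over k m" and k: "is_subfield k"
  shows "CHAR('a) \<noteq> 0 \<and> (\<exists>g. poly_over k g \<and> g \<noteq> 0 \<and> degree g < degree m \<and> (\<forall>x. poly g (x ^ CHAR('a)) = poly m x))"
proof -
  let ?p = "CHAR('a)" and ?d = "degree m"
  have dvd: "?p dvd i" if i: "coeff m i \<noteq> 0" for i
  proof (cases i)
    case (Suc j)
    have "of_nat i * coeff m i = 0" using arg_cong[OF m(1), of "\<lambda>p. coeff p j"] by (simp add: coeff_pderiv Suc)
    then show ?thesis using i by (simp add: of_nat_eq_0_iff_char_dvd)
  qed simp
  have pd: "?p dvd ?d" using m by (intro dvd) auto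
  then have p0: "?p \<noteq> 0" using m(2) by (metis dvd_0_left less_irrefl)
  then have "prime ?p" by (intro prime_CHAR_semidom) simp
  then have p1: "?p > 1" by (rule prime_gt_1_nat)
  let ?e = "?d div ?p"
  let ?g = "\<Sum>j\<le>?e. monom (coeff m (?p * j)) j"
  have "poly_over k ?g"
    using m(3) by (intro poly_over_sum poly_over_closed is_subfield_is_subring[OF k]) (auto simp: poly_over_def)
  moreover have cg: "coeff ?g j = (if j \<le> ?e then coeff m (?p * j) else 0)" for j by (simp add: coeff_sum coeff_monom)
  have "coeff ?g ?e = coeff m ?d" using cg[of ?e] pd by simp
  then have "?g \<noteq> 0" using m(2) by (metis coeff_0 degree_0 leading_coeff_0_iff less_irrefl)
  moreover have "degree ?g \<le> ?e" using cg by (intro degree_le) auto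
  then have "degree ?g < ?d" using p1 m(2) by (meson div_less_dividend le_less_trans)
  moreover have "poly ?g (x ^ ?p) = poly m x" for x
  proof -
    have "poly m x = (\<Sum>i\<le>?d. coeff m i * x ^ i)" by (rule poly_altdef)
    also have "\<dots> = (\<Sum>i\<in>(\<lambda>j. ?p * j) ` {..?e}. coeff m i * x ^ i)"
    proof (rule sum.mono_neutral_right)
      show "(\<lambda>j. ?p * j) ` {..?e} \<subseteq> {..?d}"
      proof clarsimp
        fix j assume "j \<le> ?e"
        then have "?p * j \<le> ?p * ?e" by simp
        also have "\<dots> \<le> ?d" by simp
        finally show "?p * j \<le> ?d" .
      qed
      show "\<forall>i\<in>{..?d} - (\<lambda>j. ?p * j) ` {..?e}. coeff m i * x ^ i = 0"
      proof (rule ballI, rule ccontr)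
        fix i assume i: "i \<in> {..?d} - (\<lambda>j. ?p * j) ` {..?e}" "coeff m i * x ^ i \<noteq> 0"
        then obtain j where j: "i = ?p * j" using dvd[of i] by auto
        then have "j \<le> ?e" using i p0 by (auto simp: less_eq_div_iff_mult_less_eq mult.commute)
        then show False using i j by blast
      qed
    qed auto
    also have "\<dots> = (\<Sum>j\<le>?e. coeff m (?p * j) * x ^ (?p * j))"
      using p0 by (subst sum.reindex) (auto simp: inj_on_def)
    also have "\<dots> = poly ?g (x ^ ?p)" by (simp add: poly_sum poly_monom power_mult)
    finally show ?thesis by simp
  qed
  ultimately show ?thesis using p0 by blast
qed

text \<open>Among the minimal polynomials of all these powers of \<open>x\<close>, take one of least
  degree. If its derivative vanished at the root, the derivative would be zero, and the next power
  would have a minimal polynomial of smaller degree.\<close>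

lemma separable_power_exists:
  fixes k :: "'a::field set"
  assumes k: "is_subfield k" and x: "algebraic_over k x"
  shows "\<exists>n. separable_over k (x ^ (char_exponent TYPE('a) ^ n))"
proof -
  let ?c = "char_exponent TYPE('a)"
  have alg: "algebraic_over k (x ^ i)" for i
    using is_subring_power[OF is_subfield_is_subring[OF is_subfield_algebraic_closure[OF k]]] x by simp
  let ?P = "\<lambda>(n, m). is_min_poly k (x ^ (?c ^ n)) m"
  have "\<exists>P. ?P P" using is_min_poly_exists[OF k alg] by fastforce
  then obtain n m where m: "is_min_poly k (x ^ (?c ^ n)) m" and min: "\<And>P. ?P P \<Longrightarrow> degree m \<le> degree (snd P)"
    using ex_has_least_nat[of ?P _ "\<lambda>P. degree (snd P)"] by fastforce
  have m': "poly_over k m" "poly m (x ^ (?c ^ n)) = 0" using m by (auto simp: is_min_poly_def)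
  have "poly (pderiv m) (x ^ (?c ^ n)) \<noteq> 0"
  proof
    assume z: "poly (pderiv m) (x ^ (?c ^ n)) = 0"
    have "degree (pderiv m) < degree m"
    proof -
      have "degree (pderiv m) \<le> degree m - 1"
        by (rule degree_le) (auto simp: coeff_pderiv coeff_eq_0)
      then show ?thesis using is_min_poly_degree_pos[OF m] by simp
    qed
    then have "pderiv m = 0"
      using is_min_poly_less[OF m poly_over_closed(10)[OF is_subfield_is_subring[OF k] m'(1)] z] by blast
    from poly_zero_pderiv_frobenius[OF this is_min_poly_degree_pos[OF m] m'(1) k]
    obtain g where g: "CHAR('a) \<noteq> 0" "poly_over k g" "g \<noteq> 0" "degree g < degree m"
      "\<And>x. poly g (x ^ CHAR('a)) = poly m x" by blast
    have "x ^ (?c ^ Suc n) = (x ^ (?c ^ n)) ^ CHAR('a)"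
      using g(1) by (simp add: char_exponent_def power_mult mult.commute flip: power_mult)
    then have "poly g (x ^ (?c ^ Suc n)) = 0" using g(5) m'(2) by simp
    moreover obtain m2 where m2: "is_min_poly k (x ^ (?c ^ Suc n)) m2" using is_min_poly_exists[OF k alg] by blast
    ultimately have "degree m2 \<le> degree g" using g by (auto simp: is_min_poly_def)
    then show False using min[of "(Suc n, m2)"] m2 g(4) by simp
  qed
  then show ?thesis using m' unfolding separable_over_def by blast
qed

text \<open>A further zero of the cofactor at \<open>b\<close> would make \<open>b\<close> a double
  root of \<open>g\<close>. This separates the other roots of a minimal polynomial from
  \<open>b\<close>.\<close>

lemma separable_double_root:
  fixes b :: "'a::field"
  assumes g: "poly (pderiv g) b \<noteq> 0" "g = [:- b, 1:] * n * h"
  shows "poly n b \<noteq> 0"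
proof
  assume n: "poly n b = 0"
  have "poly [:- b, 1:] b = 0" by simp
  then have "poly (pderiv g) b = 0"
    unfolding g(2) by (simp only: mult.assoc pderiv_mult poly_add poly_mult n) simp
  then show False using g(1) by blast
qed

text \<open>The classical element \<open>a + c * b\<close>; separability is required of
  \<open>b\<close> only. The minimal polynomial of \<open>b\<close> over \<open>K\<close> divides
  both \<open>g\<close> and \<open>f\<close> composed with \<open>\<theta> - c X\<close>. For
  \<open>c\<close> outside a finite set their only common root is \<open>b\<close>, and it is simple
  in \<open>g\<close>, so this minimal polynomial is linear.\<close>

lemma primitive_element_two:
  fixes k :: "'a::alg_closed_field set"
  assumes k: "is_subfield k" "infinite k" and a: "algebraic_over k a" and b: "separable_over k b"
  shows "\<exists>\<theta>. algebraic_over k \<theta> \<and> a \<in> adjoin k \<theta> \<and> b \<in> adjoin k \<theta>"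
proof -
  obtain f where f: "f \<noteq> 0" "poly_over k f" "poly f a = 0" using a by (auto simp: algebraic_over_def)
  obtain g where g: "poly_over k g" "poly g b = 0" "poly (pderiv g) b \<noteq> 0" using b by (auto simp: separable_over_def)
  have g0: "g \<noteq> 0" using g(3) by auto
  \<comment> \<open>At \<open>b' = b\<close> the quotient is \<open>0\<close> by convention, and
    \<open>0\<close> belongs to the set anyway through \<open>a' = a\<close>.\<close>
  let ?bad = "(\<lambda>(a', b'). (a' - a) / (b - b')) ` ({x. poly f x = 0} \<times> {x. poly g x = 0})"
  have "finite ?bad" using f g0 by (intro finite_imageI finite_cartesian_product poly_roots_finite)
  then obtain c where c: "c \<in> k" "c \<notin> ?bad" using k(2) by (meson finite_subset subsetI)
  define \<theta> where "\<theta> = a + c * b"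
  have alg: "algebraic_over k \<theta>"
    using is_subfieldD(3,4)[OF is_subfield_algebraic_closure[OF k(1)]] a separable_over_algebraic[OF b]
      algebraic_over_self[OF k(1) c(1)] by (simp add: \<theta>_def)
  note kr = is_subfield_is_subring[OF k(1)]
  define K where "K = adjoin k \<theta>"
  have K: "is_subfield K" "k \<subseteq> K" "\<theta> \<in> K"
    unfolding K_def using is_subfield_adjoin[OF k(1) alg] adjoin_superset[OF kr] adjoin_generator[OF kr] by auto
  note Kr = is_subfield_is_subring[OF K(1)]
  obtain n where n: "is_min_poly K b n"
    using is_min_poly_exists[OF K(1) algebraic_over_mono[OF separable_over_algebraic[OF b] K(2)]] by blast
  obtain h where h: "g = n * h" using is_min_poly_dvd[OF K(1) n poly_over_mono[OF g(1) K(2)] g(2)] by blast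
  let ?F = "pcompose f [:\<theta>, - c:]"
  have "poly_over K ?F"
    using poly_over_mono[OF f(2) K(2)] K c is_subringD[OF Kr]
    by (intro poly_over_pcompose[OF Kr]) (auto simp: poly_over_closed[OF Kr])
  moreover have "poly ?F b = 0" using f by (simp add: poly_pcompose \<theta>_def algebra_simps)
  ultimately obtain h' where h': "?F = n * h'" using is_min_poly_dvd[OF K(1) n] by blast
  have "poly n b = 0" using n by (simp add: is_min_poly_def)
  then obtain n2 where n2: "n = [:- b, 1:] * n2" by (metis dvdE poly_eq_0_iff_dvd)
  have n20: "n2 \<noteq> 0" using n2 is_min_poly_nonzero[OF n] by auto
  have "degree n2 = 0"
  proof (rule ccontr)
    assume "degree n2 \<noteq> 0"
    then obtain b' where b': "poly n2 b' = 0" using alg_closed_imp_poly_has_root[of n2] by blast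
    then have nb': "poly n b' = 0" by (simp add: n2)
    show False
    proof (cases "b' = b")
      case True
      then show False using separable_double_root[OF g(3), of n2 h] h n2 b' by simp
    next
      case False
      have "poly g b' = 0" using h nb' by simp
      moreover have "poly f (\<theta> - c * b') = 0"
        using arg_cong[OF h', of "\<lambda>p. poly p b'"] nb' by (simp add: poly_pcompose algebra_simps)
      moreover have "c = ((\<theta> - c * b') - a) / (b - b')" using False by (simp add: \<theta>_def field_simps)
      ultimately have "c \<in> ?bad" by (intro image_eqI[of _ _ "(\<theta> - c * b', b')"]) auto
      then show False using c by blast
    qed
  qed
  then obtain l where "n2 = [:l:]" by (metis degree_0_id)
  moreover have "lead_coeff n = 1" using n by (simp add: is_min_poly_def)
  ultimately have "n = [:- b, 1:]" using n2 n20 by (auto split: if_splits)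
  then have "- b \<in> K" using n by (simp add: is_min_poly_def)
  then have bK: "b \<in> K" using is_subringD(5)[OF Kr] by force
  moreover have "a = \<theta> - c * b" by (simp add: \<theta>_def)
  then have "a \<in> K" using bK K c is_subringD[OF Kr] by (simp add: subset_iff)
  ultimately show ?thesis using alg unfolding K_def by blast
qed

lemma power_adjoin:
  fixes k :: "'a::field set"
  assumes k: "is_subfield k" and x: "algebraic_over k x" and y: "y \<in> adjoin k x"
  shows "y ^ (char_exponent TYPE('a) ^ n) \<in> adjoin k (x ^ (char_exponent TYPE('a) ^ n))"
proof -
  let ?q = "char_exponent TYPE('a) ^ n"
  note kr = is_subfield_is_subring[OF k]
  have "algebraic_over k (x ^ ?q)"
    using is_subring_power[OF is_subfield_is_subring[OF is_subfield_algebraic_closure[OF k]]] x by simp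
  then have S: "is_subfield {y. y ^ ?q \<in> adjoin k (x ^ ?q)}"
    by (intro is_subfield_vimage_char_exponent_power is_subfield_adjoin k)
  have "adjoin k x \<subseteq> {y. y ^ ?q \<in> adjoin k (x ^ ?q)}"
    using is_subring_power[OF kr] adjoin_superset[OF kr] adjoin_generator[OF kr]
    by (intro adjoin_minimal is_subfield_is_subring[OF S]) auto
  then show ?thesis using y by blast
qed

text \<open>An inseparable extension with several generators need not be simple, but a common power
  of all generators lies in a simple separable extension. Each new generator costs two exponents:
  \<open>l\<close> makes it separable before it is merged with \<open>\<theta>\<close>, and
  \<open>j\<close> restores separability of the merged element \<open>\<eta>\<close>.\<close>

lemma primitive_element_power:
  fixes k :: "'a::alg_closed_field set"
  assumes k: "is_subfield k" "infinite k" and "finite X" "\<And>x. x \<in> X \<Longrightarrow> algebraic_over k x"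
  shows "\<exists>n \<theta>. separable_over k \<theta> \<and> (\<forall>x\<in>X. x ^ (char_exponent TYPE('a) ^ n) \<in> adjoin k \<theta>)"
  using assms(3,4)
proof (induction X rule: finite_induct)
  case empty
  have "separable_over k 1" unfolding separable_over_def
    using is_subfieldD[OF k(1)] by (intro exI[of _ "[:- 1, 1:]"]) (simp add: pderiv_pCons poly_over_closed[OF is_subfield_is_subring[OF k(1)]])
  then show ?case by blast
next
  case (insert x X)
  let ?c = "char_exponent TYPE('a)"
  obtain n \<theta> where \<theta>: "separable_over k \<theta>" "\<And>y. y \<in> X \<Longrightarrow> y ^ (?c ^ n) \<in> adjoin k \<theta>" using insert by auto
  obtain l where l: "separable_over k (x ^ (?c ^ l))" using separable_power_exists[OF k(1)] insert.prems by blast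
  obtain \<eta> where \<eta>: "algebraic_over k \<eta>" "\<theta> \<in> adjoin k \<eta>" "x ^ (?c ^ l) \<in> adjoin k \<eta>"
    using primitive_element_two[OF k separable_over_algebraic[OF \<theta>(1)] l] by blast
  obtain j where j: "separable_over k (\<eta> ^ (?c ^ j))" using separable_power_exists[OF k(1) \<eta>(1)] by blast
  note kr = is_subfield_is_subring[OF k(1)]
  have sub: "adjoin k \<theta> \<subseteq> adjoin k \<eta>"
    using \<eta> by (intro adjoin_minimal is_subring_adjoin kr adjoin_superset)
  note pw = is_subring_power[OF is_subring_adjoin[OF kr]]
  have "y ^ (?c ^ (n + l + j)) \<in> adjoin k (\<eta> ^ (?c ^ j))" if y: "y \<in> insert x X" for y
  proof -
    have "y ^ (?c ^ (n + l)) \<in> adjoin k \<eta>"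
    proof (cases "y = x")
      case True
      have "y ^ (?c ^ (n + l)) = (x ^ (?c ^ l)) ^ (?c ^ n)" using True by (simp add: power_add mult.commute flip: power_mult)
      then show ?thesis using pw[OF \<eta>(3)] by simp
    next
      case False
      have "y ^ (?c ^ (n + l)) = (y ^ (?c ^ n)) ^ (?c ^ l)" by (simp add: power_add flip: power_mult)
      moreover have "y ^ (?c ^ n) \<in> adjoin k \<eta>" using \<theta>(2) sub y False by blast
      ultimately show ?thesis using pw by simp
    qed
    then have "(y ^ (?c ^ (n + l))) ^ (?c ^ j) \<in> adjoin k (\<eta> ^ (?c ^ j))" by (rule power_adjoin[OF k(1) \<eta>(1)])
    then show ?thesis by (simp add: power_add flip: power_mult)
  qed
  then show ?case using j by blast
qed

subsection \<open>Invariance of the pythagorean and quadratic closures\<close>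

text \<open>
  Both closures are unions of chains of adjunctions \<open>L(s)\<close> with \<open>R L s\<close>, for different relations \<open>R\<close>.
\<close>

inductive root_chain :: "('a::field set \<Rightarrow> 'a \<Rightarrow> bool) \<Rightarrow> 'a set \<Rightarrow> 'a set \<Rightarrow> bool" for R E where
  base: "root_chain R E E"
| step: "root_chain R E L \<Longrightarrow> R L s \<Longrightarrow> s \<notin> L \<Longrightarrow> root_chain R E (generated_subfield (insert s L))"

definition root_closure :: "('a::field set \<Rightarrow> 'a \<Rightarrow> bool) \<Rightarrow> 'a set \<Rightarrow> 'a set" where
  "root_closure R E = \<Union>{L. root_chain R E L}"

lemma root_chain_subfield: "root_chain R E L \<Longrightarrow> is_subfield E \<Longrightarrow> is_subfield L"
  by (induction rule: root_chain.induct) (auto simp: is_subfield_generated_subfield)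

lemma root_chain_superset: "root_chain R E L \<Longrightarrow> E \<subseteq> L"
  by (induction rule: root_chain.induct) (use generated_subfield_superset in fastforce)+

text \<open>The roots of the second chain are adjoined on top of the first. Roots already present
  are skipped, because a chain step demands a new element.\<close>

lemma root_chain_directed:
  assumes E: "is_subfield E" and mono: "\<And>L L' s. L \<subseteq> L' \<Longrightarrow> R L s \<Longrightarrow> R L' s"
    and L2: "root_chain R E L2" and L1: "root_chain R E L1"
  shows "\<exists>L3. root_chain R E L3 \<and> L1 \<subseteq> L3 \<and> L2 \<subseteq> L3"
  using L2
proof (induction rule: root_chain.induct)
  case base
  then show ?case using L1 root_chain_superset by blast
next
  case (step L s)
  then obtain L3 where L3: "root_chain R E L3" "L1 \<subseteq> L3" "L \<subseteq> L3" by blast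
  show ?case
  proof (cases "s \<in> L3")
    case True
    then have "generated_subfield (insert s L) \<subseteq> L3"
      using L3 root_chain_subfield[OF L3(1) E] by (intro generated_subfield_minimal) auto
    then show ?thesis using L3 by blast
  next
    case False
    have "root_chain R E (generated_subfield (insert s L3))"
      using L3 mono[OF L3(3) step(2)] False by (intro root_chain.step)
    moreover have "generated_subfield (insert s L) \<subseteq> generated_subfield (insert s L3)"
      using L3 by (intro generated_subfield_mono) auto
    moreover have "L1 \<subseteq> generated_subfield (insert s L3)"
      using L3 generated_subfield_superset[of "insert s L3"] by auto
    ultimately show ?thesis by blast
  qed
qed

lemma root_closure_superset: "E \<subseteq> root_closure R E"
  unfolding root_closure_def using root_chain.base by blast

lemma root_closure_directed:
  assumes E: "is_subfield E" and mono: "\<And>L L' s. L \<subseteq> L' \<Longrightarrow> R L s \<Longrightarrow> R L' s"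
    and x: "x \<in> root_closure R E" and y: "y \<in> root_closure R E"
  shows "\<exists>L. root_chain R E L \<and> x \<in> L \<and> y \<in> L"
proof -
  obtain L1 L2 where L: "root_chain R E L1" "x \<in> L1" "root_chain R E L2" "y \<in> L2"
    using x y unfolding root_closure_def by blast
  have "\<exists>L3. root_chain R E L3 \<and> L1 \<subseteq> L3 \<and> L2 \<subseteq> L3"
    by (rule root_chain_directed[OF E mono L(3,1)])
  then show ?thesis using L by blast
qed

lemma is_subfield_root_closure:
  assumes E: "is_subfield E" and mono: "\<And>L L' s. L \<subseteq> L' \<Longrightarrow> R L s \<Longrightarrow> R L' s"
  shows "is_subfield (root_closure R E)"
  unfolding is_subfield_def
proof (intro conjI ballI)
  show "0 \<in> root_closure R E" "1 \<in> root_closure R E"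
    using root_closure_superset is_subfieldD[OF E] by blast+
  fix x y assume xy: "x \<in> root_closure R E" "y \<in> root_closure R E"
  have "\<exists>L. root_chain R E L \<and> x \<in> L \<and> y \<in> L"
    by (rule root_closure_directed[OF E mono xy])
  then obtain L where L: "root_chain R E L" "x \<in> L" "y \<in> L" by blast
  have "L \<subseteq> root_closure R E" using L unfolding root_closure_def by blast
  moreover have "x + y \<in> L" "x * y \<in> L" "- x \<in> L" "inverse x \<in> L"
    using root_chain_subfield[OF L(1) E] L unfolding is_subfield_def by blast+
  ultimately show "x + y \<in> root_closure R E" "x * y \<in> root_closure R E"
    "- x \<in> root_closure R E" "inverse x \<in> root_closure R E" by blast+
qed

lemma root_closure_closed:
  assumes E: "is_subfield E" and L: "root_chain R E L" "R L s"
  shows "s \<in> root_closure R E"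
proof (cases "s \<in> L")
  case True
  then show ?thesis using L unfolding root_closure_def by blast
next
  case False
  then have "root_chain R E (generated_subfield (insert s L))" using L by (intro root_chain.step)
  moreover have "s \<in> generated_subfield (insert s L)" using generated_subfield_superset by blast
  ultimately show ?thesis unfolding root_closure_def by blast
qed

lemma root_closure_hom_invariant:
  fixes E :: "'a::field set"
  assumes E: "is_subfield E" and mono: "\<And>L L' s. L \<subseteq> L' \<Longrightarrow> R L s \<Longrightarrow> R L' s"
    and closed: "\<And>s. R (root_closure R E) s \<Longrightarrow> s \<in> root_closure R E"
    and h: "field_hom_on UNIV h" "\<And>L s. R L s \<Longrightarrow> R (h ` L) (h s)" "h ` E \<subseteq> E"
  shows "h ` root_closure R E \<subseteq> root_closure R E"
proof -
  have S: "is_subfield (h -` root_closure R E)"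
    using h(1) is_subfield_root_closure[OF E mono] by (rule is_subfield_vimage)
  have "L \<subseteq> h -` root_closure R E" if "root_chain R E L" for L
    using that
  proof (induction rule: root_chain.induct)
    case base
    then show ?case using h(3) root_closure_superset by blast
  next
    case (step L s)
    then have "R (root_closure R E) (h s)" using mono[of "h ` L" "root_closure R E"] h(2) by blast
    then have "h s \<in> root_closure R E" by (rule closed)
    then show ?case using step by (intro generated_subfield_minimal S) auto
  qed
  then show ?thesis unfolding root_closure_def[of R E] by blast
qed

lemma pyth_closure_root_closure: "pyth_closure E = root_closure (\<lambda>L s. \<exists>a\<in>L. \<exists>b\<in>L. s\<^sup>2 = a\<^sup>2 + b\<^sup>2) E"
proof -
  have "pyth_chain E L \<longleftrightarrow> root_chain (\<lambda>L s. \<exists>a\<in>L. \<exists>b\<in>L. s\<^sup>2 = a\<^sup>2 + b\<^sup>2) E L" for L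
  proof
    show "pyth_chain E L \<Longrightarrow> root_chain (\<lambda>L s. \<exists>a\<in>L. \<exists>b\<in>L. s\<^sup>2 = a\<^sup>2 + b\<^sup>2) E L"
      by (induction rule: pyth_chain.induct) (auto intro: root_chain.intros)
    show "root_chain (\<lambda>L s. \<exists>a\<in>L. \<exists>b\<in>L. s\<^sup>2 = a\<^sup>2 + b\<^sup>2) E L \<Longrightarrow> pyth_chain E L"
      by (induction rule: root_chain.induct) (auto intro: pyth_chain.intros)
  qed
  then show ?thesis by (simp add: pyth_closure_def root_closure_def)
qed

lemma quad_closure_root_closure: "quad_closure E = root_closure (\<lambda>L s. s\<^sup>2 \<in> L) E"
proof -
  have "quad_chain E L \<longleftrightarrow> root_chain (\<lambda>L s. s\<^sup>2 \<in> L) E L" for L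
  proof
    show "quad_chain E L \<Longrightarrow> root_chain (\<lambda>L s. s\<^sup>2 \<in> L) E L"
      by (induction rule: quad_chain.induct) (auto intro: root_chain.intros)
    show "root_chain (\<lambda>L s. s\<^sup>2 \<in> L) E L \<Longrightarrow> quad_chain E L"
      by (induction rule: root_chain.induct) (auto intro: quad_chain.intros)
  qed
  then show ?thesis by (simp add: quad_closure_def root_closure_def)
qed

lemma field_hom_on_UNIV:
  assumes "field_hom_on (UNIV :: 'a::field set) h"
  shows "h (x + y) = h x + h y" "h (x * y) = h x * h y" "h (x ^ n) = h x ^ n" "h (- x) = - h x"
    "h (x - y) = h x - h y" "h 0 = 0" "h 1 = 1"
  using field_hom_onD[OF is_subfield_is_subring[OF is_subfield_UNIV] assms] by auto

lemma pyth_closure_invariant: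
  fixes E :: "'a::alg_closed_field set"
  assumes E: "is_subfield E"
  shows "is_subfield (pyth_closure E)" "E \<subseteq> pyth_closure E"
    "field_hom_on UNIV h \<Longrightarrow> h ` E \<subseteq> E \<Longrightarrow> h ` pyth_closure E \<subseteq> pyth_closure E"
proof -
  let ?R = "\<lambda>L (s::'a). \<exists>a\<in>L. \<exists>b\<in>L. s\<^sup>2 = a\<^sup>2 + b\<^sup>2"
  show "is_subfield (pyth_closure E)" "E \<subseteq> pyth_closure E"
    unfolding pyth_closure_root_closure
    by (rule is_subfield_root_closure[OF E]; blast) (rule root_closure_superset)
  show "h ` pyth_closure E \<subseteq> pyth_closure E" if h: "field_hom_on UNIV h" "h ` E \<subseteq> E"
    unfolding pyth_closure_root_closure
  proof (rule root_closure_hom_invariant[OF E _ _ h(1) _ h(2)])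
    show "?R L' s" if "L \<subseteq> L'" "?R L s" for L L' s using that by blast
    show "s \<in> root_closure ?R E" if R: "?R (root_closure ?R E) s" for s
    proof -
      obtain a b where ab: "a \<in> root_closure ?R E" "b \<in> root_closure ?R E" "s\<^sup>2 = a\<^sup>2 + b\<^sup>2" using R by blast
      have "\<exists>L. root_chain ?R E L \<and> a \<in> L \<and> b \<in> L"
        by (rule root_closure_directed[OF E _ ab(1,2)]) blast
      then obtain L where L: "root_chain ?R E L" "a \<in> L" "b \<in> L" by blast
      then show ?thesis using ab(3) by (intro root_closure_closed[OF E L(1)]) blast
    qed
    show "?R (h ` L) (h s)" if R: "?R L s" for L s
    proof -
      obtain a b where ab: "a \<in> L" "b \<in> L" "s\<^sup>2 = a\<^sup>2 + b\<^sup>2" using R by blast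
      have "(h s)\<^sup>2 = (h a)\<^sup>2 + (h b)\<^sup>2"
        using arg_cong[OF ab(3), of h] by (simp add: field_hom_on_UNIV[OF h(1)])
      then show ?thesis using ab by blast
    qed
  qed
qed

lemma quad_closure_invariant:
  fixes E :: "'a::alg_closed_field set"
  assumes E: "is_subfield E"
  shows "is_subfield (quad_closure E)" "E \<subseteq> quad_closure E"
    "field_hom_on UNIV h \<Longrightarrow> h ` E \<subseteq> E \<Longrightarrow> h ` quad_closure E \<subseteq> quad_closure E"
proof -
  let ?R = "\<lambda>L (s::'a). s\<^sup>2 \<in> L"
  show "is_subfield (quad_closure E)" "E \<subseteq> quad_closure E"
    unfolding quad_closure_root_closure
    by (rule is_subfield_root_closure[OF E]; blast) (rule root_closure_superset)
  show "h ` quad_closure E \<subseteq> quad_closure E" if h: "field_hom_on UNIV h" "h ` E \<subseteq> E"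
    unfolding quad_closure_root_closure
  proof (rule root_closure_hom_invariant[OF E _ _ h(1) _ h(2)])
    show "?R L' s" if "L \<subseteq> L'" "?R L s" for L L' s using that by blast
    show "s \<in> root_closure ?R E" if R: "?R (root_closure ?R E) s" for s
      using R root_closure_closed[OF E, of ?R _ s] unfolding root_closure_def[of ?R E] by blast
    show "?R (h ` L) (h s)" if "?R L s" for L s
      using that by (metis field_hom_on_UNIV(3)[OF h(1)] image_eqI)
  qed
qed

text \<open>The image \<open>h x\<close> is a root of the minimal polynomial of \<open>x\<close>,
  all of whose roots lie in \<open>E\<close>.\<close>

lemma normal_extension_invariant:
  assumes n: "normal_extension F E" and h: "field_hom_on UNIV h" "\<And>x. x \<in> F \<Longrightarrow> h x = x"
  shows "h ` E \<subseteq> E"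
proof
  fix y assume "y \<in> h ` E"
  then obtain x where x: "x \<in> E" "y = h x" by blast
  from n have a: "algebraic_extension F E" by (simp add: normal_extension_def)
  then have F: "is_subfield F" and alg: "algebraic_over F x"
    using x by (auto simp: algebraic_extension_def field_extension_def algebraic_over_def)
  obtain p where p: "is_min_poly F x p" using is_min_poly_exists[OF F alg] by blast
  then obtain A where A: "set_mset A \<subseteq> E" "p = (\<Prod>a\<in>#A. [:- a, 1:])"
    using n x unfolding normal_extension_def by blast
  have p': "poly_over F p" "poly p x = 0" using p by (auto simp: is_min_poly_def)
  have "h (poly p x) = poly (map_poly h p) (h x)"
    by (rule field_hom_on_poly[OF is_subfield_is_subring[OF is_subfield_UNIV] h(1)]) auto
  also have "map_poly h p = p" using h(2) p'(1) by (rule map_poly_fix)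
  finally have "poly p (h x) = 0" using p' field_hom_on_UNIV[OF h(1)] by simp
  then have "(\<Prod>a\<in>#A. poly [:- a, 1:] (h x)) = 0" unfolding A(2) by (simp add: poly_prod_mset image_mset.compositionality o_def)
  then have "h x \<in># A" by (auto simp: prod_mset_zero_iff)
  then show "y \<in> E" using A x by auto
qed

subsection \<open>Non-pythagorean extensions\<close>

text \<open>On a finite \<open>A\<close> the product of all \<open>X - a\<close> would vanish
  everywhere, against the existence of nonzero values. Infinity is needed to find primitive
  elements.\<close>

lemma (in euclidean_subring) infinite_quot_field: "infinite quot_field"
proof
  assume "finite quot_field"
  then have A: "finite A" using quot_field_superset finite_subset by blast
  let ?m = "\<Prod>a\<in>A. [:- a, 1:]"
  have m: "poly_over A ?m"
    using ring by (intro poly_over_prod[OF subring]) (auto simp: poly_over_closed[OF subring])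
  have "degree ?m = card A" by (subst degree_prod_eq_sum_degree) auto
  then have "degree ?m > 0" using A ring by (auto simp: card_gt_0_iff)
  then obtain x where x: "x \<in> A" "poly ?m (0 + 1 * x) \<noteq> 0"
    using nonunit_value[OF m, of 0 1 1] ring by auto
  then show False using A by (simp add: poly_prod prod_zero_iff)
qed

lemma field_hom_on_id: "field_hom_on k (\<lambda>x. x)"
  by (simp add: field_hom_on_def)

text \<open>Some separable power \<open>\<beta>\<close> of \<open>\<alpha>\<close> lies outside
  \<open>N\<close>, so its minimal polynomial has a second root. Sending \<open>\<beta>\<close>
  there extends to the ambient field, and a map that moves \<open>\<beta>\<close> moves
  \<open>\<alpha>\<close>.\<close>

lemma moving_automorphism_exists:
  fixes N :: "'a::alg_closed_field set"
  assumes N: "is_subfield N" and alg: "\<And>x. algebraic_over N x"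
    and \<alpha>: "\<And>n. \<alpha> ^ (char_exponent TYPE('a) ^ n) \<notin> N"
  shows "\<exists>\<sigma>. field_hom_on UNIV \<sigma> \<and> (\<forall>x\<in>N. \<sigma> x = x) \<and> \<sigma> \<alpha> \<noteq> \<alpha>"
proof -
  obtain l where l: "separable_over N (\<alpha> ^ (char_exponent TYPE('a) ^ l))"
    using separable_power_exists[OF N alg] by blast
  define \<beta> where "\<beta> = \<alpha> ^ (char_exponent TYPE('a) ^ l)"
  obtain g where g: "poly_over N g" "poly g \<beta> = 0" "poly (pderiv g) \<beta> \<noteq> 0"
    using l by (auto simp: separable_over_def \<beta>_def)
  obtain m where m: "is_min_poly N \<beta> m" using is_min_poly_exists[OF N alg] by blast
  then have m': "poly_over N m" "lead_coeff m = 1" "poly m \<beta> = 0" by (auto simp: is_min_poly_def)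
  obtain h where h: "g = m * h" using is_min_poly_dvd[OF N m g(1,2)] by blast
  obtain n where n: "m = [:- \<beta>, 1:] * n" using m'(3) by (metis dvdE poly_eq_0_iff_dvd)
  have n0: "n \<noteq> 0" using n m'(2) by auto
  have "degree n \<noteq> 0"
  proof
    assume "degree n = 0"
    then obtain c where "n = [:c:]" by (metis degree_0_id)
    then have "m = [:- \<beta>, 1:]" using n n0 m'(2) by (auto split: if_splits)
    then have "- \<beta> \<in> N" using m'(1) by simp
    then have "\<beta> \<in> N" using is_subfieldD(5)[OF N] by force
    then show False using \<alpha> by (simp add: \<beta>_def)
  qed
  then obtain \<beta>' where \<beta>': "poly n \<beta>' = 0" using alg_closed_imp_poly_has_root[of n] by blast
  have "\<beta>' \<noteq> \<beta>" using separable_double_root[OF g(3), of n h] h n \<beta>' by auto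
  have "map_poly (\<lambda>x. x) m = m" by simp
  then have "poly (map_poly (\<lambda>x. x) m) \<beta>' = 0" using n \<beta>' by simp
  from field_hom_extends_adjoin[OF N field_hom_on_id m this]
  obtain \<psi> where \<psi>: "field_hom_on (adjoin N \<beta>) \<psi>" "\<forall>x\<in>N. \<psi> x = x" "\<psi> \<beta> = \<beta>'" by blast
  note Nr = is_subfield_is_subring[OF N]
  have sub: "N \<subseteq> adjoin N \<beta>" "\<beta> \<in> adjoin N \<beta>" using adjoin_superset[OF Nr] adjoin_generator[OF Nr] by blast+
  have "\<exists>\<sigma>. field_hom_on UNIV \<sigma> \<and> (\<forall>x\<in>adjoin N \<beta>. \<sigma> x = \<psi> x)"
    using algebraic_over_mono[OF alg sub(1)]
    by (intro field_hom_extends is_subfield_adjoin N alg is_subfield_UNIV \<psi>) auto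
  then obtain \<sigma> where \<sigma>: "field_hom_on UNIV \<sigma>" "\<forall>x\<in>adjoin N \<beta>. \<sigma> x = \<psi> x" by blast
  have "\<sigma> \<beta> \<noteq> \<beta>" using \<sigma> \<psi> sub \<open>\<beta>' \<noteq> \<beta>\<close> by auto
  then have "\<sigma> \<alpha> \<noteq> \<alpha>" unfolding \<beta>_def using field_hom_on_UNIV(3)[OF \<sigma>(1)] by metis
  then show ?thesis using \<sigma> \<psi> sub by (intro exI[of _ \<sigma>]) auto
qed

text \<open>Used to show that a square root lies in \<open>D\<close>: outside \<open>D\<close> it
  has minimal polynomial \<open>X^2 - w^2\<close>, so its sign can be changed over
  \<open>D\<close>.\<close>

lemma sqrt_flip_exists:
  fixes D :: "'a::alg_closed_field set"
  assumes D: "is_subfield D" and alg: "\<And>x. algebraic_over D x" and w: "w\<^sup>2 \<in> D" "w \<notin> D"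
  shows "\<exists>a. field_hom_on UNIV a \<and> (\<forall>x\<in>D. a x = x) \<and> a w = - w"
proof -
  note Dr = is_subfield_is_subring[OF D]
  let ?m = "[:- (w\<^sup>2), 0, 1:]"
  have m: "is_min_poly D w ?m" unfolding is_min_poly_def
  proof (intro conjI allI impI)
    show "poly_over D ?m" using w is_subfieldD[OF D] by (simp add: poly_over_closed[OF Dr])
    show "poly ?m w = 0" by (simp add: power2_eq_square)
    show "degree ?m \<le> degree q" if q: "q \<noteq> 0" "poly_over D q" "poly q w = 0" for q
    proof (rule ccontr)
      assume "\<not> degree ?m \<le> degree q"
      then have "degree q \<le> 1" by simp
      then obtain a b where ab: "q = [:a, b:]" by (metis degree_eq_zeroE le_Suc_eq le_zero_eq One_nat_def degree1_coeffs pCons_0_0)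
      then have "a \<in> D" "b \<in> D" "a + w * b = 0" using q by auto
      moreover from this have "b \<noteq> 0" using q ab by auto
      ultimately have "w = - a / b" by (simp add: field_simps eq_neg_iff_add_eq_0)
      then show False using w(2) is_subfield_divide[OF D] is_subfieldD(5)[OF D] \<open>a \<in> D\<close> \<open>b \<in> D\<close> by simp
    qed
  qed simp
  have "poly (map_poly (\<lambda>x. x) ?m) (- w) = 0" by (simp add: power2_eq_square)
  from field_hom_extends_adjoin[OF D field_hom_on_id m this]
  obtain \<psi> where \<psi>: "field_hom_on (adjoin D w) \<psi>" "\<forall>x\<in>D. \<psi> x = x" "\<psi> w = - w" by blast
  have sub: "D \<subseteq> adjoin D w" "w \<in> adjoin D w" using adjoin_superset[OF Dr] adjoin_generator[OF Dr] by blast+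
  have "\<exists>a. field_hom_on UNIV a \<and> (\<forall>x\<in>adjoin D w. a x = \<psi> x)"
    using algebraic_over_mono[OF alg sub(1)]
    by (intro field_hom_extends is_subfield_adjoin D alg is_subfield_UNIV \<psi>) auto
  then show ?thesis using \<psi> sub by (metis subsetD)
qed

text \<open>All roots of one polynomial per element form a finite set, and a map fixing the
  coefficients preserves it.\<close>

lemma finite_root_set_exists:
  fixes F :: "'a::field set"
  assumes "finite X" "\<And>x. x \<in> X \<Longrightarrow> algebraic_over F x"
  shows "\<exists>R. finite R \<and> X \<subseteq> R \<and>
    (\<forall>h. field_hom_on UNIV h \<longrightarrow> (\<forall>x\<in>F. h x = x) \<longrightarrow> h ` R \<subseteq> R)"
proof -
  obtain f where f: "\<And>x. x \<in> X \<Longrightarrow> f x \<noteq> 0 \<and> poly_over F (f x) \<and> poly (f x) x = 0"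
    using assms(2) unfolding algebraic_over_def by metis
  let ?R = "\<Union>x\<in>X. {y. poly (f x) y = 0}"
  have "finite ?R" using assms(1) f by (auto intro!: poly_roots_finite)
  moreover have "X \<subseteq> ?R" using f by auto
  moreover have "h y \<in> ?R" if h: "field_hom_on UNIV h" "\<forall>x\<in>F. h x = x" and y: "y \<in> ?R" for h y
  proof -
    obtain x where x: "x \<in> X" "poly (f x) y = 0" using y by blast
    have "h (poly (f x) y) = poly (map_poly h (f x)) (h y)"
      by (rule field_hom_on_poly[OF is_subfield_is_subring[OF is_subfield_UNIV] h(1)]) auto
    also have "map_poly h (f x) = f x" using h(2) f[OF x(1)] by (intro map_poly_fix[of F]) auto
    finally have "poly (f x) (h y) = 0" using x field_hom_on_UNIV[OF h(1)] by simp
    then show ?thesis using x by blast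
  qed
  ultimately show ?thesis by (intro exI[of _ ?R]) blast
qed

text \<open>Two fields share the work. Square roots are located in \<open>D\<close>, which contains
  \<open>F\<close> and the chosen roots but may be inseparable over the field of fractions of
  \<open>A\<close>. Valuations are taken in the separable simple extension \<open>P\<close>, which
  contains the \<open>q\<close>-th powers of the elements of \<open>D\<close>.\<close>

lemma not_closed_under_sqrt_sum_squares:
  fixes F N M :: "'a::alg_closed_field set"
  assumes char: "CHAR('a) \<noteq> 2"
    and A: "euclidean_subring A \<delta>"
    and F: "is_subfield F" "euclidean_subring.quot_field A \<subseteq> F"
    and S: "finite S" "\<And>x. x \<in> S \<Longrightarrow> algebraic_over (euclidean_subring.quot_field A) x"
      "F = generated_subfield (euclidean_subring.quot_field A \<union> S)"
    and alg: "\<And>x. algebraic_over F x"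
    and N: "is_subfield N" "F \<subseteq> N"
      "\<And>h. field_hom_on UNIV h \<Longrightarrow> (\<And>x. x \<in> F \<Longrightarrow> h x = x) \<Longrightarrow> h ` N \<subseteq> N"
    and M: "is_subfield M" "N \<subseteq> M" "finite B" "M \<subseteq> generated_subfield (N \<union> B)"
    and \<alpha>: "\<alpha> \<in> M" "\<And>n. \<alpha> ^ (char_exponent TYPE('a) ^ n) \<notin> N"
  shows "\<exists>x\<in>M. \<forall>z\<in>M. 1 + x\<^sup>2 \<noteq> z\<^sup>2"
proof (rule ccontr)
  assume neg: "\<not> ?thesis"
  interpret euclidean_subring A \<delta> by (rule A)
  note Q = is_subfield_quot_field
  let ?c = "char_exponent TYPE('a)"
  have two: "(2::'a) \<noteq> 0"
  proof
    assume "(2::'a) = 0"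
    then have "of_nat 2 = (0::'a)" by simp
    then have "CHAR('a) dvd 2" by (simp only: of_nat_eq_0_iff_char_dvd)
    then have "CHAR('a) \<le> 2" by (rule dvd_imp_le) simp
    then show False using char CHAR_not_1'[where 'a = 'a] \<open>CHAR('a) dvd 2\<close> by (cases "CHAR('a)") auto
  qed
  have neg_eq: "x = 0" if "x = - x" for x :: 'a
  proof -
    have "2 * x = x + x" by (rule mult_2)
    also have "\<dots> = 0" using that by (metis add.right_inverse)
    finally show ?thesis using two by simp
  qed
  obtain i :: 'a where i: "i\<^sup>2 = - 1" using nth_root_exists[of 2 "- 1"] by auto
  have algQ: "algebraic_over quot_field x" for x
  proof (rule algebraic_over_trans[OF Q F(1) _ alg])
    have gens: "algebraic_over quot_field y" if "y \<in> quot_field \<union> S" for y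
      using that S(2) algebraic_over_self[OF Q] by blast
    show "algebraic_over quot_field y" if y: "y \<in> F" for y
      by (rule algebraic_over_generated[OF Q gens y[unfolded S(3)]])
  qed
  have algN: "algebraic_over N x" for x using algebraic_over_mono[OF alg N(2)] .
  obtain \<sigma> where \<sigma>: "field_hom_on UNIV \<sigma>" "\<And>x. x \<in> N \<Longrightarrow> \<sigma> x = x" "\<sigma> \<alpha> \<noteq> \<alpha>"
    using moving_automorphism_exists[OF N(1) algN \<alpha>(2)] by blast
  note \<sigma>h = field_hom_on_UNIV[OF \<sigma>(1)]
  have "finite (insert \<alpha> (insert i B))" using M(3) by simp
  from finite_root_set_exists[OF this alg]
  obtain R where R': "finite R" "insert \<alpha> (insert i B) \<subseteq> R"
    "\<forall>h. field_hom_on UNIV h \<longrightarrow> (\<forall>x\<in>F. h x = x) \<longrightarrow> h ` R \<subseteq> R" by blast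
  then have R: "finite R" "\<alpha> \<in> R" "i \<in> R" "B \<subseteq> R" by simp_all
  have R5: "h ` R \<subseteq> R" if "field_hom_on UNIV h" "\<And>x. x \<in> F \<Longrightarrow> h x = x" for h
    using R'(3) that by blast
  have "finite (R \<union> S)" using R S by simp
  then obtain n \<theta> where \<theta>: "separable_over quot_field \<theta>"
    "\<And>x. x \<in> R \<union> S \<Longrightarrow> x ^ (?c ^ n) \<in> adjoin quot_field \<theta>"
    using primitive_element_power[OF Q infinite_quot_field _ algQ, of "R \<union> S"] by blast
  define q where "q = ?c ^ n"
  have q: "odd q" unfolding q_def by (rule char_exponent_odd[OF char])
  define P where "P = adjoin quot_field \<theta>"
  have P: "is_subfield P" unfolding P_def by (rule is_subfield_adjoin[OF Q algQ])
  have PR: "x ^ q \<in> P" if "x \<in> R" for x using \<theta>(2) that by (simp add: P_def q_def)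
  have QP: "quot_field \<subseteq> P" unfolding P_def by (rule adjoin_superset[OF is_subfield_is_subring[OF Q]])
  define D where "D = generated_subfield (F \<union> R)"
  have D: "is_subfield D" "F \<subseteq> D" "R \<subseteq> D"
    unfolding D_def using is_subfield_generated_subfield generated_subfield_superset[of "F \<union> R"] by auto
  have powP: "is_subfield {y. y ^ q \<in> P}"
    unfolding q_def by (rule is_subfield_vimage_char_exponent_power[OF P])
  have DP: "y ^ q \<in> P" if "y \<in> D" for y
  proof -
    have "x \<in> quot_field \<Longrightarrow> x ^ q \<in> P" for x
      using QP is_subring_power[OF is_subfield_is_subring[OF P]] by blast
    then have "F \<subseteq> {y. y ^ q \<in> P}"
      unfolding S(3) using \<theta>(2) by (intro generated_subfield_minimal powP) (auto simp: P_def q_def)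
    then have "D \<subseteq> {y. y ^ q \<in> P}"
      unfolding D_def using PR by (intro generated_subfield_minimal powP) auto
    then show ?thesis using that by blast
  qed
  \<comment> \<open>The power is taken before sums of squares are formed, so that the four linear
    factors have their roots in \<open>P\<close>.\<close>
  define \<alpha>1 where "\<alpha>1 = \<alpha> ^ q"
  define \<alpha>2 where "\<alpha>2 = \<sigma> \<alpha> ^ q"
  have \<sigma>\<alpha>: "\<sigma> \<alpha>1 = \<alpha>2" by (simp add: \<alpha>1_def \<alpha>2_def \<sigma>h)
  have \<sigma>R: "\<sigma> x \<in> R" if "x \<in> R" for x using R5[OF \<sigma>(1)] \<sigma>(2) N(2) that by blast
  have \<alpha>12: "\<alpha>1 \<noteq> \<alpha>2" unfolding \<alpha>1_def \<alpha>2_def q_def using char_exponent_power_inj \<sigma>(3) by metis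
  have \<alpha>P: "\<alpha>1 \<in> P" "\<alpha>2 \<in> P" using PR R(2) \<sigma>R by (auto simp: \<alpha>1_def \<alpha>2_def)
  have \<alpha>D: "\<alpha>1 \<in> D" "\<alpha>2 \<in> D" using is_subring_power[OF is_subfield_is_subring[OF D(1)]] D(3) R(2) \<sigma>R
    by (auto simp: \<alpha>1_def \<alpha>2_def subset_iff)
  define j where "j = i ^ q"
  have "j\<^sup>2 = (i\<^sup>2) ^ q" by (simp add: j_def mult.commute flip: power_mult)
  then have j: "j\<^sup>2 = - 1" "j \<in> P" using q PR[OF R(3)] by (simp_all add: i j_def)
  have j0: "j \<noteq> 0" using j(1) by auto
  \<comment> \<open>The sign avoids the coincidence of \<open>\<alpha>1 + \<iota>\<close> with
    \<open>\<alpha>2 - \<iota>\<close>. It cannot occur for both signs, since \<open>2 * j\<close>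
    and \<open>- 2 * j\<close> differ.\<close>
  define \<iota> where "\<iota> = (if \<alpha>2 - \<alpha>1 = 2 * j then - j else j)"
  have \<iota>: "\<iota>\<^sup>2 = - 1" "\<iota> \<in> P" "\<iota> \<noteq> 0" using j j0 is_subfieldD(5)[OF P] by (auto simp: \<iota>_def)
  have \<iota>2: "\<alpha>2 - \<alpha>1 \<noteq> 2 * \<iota>"
  proof (cases "\<alpha>2 - \<alpha>1 = 2 * j")
    case True
    have "2 * j \<noteq> 2 * - j" using neg_eq[of "2 * j"] two j0 by auto
    then show ?thesis using True by (simp add: \<iota>_def)
  qed (simp add: \<iota>_def)
  define rs where "rs = [\<alpha>1 - \<iota>, \<alpha>2 + \<iota>, \<alpha>2 - \<iota>]"
  have "\<alpha>1 + \<iota> \<noteq> \<alpha>1 - \<iota>"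
    using neg_eq[of \<iota>] \<iota>(3) by (metis add_left_cancel diff_conv_add_uminus)
  moreover have "\<alpha>1 + \<iota> \<noteq> \<alpha>2 - \<iota>"
  proof
    assume eq: "\<alpha>1 + \<iota> = \<alpha>2 - \<iota>"
    have "\<alpha>2 - \<alpha>1 = (\<alpha>2 - \<iota>) + \<iota> - \<alpha>1" by simp
    also have "\<dots> = \<iota> + \<iota>" unfolding eq[symmetric] by (simp only: add.assoc add_diff_cancel_left')
    also have "\<dots> = 2 * \<iota>" by (rule mult_2[symmetric])
    finally show False using \<iota>2 by blast
  qed
  moreover have "\<alpha>1 + \<iota> \<noteq> \<alpha>2 + \<iota>" using \<alpha>12 by simp
  ultimately have rs: "\<alpha>1 + \<iota> \<notin> set rs" by (simp add: rs_def)
  have rsP: "\<alpha>1 + \<iota> \<in> P" "\<alpha>1 - \<iota> \<in> P" "\<alpha>2 + \<iota> \<in> P" "\<alpha>2 - \<iota> \<in> P"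
    using \<alpha>P \<iota>(2) is_subfieldD(3,6)[OF P] by blast+
  then have "set rs \<subseteq> P" by (simp add: rs_def)
  obtain f where f: "poly_over quot_field f" "poly f \<theta> = 0" "poly (pderiv f) \<theta> \<noteq> 0"
    using \<theta>(1) by (auto simp: separable_over_def)
  obtain s where s: "s \<in> A"
    and nonsq: "\<forall>w\<in>P. ((s - (\<alpha>1 + \<iota>)) * (\<Prod>x\<leftarrow>rs. s - x)) ^ q \<noteq> w ^ 2"
    using exists_nonsquare_value[OF f rsP(1)[unfolded P_def] \<open>set rs \<subseteq> P\<close>[unfolded P_def] rs q]
    unfolding P_def by blast
  have factor: "(s - (x + \<iota>)) * (s - (x - \<iota>)) = 1 + (s - x)\<^sup>2" for x
  proof -
    have "(s - (x + \<iota>)) * (s - (x - \<iota>)) = (s - x)\<^sup>2 - \<iota>\<^sup>2" by (simp add: power2_eq_square algebra_simps)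
    then show ?thesis using \<iota>(1) by simp
  qed
  have "(s - (\<alpha>1 + \<iota>)) * (\<Prod>x\<leftarrow>rs. s - x)
      = ((s - (\<alpha>1 + \<iota>)) * (s - (\<alpha>1 - \<iota>))) * ((s - (\<alpha>2 + \<iota>)) * (s - (\<alpha>2 - \<iota>)))"
    by (simp add: rs_def mult.assoc)
  then have H: "(s - (\<alpha>1 + \<iota>)) * (\<Prod>x\<leftarrow>rs. s - x) = (1 + (s - \<alpha>1)\<^sup>2) * (1 + (s - \<alpha>2)\<^sup>2)"
    by (simp only: factor)
  have sF: "s \<in> F" using s quot_field_superset F(2) by blast
  have "s - \<alpha>1 \<in> M"
    using sF N(2) M(2) \<alpha>(1) is_subring_power[OF is_subfield_is_subring[OF M(1)]]
    unfolding \<alpha>1_def by (intro is_subfieldD[OF M(1)]) auto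
  then obtain z where z: "z \<in> M" "1 + (s - \<alpha>1)\<^sup>2 = z\<^sup>2" using neg by blast
  have \<sigma>s: "\<sigma> s = s" using sF N(2) \<sigma>(2) by blast
  have \<sigma>z: "1 + (s - \<alpha>2)\<^sup>2 = (\<sigma> z)\<^sup>2"
    using arg_cong[OF z(2), of \<sigma>] by (simp add: \<sigma>h \<sigma>\<alpha> \<sigma>s)
  define w where "w = z * \<sigma> z"
  have w2: "w\<^sup>2 = (1 + (s - \<alpha>1)\<^sup>2) * (1 + (s - \<alpha>2)\<^sup>2)" by (simp add: w_def power_mult_distrib z \<sigma>z)
  have sD: "s - \<alpha>1 \<in> D" "s - \<alpha>2 \<in> D" using sF D(2) \<alpha>D is_subfieldD(6)[OF D(1)] by blast+
  have "w \<in> D"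
  proof (rule ccontr)
    assume wD: "w \<notin> D"
    have "w\<^sup>2 \<in> D" unfolding w2
      by (intro is_subfieldD(2-4)[OF D(1)] is_subring_power[OF is_subfield_is_subring[OF D(1)]] sD)
    from sqrt_flip_exists[OF D(1) algebraic_over_mono[OF alg D(2)] this wD]
    obtain a where a: "field_hom_on UNIV a" "\<And>x. x \<in> D \<Longrightarrow> a x = x" "a w = - w" by blast
    note ah = field_hom_on_UNIV[OF a(1)]
    have aN: "a x \<in> N" if "x \<in> N" for x using N(3)[OF a(1)] a(2) D(2) that by blast
    \<comment> \<open>The two composites agree on a subfield, so \<open>N\<close> and
      \<open>B\<close> can be checked separately. On \<open>N\<close> the map
      \<open>\<sigma>\<close> is the identity and \<open>a\<close> stays inside; on \<open>B\<close>
      the map \<open>a\<close> is the identity and \<open>\<sigma>\<close> stays inside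
      \<open>R\<close>.\<close>
    have comm: "is_subfield {y. a (\<sigma> y) = \<sigma> (a y)}"
      unfolding is_subfield_def
      using field_hom_on_inverse[OF is_subfield_UNIV a(1)] field_hom_on_inverse[OF is_subfield_UNIV \<sigma>(1)]
      by (simp add: ah \<sigma>h)
    have "N \<union> B \<subseteq> {y. a (\<sigma> y) = \<sigma> (a y)}"
      using \<sigma>(2) aN a(2) D(3) R(4) \<sigma>R by (auto simp: subset_iff)
    then have "generated_subfield (N \<union> B) \<subseteq> {y. a (\<sigma> y) = \<sigma> (a y)}"
      by (rule generated_subfield_minimal[OF comm])
    then have az: "a (\<sigma> z) = \<sigma> (a z)" using z(1) M(4) by blast
    have "(a z)\<^sup>2 = a (1 + (s - \<alpha>1)\<^sup>2)" unfolding z(2) by (simp add: ah)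
    also have "\<dots> = z\<^sup>2" unfolding z(2)[symmetric] by (simp only: ah(1,3,7) a(2)[OF sD(1)])
    finally have "a z = z \<or> a z = - z" by (simp add: power2_eq_iff)
    then have "a w = w" unfolding w_def ah az by (auto simp: \<sigma>h)
    then have "w = 0" using a(3) neg_eq[of w] by simp
    then show False using wD is_subfieldD(1)[OF D(1)] by simp
  qed
  \<comment> \<open>Passing from \<open>D\<close> to \<open>P\<close> preserves squares: the
    \<open>q\<close>-th power of \<open>w\<^sup>2\<close> is the square of \<open>w ^ q\<close>,
    which lies in \<open>P\<close>.\<close>
  then have "w ^ q \<in> P" by (rule DP)
  moreover have "(w\<^sup>2) ^ q = (w ^ q)\<^sup>2" by (metis mult.commute power_mult)
  ultimately show False using nonsq unfolding H w2[symmetric] by blast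
qed

lemma CHAR_field_hom:
  fixes h :: "'a::field \<Rightarrow> 'b::field"
  assumes N: "is_subfield N" and h: "field_hom_on N h"
  shows "CHAR('b) = CHAR('a)"
proof -
  note Nr = is_subfield_is_subring[OF N]
  note D = field_hom_onD[OF Nr h]
  have nat: "h (of_nat n) = of_nat n" for n
    by (induction n) (auto simp: D is_subringD(2)[OF Nr] is_subring_of_nat[OF Nr])
  have "(of_nat n = (0::'b)) \<longleftrightarrow> (of_nat n = (0::'a))" for n
    using nat[of n] D(1) inj_onD[OF field_hom_on_inj_on[OF N h], of "of_nat n" 0]
      is_subring_of_nat[OF Nr] is_subringD(1)[OF Nr] by force
  then have "CHAR('b) dvd n \<longleftrightarrow> CHAR('a) dvd n" for n by (simp add: of_nat_eq_0_iff_char_dvd)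
  then show ?thesis by (meson dvd_antisym dvd_refl)
qed

text \<open>The extension \<open>K\<close> lives in another type. The inverse of \<open>h\<close>
  extends to an embedding \<open>\<psi>\<close> of \<open>K\<close> into the ambient field, because
  that field is algebraically closed; this replaces \<open>K\<close> by a subfield \<open>M\<close>
  that contains \<open>N\<close> itself.\<close>

lemma invariant_imp_hereditarily_non_pythagorean:
  fixes F N :: "'a::alg_closed_field set"
  assumes F: "number_field F \<or>
              (is_subfield F \<and> CHAR('a) \<noteq> 2 \<and>
               (\<exists>k. finitely_generated_extension k F \<and> transcendence_degree k F \<ge> 1))"
    and alg: "\<And>x. algebraic_over F x"
    and N: "is_subfield N" "F \<subseteq> N"
      "\<And>h. field_hom_on UNIV h \<Longrightarrow> (\<And>x. x \<in> F \<Longrightarrow> h x = x) \<Longrightarrow> h ` N \<subseteq> N"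
  shows "hereditarily_non_pythagorean TYPE('b::field) N"
  unfolding hereditarily_non_pythagorean_def
proof (intro allI impI notI)
  fix h :: "'a \<Rightarrow> 'b" and K
  assume h: "field_hom_on N h" and fin: "finite_extension (h ` N) K" and "h ` N \<noteq> K"
    and insep: "\<not> purely_inseparable_extension (h ` N) K" and pyth: "pythagorean K"
  have "CHAR('a) \<noteq> 2" using F by (auto simp: number_field_def)
  moreover have "\<exists>A \<delta> S. euclidean_subring A \<delta> \<and> is_subfield F \<and> euclidean_subring.quot_field A \<subseteq> F \<and> finite S \<and>
    (\<forall>x\<in>S. algebraic_over (euclidean_subring.quot_field A) x) \<and>
    F = generated_subfield (euclidean_subring.quot_field A \<union> S)"
    using F number_field_over_euclidean_subring function_field_over_euclidean_subring by blast
  then obtain A \<delta> S where A: "euclidean_subring A \<delta>"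
    and FA: "is_subfield F" "euclidean_subring.quot_field A \<subseteq> F"
    and S: "finite S" "\<And>x. x \<in> S \<Longrightarrow> algebraic_over (euclidean_subring.quot_field A) x"
      "F = generated_subfield (euclidean_subring.quot_field A \<union> S)" by blast
  have ext: "field_extension (h ` N) K" and K: "is_subfield (h ` N)" "is_subfield K" "h ` N \<subseteq> K"
    using fin by (auto simp: finite_extension_def field_extension_def)
  note inj = field_hom_on_inj_on[OF N(1) h]
  define \<phi> where "\<phi> = the_inv_into N h"
  have \<phi>h: "\<phi> (h x) = x" if "x \<in> N" for x unfolding \<phi>_def by (rule the_inv_into_f_f[OF inj that])
  note hD = field_hom_onD[OF is_subfield_is_subring[OF N(1)] h]
  have "field_hom_on (h ` N) \<phi>"
    unfolding field_hom_on_def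
    using \<phi>h[OF is_subfieldD(2)[OF N(1)]] is_subfieldD[OF N(1)]
    by (auto simp: hD(2) \<phi>h simp flip: hD(3,4))
  with finite_extension_algebraic[OF fin] obtain \<psi> where \<psi>: "field_hom_on K \<psi>" "\<forall>x\<in>h ` N. \<psi> x = \<phi> x"
    using field_hom_extends[OF K(1,2,3)] by blast
  note Kr = is_subfield_is_subring[OF K(2)]
  note \<psi>D = field_hom_onD[OF Kr \<psi>(1)]
  have \<psi>h: "\<psi> (h x) = x" if "x \<in> N" for x using \<psi>(2) \<phi>h that by auto
  define M where "M = \<psi> ` K"
  have M: "is_subfield M" unfolding M_def by (rule is_subfield_image[OF K(2) \<psi>(1)])
  have NM: "N \<subseteq> M"
  proof
    fix x assume "x \<in> N"
    then have "x = \<psi> (h x)" "h x \<in> K" using \<psi>h K(3) by auto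
    then show "x \<in> M" unfolding M_def by blast
  qed
  obtain B where B: "B \<subseteq> K" "finite B" "\<forall>x\<in>K. \<exists>c. c ` B \<subseteq> h ` N \<and> x = (\<Sum>b\<in>B. c b * b)"
    using fin unfolding finite_extension_def by blast
  have MB: "M \<subseteq> generated_subfield (N \<union> \<psi> ` B)"
  proof
    fix y assume "y \<in> M"
    then obtain x where x: "x \<in> K" "y = \<psi> x" by (auto simp: M_def)
    then obtain c where c: "c ` B \<subseteq> h ` N" "x = (\<Sum>b\<in>B. c b * b)" using B(3) by blast
    let ?G = "generated_subfield (N \<union> \<psi> ` B)"
    note G = is_subfield_is_subring[OF is_subfield_generated_subfield[of "N \<union> \<psi> ` B"]]
    have cK: "c b \<in> K" if "b \<in> B" for b using c(1) K(3) that by blast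
    have "\<psi> (\<Sum>b\<in>B'. c b * b) \<in> ?G" if "B' \<subseteq> B" for B'
      using finite_subset[OF that B(2)] that
    proof (induction B' rule: finite_induct)
      case empty
      then show ?case using is_subringD(1)[OF G] \<psi>D(1) by simp
    next
      case (insert b B')
      have cb: "c b \<in> K" "b \<in> K" using insert.prems cK B(1) by auto
      have sK: "(\<Sum>b\<in>B'. c b * b) \<in> K"
        using insert.prems cK B(1) by (intro is_subring_sum[OF Kr] is_subringD(4)[OF Kr]) auto
      obtain x where "x \<in> N" "c b = h x" using c(1) insert.prems by blast
      then have "\<psi> (c b) \<in> ?G" using \<psi>h generated_subfield_superset[of "N \<union> \<psi> ` B"] by auto
      moreover have "\<psi> b \<in> ?G" using insert.prems generated_subfield_superset[of "N \<union> \<psi> ` B"] by auto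
      moreover have "\<psi> (c b * b + (\<Sum>b\<in>B'. c b * b)) = \<psi> (c b) * \<psi> b + \<psi> (\<Sum>b\<in>B'. c b * b)"
        using \<psi>D(3)[OF is_subringD(4)[OF Kr cb] sK] \<psi>D(4)[OF cb] by simp
      ultimately show ?case using insert is_subringD(3,4)[OF G] by auto
    qed
    then show "y \<in> ?G" using x c(2) by blast
  qed
  \<comment> \<open>The homomorphism forces equal characteristics, so pure inseparability over the
    image of \<open>N\<close> may be tested with the characteristic exponent of the ambient
    type.\<close>
  obtain \<kappa> where \<kappa>: "\<kappa> \<in> K" "\<And>n. \<kappa> ^ (char_exponent TYPE('a) ^ n) \<notin> h ` N"
  proof -
    have "(if CHAR('b) = 0 then 1 else CHAR('b)) = char_exponent TYPE('a)"
      by (simp add: char_exponent_def CHAR_field_hom[OF N(1) h])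
    then have "\<exists>x\<in>K. \<forall>n. x ^ (char_exponent TYPE('a) ^ n) \<notin> h ` N"
      using insep ext unfolding purely_inseparable_extension_def by simp
    then show ?thesis using that by blast
  qed
  have "\<psi> \<kappa> ^ (char_exponent TYPE('a) ^ n) \<notin> N" for n
  proof
    let ?q = "char_exponent TYPE('a) ^ n"
    assume a: "\<psi> \<kappa> ^ ?q \<in> N"
    then have "\<psi> (h (\<psi> \<kappa> ^ ?q)) = \<psi> (\<kappa> ^ ?q)" using \<psi>h \<psi>D(7)[OF \<kappa>(1)] by simp
    moreover have "h (\<psi> \<kappa> ^ ?q) \<in> K" "\<kappa> ^ ?q \<in> K" using a K(3) \<kappa>(1) is_subring_power[OF Kr] by auto
    ultimately have "h (\<psi> \<kappa> ^ ?q) = \<kappa> ^ ?q" using inj_onD[OF field_hom_on_inj_on[OF K(2) \<psi>(1)]] by blast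
    then show False using \<kappa>(2)[of n] a by (metis image_eqI)
  qed
  moreover have "\<psi> \<kappa> \<in> M" using \<kappa> by (simp add: M_def)
  moreover have "finite (\<psi> ` B)" using B by simp
  ultimately have "\<exists>x\<in>M. \<forall>z\<in>M. 1 + x\<^sup>2 \<noteq> z\<^sup>2"
    using not_closed_under_sqrt_sum_squares[OF _ A FA S alg N M NM _ MB] by blast
  then obtain x where x: "x \<in> K" "\<forall>z\<in>K. 1 + (\<psi> x)\<^sup>2 \<noteq> (\<psi> z)\<^sup>2" by (auto simp: M_def)
  \<comment> \<open>Failure for the two squares of \<open>1\<close> and \<open>x\<close> already
    contradicts the closure of \<open>K\<close> under roots of sums of squares; injectivity of
    \<open>\<psi>\<close> is not at stake, as the equation is pushed forward.\<close>
  have "set [1, x] \<subseteq> K" using x is_subringD[OF Kr] by simp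
  then obtain y where y: "y \<in> K" "1 + x\<^sup>2 = y\<^sup>2" using pyth unfolding pythagorean_def by fastforce
  have "\<psi> (1 + x\<^sup>2) = 1 + (\<psi> x)\<^sup>2"
    using \<psi>D(3)[OF is_subringD(2)[OF Kr] is_subring_power[OF Kr x(1), of 2]] \<psi>D(2) \<psi>D(7)[OF x(1)] by simp
  then show False using x(2) y \<psi>D(7)[OF y(1)] by metis
qed

theorem theorem6p1:
  fixes F E :: "'a::alg_closed_field set"
  assumes F: "number_field F \<or>
              (is_subfield F \<and> CHAR('a) \<noteq> 2 \<and>
               (\<exists>k. finitely_generated_extension k F \<and> transcendence_degree k F \<ge> 1))"
    and galois: "galois_extension F E"
    and infinite_degree: "\<not> finite_extension F E"
    and ambient_is_algebraic_closure: "algebraic_extension E (UNIV :: 'a set)"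
  shows "hereditarily_non_pythagorean TYPE('b::field) (pyth_closure E) \<and>
         hereditarily_non_pythagorean TYPE('b) (quad_closure E)"
proof -
  have normal: "normal_extension F E" using galois by (simp add: galois_extension_def)
  then have "algebraic_extension F E" by (simp add: normal_extension_def)
  then have FE: "is_subfield F" "is_subfield E" "F \<subseteq> E" and algE: "\<And>x. x \<in> E \<Longrightarrow> algebraic_over F x"
    by (simp_all add: algebraic_extension_def field_extension_def algebraic_over_def)
  have "algebraic_over E x" for x
    using ambient_is_algebraic_closure by (simp add: algebraic_extension_def algebraic_over_def)
  then have alg: "algebraic_over F x" for x using algebraic_over_trans[OF FE(1,2) algE] by blast
  note pyth = pyth_closure_invariant[OF FE(2)] and quad = quad_closure_invariant[OF FE(2)]
  \<comment> \<open>Normality of \<open>E\<close> over \<open>F\<close> is what makes endomorphisms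
    over \<open>F\<close> preserve \<open>E\<close>, and hence both closures of
    \<open>E\<close>.\<close>
  have inv: "h ` pyth_closure E \<subseteq> pyth_closure E" "h ` quad_closure E \<subseteq> quad_closure E"
    if h: "field_hom_on UNIV h" "\<And>x. x \<in> F \<Longrightarrow> h x = x" for h
    using pyth(3)[OF h(1)] quad(3)[OF h(1)] normal_extension_invariant[OF normal h] by auto
  show ?thesis
    using invariant_imp_hereditarily_non_pythagorean[OF F alg pyth(1) _ inv(1)]
      invariant_imp_hereditarily_non_pythagorean[OF F alg quad(1) _ inv(2)] pyth(2) quad(2) FE(3)
    by blast
qed

end
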